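(* (a) For every $n\ge1$, the optimal (smallest) constant $K$ such that $\|DP\|_{L^2(\gamma_d;\mathbb R^d)}\le K\|P\|_{L^2(\gamma_d)}$ for all polynomials $P:\mathbb R^d\to\mathbb R$ of degree at most $n$ is $K=\sqrt n$. (b) For every integer $N\ge1$ and real $p\ge2$, the polynomial $P_N(x):=\prod_{j=1}^Nx_j$ on $\mathbb R^N$ satisfies $$\frac{\|DP_N\|_{L^p(\gamma_N;\mathbb R^N)}}{\|P_N\|_{L^p(\gamma_N)}}\ge\sqrt{\frac{N}{p-1}}.$$ (c) For every fixed $p>1$, $$\lim_{N\to\infty}\frac{\|DP_N\|_{L^p(\gamma_N;\mathbb R^N)}}{\sqrt N\,\|P_N\|_{L^p(\gamma_N)}}=\frac1{\sqrt{p-1}}.$$ Thus the estimate $\|DP\|_{L^p(\gamma_d;\mathbb R^d)}\le 2e\sqrt2\,\sqrt{n/p}\,\|P\|_{L^p(\gamma_d)}$, valid for all $d\ge 1$, $n\ge1$, $p\ge2$ and all polynomials $P:\mathbb R^d\to\mathbb R$ of degree at most $n$, has the optimal joint order in $(n,p)$ for $p\ge2$: there is a universal $c>0$ such that for all $n\ge1$ and $p\ge2$, any constant $K$ for which $\|DP\|_{L^p(\gamma_d;\mathbb R^d)}\le K\|P\|_{L^p(\gamma_d)}$ holds for all $d\ge1$ and all polynomials $P$ on $\mathbb R^d$ of degree at most $n$ satisfies $K\ge c\sqrt{n/p}$.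
   Context: $\gamma_d$ is the standard Gaussian measure on $\mathbb R^d$. $DP$ is the gradient of $P$, and $\|DP\|_{L^p(\gamma_d;\mathbb R^d)}=\bigl(\int|DP|^p\,d\gamma_d\bigr)^{1/p}$ with $|\cdot|$ the Euclidean norm. *)

theory Defs
  imports "HOL-Probability.Probability"
begin

text \<open>
  The dimension varies inside the statement, so a point of \<open>\<real>\<^sup>d\<close> is a function
  \<open>x :: nat \<Rightarrow> real\<close> of which only the coordinates \<open>x 0, \<dots>, x (d - 1)\<close> matter; the
  coordinates \<open>x\<^sub>1, \<dots>, x\<^sub>d\<close> of the usual notation are shifted by one.
\<close>

definition std_gaussian :: "nat \<Rightarrow> (nat \<Rightarrow> real) measure" where
  "std_gaussian d = (\<Pi>\<^sub>M i\<in>{..<d}. std_normal_distribution)"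

text \<open>
  Polynomials \<open>\<real>\<^sup>d \<rightarrow> \<real>\<close> of total degree at most \<open>n\<close>, as functions. A multi-index is a
  function \<open>m :: nat \<Rightarrow> nat\<close>, of which only the values at \<open>i < d\<close> are used.
\<close>

definition poly_fun :: "nat \<Rightarrow> nat \<Rightarrow> ((nat \<Rightarrow> real) \<Rightarrow> real) \<Rightarrow> bool" where
  "poly_fun d n P \<longleftrightarrow>
     (\<exists>(A :: (nat \<Rightarrow> nat) set) (a :: (nat \<Rightarrow> nat) \<Rightarrow> real).
        finite A \<and> (\<forall>m\<in>A. (\<Sum>i<d. m i) \<le> n) \<and>
        (\<forall>x. P x = (\<Sum>m\<in>A. a m * (\<Prod>i<d. x i ^ m i))))"

definition partial_deriv :: "nat \<Rightarrow> ((nat \<Rightarrow> real) \<Rightarrow> real) \<Rightarrow> (nat \<Rightarrow> real) \<Rightarrow> real" where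
  "partial_deriv i P x = deriv (\<lambda>t. P (x(i := t))) (x i)"

definition grad_norm :: "nat \<Rightarrow> ((nat \<Rightarrow> real) \<Rightarrow> real) \<Rightarrow> (nat \<Rightarrow> real) \<Rightarrow> real" where
  "grad_norm d P x = L2_set (\<lambda>i. partial_deriv i P x) {..<d}"

definition gauss_Lp :: "nat \<Rightarrow> real \<Rightarrow> ((nat \<Rightarrow> real) \<Rightarrow> real) \<Rightarrow> real" where
  "gauss_Lp d p f = (\<integral>x. \<bar>f x\<bar> powr p \<partial>std_gaussian d) powr (1 / p)"

definition gauss_Lp_grad :: "nat \<Rightarrow> real \<Rightarrow> ((nat \<Rightarrow> real) \<Rightarrow> real) \<Rightarrow> real" where
  "gauss_Lp_grad d p P = gauss_Lp d p (grad_norm d P)"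

definition gradient_bound :: "nat \<Rightarrow> nat \<Rightarrow> real \<Rightarrow> real \<Rightarrow> bool" where
  "gradient_bound d n p K \<longleftrightarrow>
     (\<forall>P. poly_fun d n P \<longrightarrow> gauss_Lp_grad d p P \<le> K * gauss_Lp d p P)"

definition prod_poly :: "nat \<Rightarrow> (nat \<Rightarrow> real) \<Rightarrow> real" where
  "prod_poly N x = (\<Prod>j<N. x j)"

end

theory Submission
  imports Defs
begin

text \<open>
  The gradient bounds rest on the complex Gaussian vectors \<open>z = x + \<lambda> \<zeta>\<close>, where \<open>x\<close> is a real and
  \<open>\<zeta>\<close> an independent complex standard Gaussian vector. Put \<open>H = 1 + \<bar>\<lambda>\<bar>\<^sup>2\<close>, \<open>a = p / 2 \<ge> 1\<close> and
  \<open>A = E (\<bar>P z\<bar>\<^sup>2 + \<epsilon>)\<^sup>a\<close>. Gaussian integration by parts turns the first two derivatives of \<open>A\<close> with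
  respect to \<open>log H\<close> into \<open>E N F\<close> and \<open>E N\<^sup>* N F\<close>, where \<open>F = (\<bar>P\<bar>\<^sup>2 + \<epsilon>)\<^sup>a\<close>, \<open>N = z \<sqdot> \<partial> - \<partial> \<sqdot> \<partial>\<close> and \<open>N\<^sup>*\<close>
  is its conjugate. For \<open>a \<ge> 1\<close> the two-jet of the kernel \<open>(w w\<^sup>* + \<epsilon>)\<^sup>a\<close> is positive semidefinite, so
  the Cauchy-Schwarz inequality shows that \<open>log A\<close> is convex in \<open>log H\<close>. As \<open>A\<close> grows at most like
  \<open>H\<close> to the power \<open>n a\<close>, its logarithmic slope is at most \<open>n a\<close> everywhere, hence \<open>A \<le> H\<^bsup>n a\<^esup> A\<^sub>0\<close>.
  The slope at \<open>H = 1\<close> is the case \<open>p = 2\<close>. For general \<open>p\<close> one takes \<open>\<bar>\<lambda>\<bar>\<^sup>2 = 1 / n\<close> and extracts the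
  linear coefficient of \<open>P (x + \<lambda> \<zeta>)\<close> by averaging over roots of unity; it is the directional
  derivative \<open>DP x \<sqdot> \<zeta>\<close>, whose moments carry the factor \<open>p\<^bsup>p/2\<^esup>\<close>.

  For the product polynomial, \<open>\<bar>DP\<bar>\<^sup>2 = P\<^sup>2 \<Sum>\<^sub>j x\<^sub>j\<^bsup>-2\<^esup>\<close>, so the ratio of norms is a moment of an average of
  independent variables \<open>x\<^sub>j\<^bsup>-2\<^esup>\<close> of mean \<open>1 / (p - 1)\<close> under the density proportional to
  \<open>\<bar>P\<bar>\<^sup>p\<close>: Jensen's inequality gives one bound and the law of large numbers, after truncation, the limit.
\<close>

section \<open>Gaussian integration by parts\<close>

text \<open>The variable log H is dictated by covariances: E |z_j|^2 = H depends on \<lambda>,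
  whereas E z_j^2 = 1 does not, because a circular \<zeta> has E \<zeta>_j^2 = 0. Integration by
  parts therefore attaches the factor H exactly to the mixed derivatives, which are what the heat
  equation in |\<lambda>|^2 produces. A complex \<zeta> has a second use: the moments depend on
  |\<lambda>| alone, so a bound for real \<lambda> holds on a whole circle, and roots of unity on it
  isolate the linear coefficient without a loss depending on n. The shift \<epsilon> > 0 keeps the
  kernel smooth where P vanishes, since a need not be an integer; it is sent to 0 once the convexity
  has been exploited. Positivity of the two-jet is an explicit sum of three squares, one of them
  weighted by a (a - 1). The choice |\<lambda>|^2 = 1 / n balances |\<lambda>|^(-p) = n^(p/2)
  against (1 + 1/n)^(n p / 2) \<le> e^(p/2). For the product polynomial, x^(-2) has a finite second
  moment under the weighted law only for p > 3; this is why the law of large numbers is preceded by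
  a truncation.\<close>

abbreviation gauss :: "nat set \<Rightarrow> (nat \<Rightarrow> real) measure" where
  "gauss I \<equiv> \<Pi>\<^sub>M i\<in>I. std_normal_distribution"

interpretation std_normal: prob_space std_normal_distribution
  by (rule prob_space_normal_density) simp

interpretation std_normal_prod: product_sigma_finite "\<lambda>_::nat. std_normal_distribution"
  by standard

lemma prob_space_gauss: "prob_space (gauss I)"
  by (rule prob_space_PiM) (rule std_normal.prob_space_axioms)

lemma integrable_std_normal:
  fixes f :: "real \<Rightarrow> 'b::{banach, second_countable_topology}"
  assumes [measurable]: "f \<in> borel_measurable borel"
  shows "integrable std_normal_distribution f \<longleftrightarrow> integrable lborel (\<lambda>x. std_normal_density x *\<^sub>R f x)"
  by (rule integrable_density) auto

lemma integral_std_normal: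
  fixes f :: "real \<Rightarrow> 'b::{banach, second_countable_topology}"
  assumes [measurable]: "f \<in> borel_measurable borel"
  shows "integral\<^sup>L std_normal_distribution f = (\<integral>x. std_normal_density x *\<^sub>R f x \<partial>lborel)"
  by (rule integral_density) auto

lemma integrable_std_normal_abs_power: "integrable std_normal_distribution (\<lambda>x. \<bar>x\<bar> ^ m)"
  using integrable_std_normal_moment_abs[of m] by (subst integrable_std_normal) auto

lemma integrable_std_normal_one_plus_abs_power:
  "integrable std_normal_distribution (\<lambda>x. (1 + \<bar>x\<bar>) ^ m)"
  by (subst add.commute, subst binomial_ring)
     (intro Bochner_Integration.integrable_sum integrable_mult_right integrable_mult_left
        integrable_std_normal_abs_power | simp)+

text \<open>A product over the coordinates instead of a norm: its powers have product integrals, and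
  changing one coordinate changes one factor, so a bound \<open>C * wt I g ^ m\<close> becomes a
  one-variable bound of the same shape when the other coordinates are frozen.\<close>

definition wt :: "nat set \<Rightarrow> (nat \<Rightarrow> 'a::real_normed_vector) \<Rightarrow> real" where
  "wt I g = (\<Prod>i\<in>I. 1 + norm (g i))"

lemma wt_ge_1: "wt I g \<ge> 1"
  unfolding wt_def by (rule prod_ge_1) auto

lemma wt_pos: "wt I g > 0"
  using wt_ge_1[of I g] by linarith

lemma wt_upd: "finite I \<Longrightarrow> k \<in> I \<Longrightarrow> wt I (g(k := t)) = (1 + norm t) * wt (I - {k}) g"
  unfolding wt_def by (subst prod.remove[of I k]) auto

lemma integrable_wt: "finite I \<Longrightarrow> integrable (gauss I) (\<lambda>g. wt I g ^ m)"
  unfolding wt_def prod_power_distrib real_norm_def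
  by (rule std_normal_prod.product_integrable_prod) (auto intro: integrable_std_normal_one_plus_abs_power)

lemma integrable_gauss_wt_bound:
  fixes f :: "(nat \<Rightarrow> real) \<Rightarrow> 'b::{banach, second_countable_topology}"
  assumes "finite I" and "f \<in> borel_measurable (gauss I)" and "\<And>g. norm (f g) \<le> C * wt I g ^ m"
  shows "integrable (gauss I) f"
proof (rule Bochner_Integration.integrable_bound)
  show "integrable (gauss I) (\<lambda>g. C * wt I g ^ m)"
    by (intro integrable_mult_right integrable_wt assms)
  show "AE x in gauss I. norm (f x) \<le> norm (C * wt I x ^ m)"
    using assms(3) by (auto intro: order_trans[OF _ abs_ge_self])
qed (use assms in auto)

lemma filterlim_abs_real_at_bot: "filterlim (abs :: real \<Rightarrow> real) at_top at_bot"
  unfolding filterlim_at_bot_mirror by (simp add: filterlim_abs_real)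

text \<open>Supplies the vanishing boundary terms of the integration by parts, at both ends of the
  line through the filter \<open>F\<close>. Comparing the Gaussian with exp (- |x|) is enough, since
  that already beats every power.\<close>

lemma std_normal_density_mult_tendsto_0:
  fixes f :: "real \<Rightarrow> 'b::real_normed_vector"
  assumes f: "\<And>x. norm (f x) \<le> C * (1 + \<bar>x\<bar>) ^ m"
  assumes F: "filterlim (\<lambda>x::real. \<bar>x\<bar>) at_top F"
  shows "((\<lambda>x. std_normal_density x *\<^sub>R f x) \<longlongrightarrow> 0) F"
proof (rule Lim_null_comparison)
  define D where "D = 1 / sqrt (2 * pi) * C * exp (3/2)"
  have "C \<ge> 0" using f[of 0] order_trans[OF norm_ge_zero f[of 0]] by simp
  show "\<forall>\<^sub>F x in F. norm (std_normal_density x *\<^sub>R f x)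
      \<le> D * ((1 + \<bar>x\<bar>) ^ m / exp (1 + \<bar>x\<bar>))"
  proof (rule always_eventually, rule allI)
    fix x :: real
    \<comment> \<open>This is (|x| - 1)^2 \<ge> 0 rearranged; in the variable 1 + |x| the growth
      bound is a pure power.\<close>
    have "- x\<^sup>2 / 2 \<le> 3/2 - (1 + \<bar>x\<bar>)"
      using zero_le_power2[of "\<bar>x\<bar> - 1"] by (simp add: power2_eq_square algebra_simps)
    then have "exp (- x\<^sup>2 / 2) \<le> exp (3/2) / exp (1 + \<bar>x\<bar>)"
      by (metis exp_diff exp_le_cancel_iff)
    then have "std_normal_density x \<le> 1 / sqrt (2 * pi) * (exp (3/2) / exp (1 + \<bar>x\<bar>))"
      unfolding std_normal_density_def by (rule mult_left_mono) simp
    then have "std_normal_density x * norm (f x)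
        \<le> (1 / sqrt (2 * pi) * (exp (3/2) / exp (1 + \<bar>x\<bar>))) * (C * (1 + \<bar>x\<bar>) ^ m)"
      by (rule mult_mono) (use f in auto)
    then show "norm (std_normal_density x *\<^sub>R f x) \<le> D * ((1 + \<bar>x\<bar>) ^ m / exp (1 + \<bar>x\<bar>))"
      by (simp add: D_def field_simps)
  qed
  have 1: "filterlim (\<lambda>x::real. 1 + \<bar>x\<bar>) at_top F"
    by (intro filterlim_tendsto_add_at_top[OF tendsto_const] F)
  show "((\<lambda>x. D * ((1 + \<bar>x\<bar>) ^ m / exp (1 + \<bar>x\<bar>))) \<longlongrightarrow> 0) F"
    by (rule tendsto_mult_right_zero, rule filterlim_compose[OF tendsto_power_div_exp_0 1])
qed

text \<open>The fundamental theorem of calculus for \<phi> f on the whole line, where \<phi> is the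
  density and \<phi>' = - x \<phi>. Values in a Euclidean space let one statement serve real and
  complex integrands.\<close>

lemma std_normal_ibp:
  fixes f f' :: "real \<Rightarrow> 'b::euclidean_space"
  assumes deriv: "\<And>x. (f has_vector_derivative f' x) (at x)"
    and cont: "continuous_on UNIV f'"
    and f: "\<And>x. norm (f x) \<le> C * (1 + \<bar>x\<bar>) ^ m"
    and f': "\<And>x. norm (f' x) \<le> C' * (1 + \<bar>x\<bar>) ^ m'"
  shows "(\<integral>x. x *\<^sub>R f x \<partial>std_normal_distribution) = (\<integral>x. f' x \<partial>std_normal_distribution)"
proof -
  let ?d = std_normal_density
  have contf: "continuous_on UNIV f"
    using deriv by (meson continuous_at_imp_continuous_on has_vector_derivative_continuous)
  have [measurable]: "f \<in> borel_measurable borel" "f' \<in> borel_measurable borel"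
    using contf cont by (auto intro: borel_measurable_continuous_onI)
  have bd: "integrable std_normal_distribution h"
    if [measurable]: "h \<in> borel_measurable borel" and h: "\<And>x. norm (h x) \<le> D * (1 + \<bar>x\<bar>) ^ k"
    for h :: "real \<Rightarrow> 'b" and D k
  proof (rule Bochner_Integration.integrable_bound)
    show "integrable std_normal_distribution (\<lambda>x. D * (1 + \<bar>x\<bar>) ^ k)"
      by (intro integrable_mult_right integrable_std_normal_one_plus_abs_power)
    show "AE x in std_normal_distribution. norm (h x) \<le> norm (D * (1 + \<bar>x\<bar>) ^ k)"
      using h by (auto intro: order_trans[OF _ abs_ge_self])
  qed auto
  have "norm (x *\<^sub>R f x) \<le> C * (1 + \<bar>x\<bar>) ^ Suc m" for x
  proof -
    have "norm (x *\<^sub>R f x) \<le> (1 + \<bar>x\<bar>) * (C * (1 + \<bar>x\<bar>) ^ m)"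
      unfolding norm_scaleR by (intro mult_mono f) auto
    then show ?thesis by (simp add: algebra_simps)
  qed
  then have i1: "integrable std_normal_distribution (\<lambda>x. x *\<^sub>R f x)" by (rule bd[rotated]) measurable
  have i2: "integrable std_normal_distribution f'" using f' by (intro bd) auto
  define h where "h x = ?d x *\<^sub>R f' x - ?d x *\<^sub>R (x *\<^sub>R f x)" for x
  have j1: "integrable lborel (\<lambda>x. ?d x *\<^sub>R (x *\<^sub>R f x))"
    using i1 by (subst (asm) integrable_std_normal) auto
  have j2: "integrable lborel (\<lambda>x. ?d x *\<^sub>R f' x)"
    using i2 by (subst (asm) integrable_std_normal) auto
  have "(LBINT x=-\<infinity>..\<infinity>. h x) = 0 - 0"
  proof (rule interval_integral_FTC_integrable)
    show "((\<lambda>x. ?d x *\<^sub>R f x) has_vector_derivative h x) (at x)" for x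
    proof -
      have "((\<lambda>x. c * exp (- x\<^sup>2 / 2)) has_real_derivative - x * (c * exp (- x\<^sup>2 / 2))) (at x)" for c :: real
        by (auto intro!: derivative_eq_intros simp: power2_eq_square)
      then have "(?d has_real_derivative - x * ?d x) (at x)"
        unfolding std_normal_density_def .
      then show ?thesis
        unfolding h_def by (auto intro!: derivative_eq_intros deriv simp: has_real_derivative_iff_has_vector_derivative)
    qed
    have "continuous_on UNIV h"
      unfolding h_def std_normal_density_def by (intro continuous_intros contf cont) auto
    then show "isCont h x" for x by (simp add: continuous_on_eq_continuous_at)
    have "integrable lborel h" unfolding h_def using j1 j2 by (intro Bochner_Integration.integrable_diff)
    then show "set_integrable lborel (einterval (- \<infinity>) \<infinity>) h"
      unfolding set_integrable_def by simp
    show "(((\<lambda>x. ?d x *\<^sub>R f x) \<circ> real_of_ereal) \<longlongrightarrow> 0) (at_right (- \<infinity>))"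
      unfolding ereal_tendsto_simps
      by (rule std_normal_density_mult_tendsto_0[OF f filterlim_abs_real_at_bot])
    show "(((\<lambda>x. ?d x *\<^sub>R f x) \<circ> real_of_ereal) \<longlongrightarrow> 0) (at_left \<infinity>)"
      unfolding ereal_tendsto_simps
      by (rule std_normal_density_mult_tendsto_0[OF f filterlim_abs_real])
  qed simp
  then have "integral\<^sup>L lborel h = 0"
    by (simp add: interval_lebesgue_integral_def set_lebesgue_integral_def)
  then show ?thesis
    unfolding h_def using j1 j2 by (simp add: integral_std_normal)
qed

section \<open>Integration by parts in one coordinate of a Gaussian product measure\<close>

lemma gauss_split_coordinate:
  fixes f :: "(nat \<Rightarrow> real) \<Rightarrow> 'b::{banach, second_countable_topology}"
  assumes I: "finite I" "k \<in> I" and f: "integrable (gauss I) f"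
  shows "integral\<^sup>L (gauss I) f = (\<integral>g. (\<integral>t. f (g(k := t)) \<partial>std_normal_distribution) \<partial>gauss (I - {k}))"
proof -
  have "insert k (I - {k}) = I" using I by auto
  then show ?thesis
    using std_normal_prod.product_integral_insert[of "I - {k}" k f] I f by simp
qed

lemma gauss_ibp:
  fixes f f' :: "(nat \<Rightarrow> real) \<Rightarrow> 'b::euclidean_space"
  assumes I: "finite I" "k \<in> I"
    and [measurable]: "f \<in> borel_measurable (gauss I)" "f' \<in> borel_measurable (gauss I)"
    and deriv: "\<And>g t. ((\<lambda>t. f (g(k := t))) has_vector_derivative f' (g(k := t))) (at t)"
    and cont: "\<And>g. continuous_on UNIV (\<lambda>t. f' (g(k := t)))"
    and f: "\<And>g. norm (f g) \<le> C * wt I g ^ m"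
    and f': "\<And>g. norm (f' g) \<le> C' * wt I g ^ m'"
  shows "(\<integral>g. g k *\<^sub>R f g \<partial>gauss I) = (\<integral>g. f' g \<partial>gauss I)"
proof -
  have [measurable]: "(\<lambda>g. g k) \<in> borel_measurable (gauss I)"
    using measurable_component_singleton[OF I(2), of "\<lambda>_. std_normal_distribution"] by simp
  have "norm (g k *\<^sub>R f g) \<le> C * wt I g ^ Suc m" for g
  proof -
    have "\<bar>g k\<bar> \<le> (1 + norm (g k)) * wt (I - {k}) g"
      using wt_ge_1[of "I - {k}" g] by (smt (verit) mult_le_cancel_left1 real_norm_def)
    also have "\<dots> = wt I g" using wt_upd[OF I, of g "g k"] by simp
    finally have "norm (g k *\<^sub>R f g) \<le> wt I g * (C * wt I g ^ m)"
      unfolding norm_scaleR by (intro mult_mono f) (auto intro: less_imp_le wt_pos)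
    then show ?thesis by (simp add: algebra_simps)
  qed
  then have i1: "integrable (gauss I) (\<lambda>g. g k *\<^sub>R f g)"
    by (rule integrable_gauss_wt_bound[OF I(1), rotated]) measurable
  have i2: "integrable (gauss I) f'"
    by (intro integrable_gauss_wt_bound[OF I(1) _ f']) auto
  have "(\<integral>t. (g(k := t)) k *\<^sub>R f (g(k := t)) \<partial>std_normal_distribution)
      = (\<integral>t. f' (g(k := t)) \<partial>std_normal_distribution)" for g
  proof -
    have "(\<integral>t. t *\<^sub>R f (g(k := t)) \<partial>std_normal_distribution)
      = (\<integral>t. f' (g(k := t)) \<partial>std_normal_distribution)"
    proof (rule std_normal_ibp[OF deriv cont])
      show "norm (f (g(k := x))) \<le> (C * wt (I - {k}) g ^ m) * (1 + \<bar>x\<bar>) ^ m" for x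
        using f[of "g(k := x)"] by (simp add: wt_upd[OF I] power_mult_distrib ac_simps)
      show "norm (f' (g(k := x))) \<le> (C' * wt (I - {k}) g ^ m') * (1 + \<bar>x\<bar>) ^ m'" for x
        using f'[of "g(k := x)"] by (simp add: wt_upd[OF I] power_mult_distrib ac_simps)
    qed
    then show ?thesis by simp
  qed
  then show ?thesis
    by (simp only: gauss_split_coordinate[OF I i1] gauss_split_coordinate[OF I i2])
qed

section \<open>Differentiation under the integral sign\<close>

lemma has_vector_derivative_iff_tendsto:
  fixes f :: "real \<Rightarrow> 'b::real_normed_vector"
  shows "(f has_vector_derivative d) (at x) \<longleftrightarrow> ((\<lambda>s. (f (x + s) - f x) /\<^sub>R s) \<longlongrightarrow> d) (at 0)"
proof -
  have "(f has_vector_derivative d) (at x)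
      \<longleftrightarrow> ((\<lambda>s. norm (f (x + s) - f x - s *\<^sub>R d) / norm s) \<longlongrightarrow> 0) (at 0)"
    unfolding has_vector_derivative_def has_derivative_at by (simp add: bounded_linear_scaleR_left)
  also have "\<dots> \<longleftrightarrow> ((\<lambda>s. norm ((f (x + s) - f x) /\<^sub>R s - d)) \<longlongrightarrow> 0) (at 0)"
  proof (rule filterlim_cong[OF refl refl])
    show "\<forall>\<^sub>F s in at 0. norm (f (x + s) - f x - s *\<^sub>R d) / norm s = norm ((f (x + s) - f x) /\<^sub>R s - d)"
    proof (rule eventually_at_filter[THEN iffD2], rule always_eventually, intro allI impI)
      fix s :: real assume "s \<noteq> 0"
      then have "(f (x + s) - f x) /\<^sub>R s - d = (f (x + s) - f x - s *\<^sub>R d) /\<^sub>R s"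
        by (simp add: scaleR_right_diff_distrib)
      then show "norm (f (x + s) - f x - s *\<^sub>R d) / norm s = norm ((f (x + s) - f x) /\<^sub>R s - d)"
        by (simp add: divide_inverse mult.commute)
    qed
  qed
  finally show ?thesis by (simp add: tendsto_norm_zero_iff LIM_zero_iff)
qed

text \<open>The bound \<open>h x\<close> on the derivative is a Lipschitz constant of t |-> f t x
  within distance 1 of t0, so the difference quotients are dominated by \<open>h\<close> while they
  converge pointwise.\<close>

lemma has_vector_derivative_integral:
  fixes f f' :: "real \<Rightarrow> 'a \<Rightarrow> 'b::euclidean_space"
  assumes int: "\<And>t. \<bar>t - t0\<bar> \<le> 1 \<Longrightarrow> integrable M (f t)"
    and deriv: "\<And>t x. \<bar>t - t0\<bar> \<le> 1 \<Longrightarrow> ((\<lambda>t. f t x) has_vector_derivative f' t x) (at t)"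
    and bound: "\<And>t x. \<bar>t - t0\<bar> \<le> 1 \<Longrightarrow> norm (f' t x) \<le> h x"
    and h: "integrable M h"
    and [measurable]: "f' t0 \<in> borel_measurable M"
  shows "((\<lambda>t. \<integral>x. f t x \<partial>M) has_vector_derivative (\<integral>x. f' t0 x \<partial>M)) (at t0)"
proof -
  have lip: "norm (f t x - f t0 x) \<le> h x * \<bar>t - t0\<bar>" if "\<bar>t - t0\<bar> \<le> 1" for t x
  proof -
    have "norm (f t x - f t0 x) \<le> h x * norm (t - t0)"
    proof (rule differentiable_bound[where S = "cball t0 1" and f' = "\<lambda>t k. k *\<^sub>R f' t x"])
      show "((\<lambda>t. f t x) has_derivative (\<lambda>k. k *\<^sub>R f' s x)) (at s within cball t0 1)"
        if "s \<in> cball t0 1" for s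
        unfolding has_vector_derivative_def[symmetric]
      proof (rule has_vector_derivative_at_within, rule deriv)
        show "\<bar>s - t0\<bar> \<le> 1" using that by (simp add: dist_real_def abs_minus_commute)
      qed
      show "onorm (\<lambda>k. k *\<^sub>R f' s x) \<le> h x" if "s \<in> cball t0 1" for s
      proof (rule onorm_le)
        have "norm (f' s x) \<le> h x"
          by (rule bound) (use that in \<open>simp add: dist_real_def abs_minus_commute\<close>)
        then show "norm (k *\<^sub>R f' s x) \<le> h x * norm k" for k :: real
          unfolding norm_scaleR real_norm_def by (metis mult.commute mult_left_mono abs_ge_zero)
      qed
    qed (use that in \<open>auto simp: dist_real_def\<close>)
    then show ?thesis by simp
  qed
  have "((\<lambda>s. ((\<integral>x. f (t0 + s) x \<partial>M) - (\<integral>x. f t0 x \<partial>M)) /\<^sub>R s) \<longlongrightarrow> (\<integral>x. f' t0 x \<partial>M)) (at 0)"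
    unfolding tendsto_at_iff_sequentially
  proof (intro allI impI)
    fix X :: "nat \<Rightarrow> real"
    assume X: "\<forall>i. X i \<in> UNIV - {0}" and lim: "X \<longlonglongrightarrow> 0"
    obtain n0 where n0: "\<And>n. n \<ge> n0 \<Longrightarrow> \<bar>X n\<bar> < 1"
      using LIMSEQ_D[OF lim, of 1] by auto
    \<comment> \<open>Dropping finitely many terms keeps t0 + Y n within distance 1 of t0, where the
      hypotheses apply.\<close>
    define Y where "Y n = X (n + n0)" for n
    have Y: "Y n \<noteq> 0" "\<bar>Y n\<bar> \<le> 1" for n using X n0[of "n + n0"] by (auto simp: Y_def)
    have limY: "Y \<longlonglongrightarrow> 0" unfolding Y_def using lim by (rule LIMSEQ_ignore_initial_segment)
    have "(\<lambda>n. \<integral>x. (f (t0 + Y n) x - f t0 x) /\<^sub>R Y n \<partial>M) \<longlonglongrightarrow> (\<integral>x. f' t0 x \<partial>M)"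
    proof (rule integral_dominated_convergence[where w = h])
      show "AE x in M. (\<lambda>n. (f (t0 + Y n) x - f t0 x) /\<^sub>R Y n) \<longlonglongrightarrow> f' t0 x"
      proof (rule AE_I2)
        fix x
        have "((\<lambda>s. (f (t0 + s) x - f t0 x) /\<^sub>R s) \<longlongrightarrow> f' t0 x) (at 0)"
          using deriv[of t0 x] by (simp add: has_vector_derivative_iff_tendsto)
        then show "(\<lambda>n. (f (t0 + Y n) x - f t0 x) /\<^sub>R Y n) \<longlonglongrightarrow> f' t0 x"
          unfolding tendsto_at_iff_sequentially comp_def using Y limY by auto
      qed
      show "AE x in M. norm ((f (t0 + Y n) x - f t0 x) /\<^sub>R Y n) \<le> h x" for n
      proof (rule AE_I2)
        fix x
        show "norm ((f (t0 + Y n) x - f t0 x) /\<^sub>R Y n) \<le> h x"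
          using lip[of "t0 + Y n" x] Y[of n]
          by (simp only: norm_scaleR) (simp add: field_simps)
      qed
      show "(\<lambda>x. (f (t0 + Y n) x - f t0 x) /\<^sub>R Y n) \<in> borel_measurable M" for n
      proof -
        have [measurable]: "f (t0 + Y n) \<in> borel_measurable M" "f t0 \<in> borel_measurable M"
          using int[of "t0 + Y n"] int[of t0] Y[of n] by auto
        show ?thesis by measurable
      qed
    qed (use h in auto)
    also have "(\<lambda>n. \<integral>x. (f (t0 + Y n) x - f t0 x) /\<^sub>R Y n \<partial>M)
       = (\<lambda>n. ((\<integral>x. f (t0 + Y n) x \<partial>M) - (\<integral>x. f t0 x \<partial>M)) /\<^sub>R Y n)"
    proof
      fix n
      have "integrable M (f (t0 + Y n))" "integrable M (f t0)" using int Y[of n] by auto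
      then show "(\<integral>x. (f (t0 + Y n) x - f t0 x) /\<^sub>R Y n \<partial>M)
          = ((\<integral>x. f (t0 + Y n) x \<partial>M) - (\<integral>x. f t0 x \<partial>M)) /\<^sub>R Y n"
        by (simp only: integral_scaleR_right Bochner_Integration.integral_diff)
    qed
    finally show "((\<lambda>s. ((\<integral>x. f (t0 + s) x \<partial>M) - (\<integral>x. f t0 x \<partial>M)) /\<^sub>R s) \<circ> X) \<longlonglongrightarrow> (\<integral>x. f' t0 x \<partial>M)"
      unfolding Y_def comp_def by (rule LIMSEQ_offset)
  qed
  then show ?thesis by (simp add: has_vector_derivative_iff_tendsto)
qed

section \<open>Wirtinger calculus for functions of polynomial growth\<close>

text \<open>Polynomial growth, measurability along random vectors and continuity along curves. The
  test vectors and curves are required to be regular only in their coordinates below d; this forces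
  a tame function to depend on those coordinates alone, although a point has infinitely
  many.\<close>

definition tame :: "nat \<Rightarrow> ((nat \<Rightarrow> complex) \<Rightarrow> complex) \<Rightarrow> bool" where
  "tame d K \<longleftrightarrow>
     (\<exists>C m. \<forall>z. norm (K z) \<le> C * wt {..<d} z ^ m) \<and>
     (\<forall>(M :: (nat \<Rightarrow> real) measure) Z. (\<forall>j<d. (\<lambda>\<omega>. Z \<omega> j) \<in> borel_measurable M)
        \<longrightarrow> (\<lambda>\<omega>. K (Z \<omega>)) \<in> borel_measurable M) \<and>
     (\<forall>Z :: real \<Rightarrow> nat \<Rightarrow> complex. (\<forall>j<d. continuous_on UNIV (\<lambda>t. Z t j))
        \<longrightarrow> continuous_on UNIV (\<lambda>t. K (Z t)))"

lemma tame_bound: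
  assumes "tame d K"
  obtains C m where "C \<ge> 0" "\<And>z. norm (K z) \<le> C * wt {..<d} z ^ m"
proof -
  obtain C m where C: "\<And>z. norm (K z) \<le> C * wt {..<d} z ^ m"
    using assms by (auto simp: tame_def)
  have "0 \<le> C * wt {..<d} (\<lambda>_. 0 :: complex) ^ m" using C order_trans[OF norm_ge_zero] by blast
  then have "C \<ge> 0" by (metis mult_neg_pos not_less wt_pos zero_less_power)
  with C that show thesis by blast
qed

lemma tame_measurable:
  fixes M :: "(nat \<Rightarrow> real) measure"
  shows "tame d K \<Longrightarrow> (\<And>j. j < d \<Longrightarrow> (\<lambda>\<omega>. Z \<omega> j) \<in> borel_measurable M) \<Longrightarrow> (\<lambda>\<omega>. K (Z \<omega>)) \<in> borel_measurable M"
  by (auto simp: tame_def)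

lemma tame_continuous:
  fixes Z :: "real \<Rightarrow> nat \<Rightarrow> complex"
  shows "tame d K \<Longrightarrow> (\<And>j. j < d \<Longrightarrow> continuous_on UNIV (\<lambda>t. Z t j)) \<Longrightarrow> continuous_on UNIV (\<lambda>t. K (Z t))"
  by (auto simp: tame_def)

lemma tameI:
  assumes "\<And>z. norm (K z) \<le> C * wt {..<d} z ^ m"
    and "\<And>(M :: (nat \<Rightarrow> real) measure) Z. (\<And>j. j < d \<Longrightarrow> (\<lambda>\<omega>. Z \<omega> j) \<in> borel_measurable M)
        \<Longrightarrow> (\<lambda>\<omega>. K (Z \<omega>)) \<in> borel_measurable M"
    and "\<And>Z :: real \<Rightarrow> nat \<Rightarrow> complex. (\<And>j. j < d \<Longrightarrow> continuous_on UNIV (\<lambda>t. Z t j))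
        \<Longrightarrow> continuous_on UNIV (\<lambda>t. K (Z t))"
  shows "tame d K"
  using assms unfolding tame_def by blast

lemma tame_const [intro!, simp]: "tame d (\<lambda>_. c)"
  by (rule tameI[where C = "norm c" and m = 0]) auto

lemma wt_coord: "j < d \<Longrightarrow> 1 + norm (z j) \<le> wt {..<d} z"
  unfolding wt_def
  using mult_left_mono[OF prod_ge_1[of "{..<d} - {j}" "\<lambda>i. 1 + norm (z i)"], of "1 + norm (z j)"]
  by (subst prod.remove[of _ j]) auto

lemma tame_coord [intro!, simp]: "j < d \<Longrightarrow> tame d (\<lambda>z. z j)"
proof (rule tameI[where C = 1 and m = 1])
  show "norm (z j) \<le> 1 * wt {..<d} z ^ 1" if "j < d" for z
    using wt_coord[OF that, of z] by simp
qed auto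

lemma tame_cnj [intro!]: "tame d K \<Longrightarrow> tame d (\<lambda>z. cnj (K z))"
proof -
  assume K: "tame d K"
  then obtain C m where "\<And>z. norm (K z) \<le> C * wt {..<d} z ^ m" by (auto simp: tame_def)
  then show ?thesis
    by (intro tameI[where C = C and m = m])
       (auto intro!: continuous_intros tame_continuous[OF K]
         measurable_compose[OF tame_measurable[OF K] borel_measurable_continuous_onI[of cnj]])
qed

lemma tame_add [intro!]: "tame d K \<Longrightarrow> tame d L \<Longrightarrow> tame d (\<lambda>z. K z + L z)"
proof -
  assume K: "tame d K" and L: "tame d L"
  obtain C m where C: "C \<ge> 0" "\<And>z. norm (K z) \<le> C * wt {..<d} z ^ m" using tame_bound[OF K] by blast
  obtain C' m' where C': "C' \<ge> 0" "\<And>z. norm (L z) \<le> C' * wt {..<d} z ^ m'" using tame_bound[OF L] by blast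
  show ?thesis
  proof (rule tameI[where C = "C + C'" and m = "max m m'"])
    fix z :: "nat \<Rightarrow> complex"
    have "norm (K z + L z) \<le> C * wt {..<d} z ^ m + C' * wt {..<d} z ^ m'"
      using C(2)[of z] C'(2)[of z] norm_triangle_ineq[of "K z" "L z"] by linarith
    also have "\<dots> \<le> C * wt {..<d} z ^ max m m' + C' * wt {..<d} z ^ max m m'"
      by (intro add_mono mult_left_mono power_increasing wt_ge_1 C C') auto
    finally show "norm (K z + L z) \<le> (C + C') * wt {..<d} z ^ max m m'"
      by (simp add: algebra_simps)
  qed (auto intro!: borel_measurable_add continuous_intros tame_continuous[OF K] tame_continuous[OF L]
         tame_measurable[OF K] tame_measurable[OF L])
qed

lemma tame_mult [intro!]: "tame d K \<Longrightarrow> tame d L \<Longrightarrow> tame d (\<lambda>z. K z * L z)"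
proof -
  assume K: "tame d K" and L: "tame d L"
  obtain C m where C: "C \<ge> 0" "\<And>z. norm (K z) \<le> C * wt {..<d} z ^ m" using tame_bound[OF K] by blast
  obtain C' m' where C': "C' \<ge> 0" "\<And>z. norm (L z) \<le> C' * wt {..<d} z ^ m'" using tame_bound[OF L] by blast
  show ?thesis
  proof (rule tameI[where C = "C * C'" and m = "m + m'"])
    fix z :: "nat \<Rightarrow> complex"
    have "norm (K z * L z) \<le> (C * wt {..<d} z ^ m) * (C' * wt {..<d} z ^ m')"
      unfolding norm_mult by (intro mult_mono C C' mult_nonneg_nonneg zero_le_power less_imp_le[OF wt_pos]) auto
    then show "norm (K z * L z) \<le> (C * C') * wt {..<d} z ^ (m + m')"
      by (simp add: algebra_simps power_add)
  qed (auto intro!: borel_measurable_times continuous_intros tame_continuous[OF K] tame_continuous[OF L]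
         tame_measurable[OF K] tame_measurable[OF L])
qed

lemma tame_uminus [intro!]: "tame d K \<Longrightarrow> tame d (\<lambda>z. - K z)"
  using tame_mult[OF tame_const[of d "-1"], of K] by simp

lemma tame_diff [intro!]: "tame d K \<Longrightarrow> tame d L \<Longrightarrow> tame d (\<lambda>z. K z - L z)"
  using tame_add[of d K "\<lambda>z. - L z"] by auto

lemma tame_power [intro!]: "tame d K \<Longrightarrow> tame d (\<lambda>z. K z ^ n)"
  by (induction n) auto

text \<open>Exponents of either sign occur, because each derivative of the kernel lowers b by one. A
  negative power is bounded by \<open>e powr b\<close> thanks to e > 0; a positive exponent is
  rounded up to the integer B.\<close>

lemma tame_powr [intro!]:
  assumes K: "tame d K" and e: "e > 0"
  shows "tame d (\<lambda>z. of_real (((cmod (K z))\<^sup>2 + e) powr b))"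
proof -
  obtain C m where C: "C \<ge> 0" "\<And>z. norm (K z) \<le> C * wt {..<d} z ^ m" using tame_bound[OF K] by blast
  define B where "B = nat \<lceil>max b 0\<rceil>"
  have B: "b \<le> real B" unfolding B_def by linarith
  define D where "D = max (e powr b) ((C\<^sup>2 + e + 1) ^ B)"
  show ?thesis
  proof (rule tameI[where C = D and m = "2 * m * B"])
    fix z :: "nat \<Rightarrow> complex"
    let ?w = "wt {..<d} z"
    have w1: "1 \<le> ?w ^ k" for k by (rule one_le_power[OF wt_ge_1])
    have pos: "0 < (cmod (K z))\<^sup>2 + e" using e by (simp add: add_nonneg_pos)
    have "((cmod (K z))\<^sup>2 + e) powr b \<le> D * ?w ^ (2 * m * B)"
    proof (cases "b \<le> 0")
      case True
      have "((cmod (K z))\<^sup>2 + e) powr b \<le> e powr b"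
        using True e by (intro powr_mono2') auto
      also have "\<dots> \<le> D * 1" unfolding D_def by simp
      also have "\<dots> \<le> D * ?w ^ (2 * m * B)"
        by (intro mult_left_mono w1) (auto simp: D_def le_max_iff_disj)
      finally show ?thesis .
    next
      case False
      have "(cmod (K z))\<^sup>2 + e \<le> (C * ?w ^ m)\<^sup>2 + (e + 1) * 1"
        using power_mono[OF C(2)[of z], of 2] by simp
      also have "\<dots> \<le> (C * ?w ^ m)\<^sup>2 + (e + 1) * (?w ^ (m * 2))"
        using e by (intro add_left_mono mult_left_mono w1) auto
      also have "\<dots> = (C\<^sup>2 + e + 1) * ?w ^ (2 * m)"
        by (simp add: algebra_simps power_mult)
      finally have 1: "(cmod (K z))\<^sup>2 + e \<le> (C\<^sup>2 + e + 1) * ?w ^ (2 * m)" .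
      have 2: "1 \<le> (C\<^sup>2 + e + 1) * ?w ^ (2 * m)"
        using mult_mono[of 1 "C\<^sup>2 + e + 1" 1 "?w ^ (2 * m)"] w1 e by simp
      have "((cmod (K z))\<^sup>2 + e) powr b \<le> ((C\<^sup>2 + e + 1) * ?w ^ (2 * m)) powr b"
        using 1 pos False by (intro powr_mono2) auto
      also have "\<dots> \<le> ((C\<^sup>2 + e + 1) * ?w ^ (2 * m)) powr (real B)"
        using 2 B by (intro powr_mono) auto
      also have "\<dots> = ((C\<^sup>2 + e + 1) * ?w ^ (2 * m)) ^ B"
        using 2 by (intro powr_realpow) linarith
      also have "\<dots> = (C\<^sup>2 + e + 1) ^ B * ?w ^ (2 * m * B)"
        by (simp add: power_mult_distrib power_mult)
      also have "\<dots> \<le> D * ?w ^ (2 * m * B)"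
        by (intro mult_right_mono) (auto simp: D_def intro!: zero_le_power less_imp_le[OF wt_pos])
      finally show ?thesis .
    qed
    then show "norm (complex_of_real (((cmod (K z))\<^sup>2 + e) powr b)) \<le> D * ?w ^ (2 * m * B)"
      by simp
  next
    fix M :: "(nat \<Rightarrow> real) measure" and Z :: "(nat \<Rightarrow> real) \<Rightarrow> nat \<Rightarrow> complex"
    assume "\<And>j. j < d \<Longrightarrow> (\<lambda>\<omega>. Z \<omega> j) \<in> borel_measurable M"
    then have [measurable]: "(\<lambda>\<omega>. K (Z \<omega>)) \<in> borel_measurable M" by (rule tame_measurable[OF K])
    show "(\<lambda>\<omega>. complex_of_real (((cmod (K (Z \<omega>)))\<^sup>2 + e) powr b)) \<in> borel_measurable M"
      by measurable
  next
    fix Z :: "real \<Rightarrow> nat \<Rightarrow> complex"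
    assume Z: "\<And>j. j < d \<Longrightarrow> continuous_on UNIV (\<lambda>t. Z t j)"
    have "(cmod (K (Z t)))\<^sup>2 + e \<noteq> 0" for t
      using e by (metis add_nonneg_pos less_irrefl zero_le_power2)
    then show "continuous_on UNIV (\<lambda>t. complex_of_real (((cmod (K (Z t)))\<^sup>2 + e) powr b))"
      by (intro continuous_intros tame_continuous[OF K] Z) auto
  qed
qed

text \<open>\<open>wirtinger d K K1 K2\<close>: the Wirtinger derivatives \<open>\<partial>K/\<partial>z\<^sub>j\<close> and \<open>\<partial>K/\<partial>cnj z\<^sub>j\<close> are
  \<open>K1 j\<close> and \<open>K2 j\<close>, expressed as the chain rule along curves.\<close>

definition wirtinger :: "nat \<Rightarrow> ((nat \<Rightarrow> complex) \<Rightarrow> complex) \<Rightarrow> (nat \<Rightarrow> (nat \<Rightarrow> complex) \<Rightarrow> complex)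
    \<Rightarrow> (nat \<Rightarrow> (nat \<Rightarrow> complex) \<Rightarrow> complex) \<Rightarrow> bool" where
  "wirtinger d K K1 K2 \<longleftrightarrow>
     (\<forall>(Z :: real \<Rightarrow> nat \<Rightarrow> complex) Z' t.
        (\<forall>j<d. ((\<lambda>s. Z s j) has_vector_derivative Z' j) (at t)) \<longrightarrow>
        ((\<lambda>s. K (Z s)) has_vector_derivative (\<Sum>j<d. K1 j (Z t) * Z' j + K2 j (Z t) * cnj (Z' j))) (at t))"

lemma wirtingerD:
  assumes "wirtinger d K K1 K2" and "\<And>j. j < d \<Longrightarrow> ((\<lambda>s. Z s j) has_vector_derivative Z' j) (at t)"
  shows "((\<lambda>s. K (Z s)) has_vector_derivative (\<Sum>j<d. K1 j (Z t) * Z' j + K2 j (Z t) * cnj (Z' j))) (at t)"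
  using assms unfolding wirtinger_def by blast

lemma wirtinger_cong:
  assumes "wirtinger d K K1 K2" "\<And>z. K z = L z" "\<And>j z. j < d \<Longrightarrow> K1 j z = L1 j z" "\<And>j z. j < d \<Longrightarrow> K2 j z = L2 j z"
  shows "wirtinger d L L1 L2"
proof -
  have "K = L" using assms by blast
  moreover have "(\<Sum>j<d. K1 j z * Z' j + K2 j z * cnj (Z' j)) = (\<Sum>j<d. L1 j z * Z' j + L2 j z * cnj (Z' j))" for z Z'
    using assms by (intro sum.cong) auto
  ultimately show ?thesis using assms(1) unfolding wirtinger_def by simp
qed

lemma wirtinger_const: "wirtinger d (\<lambda>_. c) (\<lambda>_ _. 0) (\<lambda>_ _. 0)"
  unfolding wirtinger_def by simp

lemma wirtinger_coord: "i < d \<Longrightarrow> wirtinger d (\<lambda>z. z i) (\<lambda>j _. of_bool (i = j)) (\<lambda>_ _. 0)"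
  unfolding wirtinger_def by (auto simp: of_bool_def if_distrib[of "\<lambda>x. x * _"] cong: if_cong)

lemma wirtinger_cnj: "wirtinger d K K1 K2 \<Longrightarrow> wirtinger d (\<lambda>z. cnj (K z)) (\<lambda>j z. cnj (K2 j z)) (\<lambda>j z. cnj (K1 j z))"
  unfolding wirtinger_def
proof (intro allI impI)
  fix Z :: "real \<Rightarrow> nat \<Rightarrow> complex" and Z' t
  assume K: "\<forall>Z Z' t. (\<forall>j<d. ((\<lambda>s. Z s j) has_vector_derivative Z' j) (at t)) \<longrightarrow>
        ((\<lambda>s. K (Z s)) has_vector_derivative (\<Sum>j<d. K1 j (Z t) * Z' j + K2 j (Z t) * cnj (Z' j))) (at t)"
    and Z: "\<forall>j<d. ((\<lambda>s. Z s j) has_vector_derivative Z' j) (at t)"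
  have "((\<lambda>s. cnj (K (Z s))) has_vector_derivative cnj (\<Sum>j<d. K1 j (Z t) * Z' j + K2 j (Z t) * cnj (Z' j))) (at t)"
    using K Z by (intro bounded_linear.has_vector_derivative[OF bounded_linear_cnj]) blast
  also have "cnj (\<Sum>j<d. K1 j (Z t) * Z' j + K2 j (Z t) * cnj (Z' j))
    = (\<Sum>j<d. cnj (K2 j (Z t)) * Z' j + cnj (K1 j (Z t)) * cnj (Z' j))"
    by (simp add: algebra_simps)
  finally show "((\<lambda>s. cnj (K (Z s))) has_vector_derivative (\<Sum>j<d. cnj (K2 j (Z t)) * Z' j + cnj (K1 j (Z t)) * cnj (Z' j))) (at t)" .
qed

lemma wirtinger_add:
  "wirtinger d K K1 K2 \<Longrightarrow> wirtinger d L L1 L2 \<Longrightarrow> wirtinger d (\<lambda>z. K z + L z) (\<lambda>j z. K1 j z + L1 j z) (\<lambda>j z. K2 j z + L2 j z)"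
  unfolding wirtinger_def
proof (intro allI impI, goal_cases)
  case (1 Z Z' t)
  then have "((\<lambda>s. K (Z s) + L (Z s)) has_vector_derivative
     (\<Sum>j<d. K1 j (Z t) * Z' j + K2 j (Z t) * cnj (Z' j)) + (\<Sum>j<d. L1 j (Z t) * Z' j + L2 j (Z t) * cnj (Z' j))) (at t)"
    by (intro has_vector_derivative_add) blast+
  then show ?case by (simp add: sum.distrib[symmetric] algebra_simps)
qed

lemma wirtinger_mult:
  "wirtinger d K K1 K2 \<Longrightarrow> wirtinger d L L1 L2 \<Longrightarrow>
   wirtinger d (\<lambda>z. K z * L z) (\<lambda>j z. K1 j z * L z + K z * L1 j z) (\<lambda>j z. K2 j z * L z + K z * L2 j z)"
  unfolding wirtinger_def
proof (intro allI impI, goal_cases)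
  case (1 Z Z' t)
  then have "((\<lambda>s. K (Z s) * L (Z s)) has_vector_derivative
     K (Z t) * (\<Sum>j<d. L1 j (Z t) * Z' j + L2 j (Z t) * cnj (Z' j)) + (\<Sum>j<d. K1 j (Z t) * Z' j + K2 j (Z t) * cnj (Z' j)) * L (Z t)) (at t)"
    by (intro has_vector_derivative_mult) blast+
  then show ?case by (simp add: sum.distrib[symmetric] sum_distrib_left sum_distrib_right algebra_simps)
qed

lemma wirtinger_cmult: "wirtinger d L L1 L2 \<Longrightarrow> wirtinger d (\<lambda>z. c * L z) (\<lambda>j z. c * L1 j z) (\<lambda>j z. c * L2 j z)"
  by (rule wirtinger_cong[OF wirtinger_mult[OF wirtinger_const]]) auto

lemma wirtinger_power:
  assumes "wirtinger d K K1 K2"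
  shows "wirtinger d (\<lambda>z. K z ^ n) (\<lambda>j z. of_nat n * K z ^ (n - 1) * K1 j z) (\<lambda>j z. of_nat n * K z ^ (n - 1) * K2 j z)"
proof (induction n)
  case 0
  then show ?case by (simp add: wirtinger_const)
next
  case (Suc n)
  show ?case
    by (rule wirtinger_cong[OF wirtinger_mult[OF assms Suc.IH]]) (cases n; simp add: algebra_simps)+
qed

text \<open>Along a curve on which K has derivative w', the base |K|^2 + e has the real derivative K
  cnj w' + w' cnj K. As e > 0 keeps the base positive, its power is differentiable even at zeros of
  K.\<close>

lemma wirtinger_powr:
  assumes K: "wirtinger d K K1 K2" and e: "e > 0"
  shows "wirtinger d (\<lambda>z. of_real (((cmod (K z))\<^sup>2 + e) powr b))
    (\<lambda>j z. of_real (b * ((cmod (K z))\<^sup>2 + e) powr (b - 1)) * (cnj (K z) * K1 j z + K z * cnj (K2 j z)))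
    (\<lambda>j z. of_real (b * ((cmod (K z))\<^sup>2 + e) powr (b - 1)) * (cnj (K z) * K2 j z + K z * cnj (K1 j z)))"
  unfolding wirtinger_def
proof (intro allI impI)
  fix Z :: "real \<Rightarrow> nat \<Rightarrow> complex" and Z' t
  assume Z: "\<forall>j<d. ((\<lambda>s. Z s j) has_vector_derivative Z' j) (at t)"
  define w' where "w' = (\<Sum>j<d. K1 j (Z t) * Z' j + K2 j (Z t) * cnj (Z' j))"
  have w: "((\<lambda>s. K (Z s)) has_vector_derivative w') (at t)"
    unfolding w'_def by (rule wirtingerD[OF K]) (use Z in blast)
  define q where "q s = (cmod (K (Z s)))\<^sup>2 + e" for s
  have qpos: "q s > 0" for s using e by (simp add: q_def add_nonneg_pos)
  have "((\<lambda>s. Re (K (Z s) * cnj (K (Z s)))) has_vector_derivative Re (K (Z t) * cnj w' + w' * cnj (K (Z t)))) (at t)"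
    by (intro bounded_linear.has_vector_derivative[OF bounded_linear_Re] has_vector_derivative_mult w
        bounded_linear.has_vector_derivative[OF bounded_linear_cnj])
  also have "(\<lambda>s. Re (K (Z s) * cnj (K (Z s)))) = (\<lambda>s. q s - e)"
    by (simp only: q_def cmod_power2 complex_mult_cnj fun_eq_iff) simp
  finally have "((\<lambda>s. (q s - e) + e) has_vector_derivative (Re (K (Z t) * cnj w' + w' * cnj (K (Z t))) + 0)) (at t)"
    by (intro has_vector_derivative_add has_vector_derivative_const)
  then have q: "(q has_real_derivative Re (K (Z t) * cnj w' + w' * cnj (K (Z t)))) (at t)"
    by (simp add: has_real_derivative_iff_has_vector_derivative)
  have "((\<lambda>s. q s powr b) has_real_derivative (b * q t powr (b - 1) * Re (K (Z t) * cnj w' + w' * cnj (K (Z t))))) (at t)"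
    by (rule DERIV_cong[OF DERIV_fun_powr[OF q qpos]]) simp
  then have "((\<lambda>s. of_real (q s powr b)) has_vector_derivative
      complex_of_real (b * q t powr (b - 1) * Re (K (Z t) * cnj w' + w' * cnj (K (Z t))))) (at t)"
    by (intro has_vector_derivative_of_real) (simp add: has_real_derivative_iff_has_vector_derivative)
  also have "complex_of_real (Re (K (Z t) * cnj w' + w' * cnj (K (Z t)))) = K (Z t) * cnj w' + w' * cnj (K (Z t))"
    by (simp add: complex_eq_iff)
  then have "complex_of_real (b * q t powr (b - 1) * Re (K (Z t) * cnj w' + w' * cnj (K (Z t)))) =
     of_real (b * q t powr (b - 1)) * (K (Z t) * cnj w' + w' * cnj (K (Z t)))"
    by (simp only: of_real_mult)
  also have "\<dots> = (\<Sum>j<d. of_real (b * q t powr (b - 1)) * (cnj (K (Z t)) * K1 j (Z t) + K (Z t) * cnj (K2 j (Z t))) * Z' j +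
          of_real (b * q t powr (b - 1)) * (cnj (K (Z t)) * K2 j (Z t) + K (Z t) * cnj (K1 j (Z t))) * cnj (Z' j))"
    unfolding w'_def by (simp add: sum.distrib[symmetric] sum_distrib_left sum_distrib_right algebra_simps)
  finally show "((\<lambda>s. of_real (((cmod (K (Z s)))\<^sup>2 + e) powr b)) has_vector_derivative
       (\<Sum>j<d. of_real (b * ((cmod (K (Z t)))\<^sup>2 + e) powr (b - 1)) * (cnj (K (Z t)) * K1 j (Z t) + K (Z t) * cnj (K2 j (Z t))) * Z' j +
          of_real (b * ((cmod (K (Z t)))\<^sup>2 + e) powr (b - 1)) * (cnj (K (Z t)) * K2 j (Z t) + K (Z t) * cnj (K1 j (Z t))) * cnj (Z' j))) (at t)"
    unfolding q_def .
qed

section \<open>Complex polynomials and their partial derivatives\<close>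

inductive cpoly :: "nat \<Rightarrow> ((nat \<Rightarrow> complex) \<Rightarrow> complex) \<Rightarrow> bool" for d where
  const: "cpoly d (\<lambda>_. c)"
| coord: "j < d \<Longrightarrow> cpoly d (\<lambda>z. z j)"
| add: "cpoly d M \<Longrightarrow> cpoly d L \<Longrightarrow> cpoly d (\<lambda>z. M z + L z)"
| mult: "cpoly d M \<Longrightarrow> cpoly d L \<Longrightarrow> cpoly d (\<lambda>z. M z * L z)"

definition pd :: "nat \<Rightarrow> ((nat \<Rightarrow> complex) \<Rightarrow> complex) \<Rightarrow> (nat \<Rightarrow> complex) \<Rightarrow> complex" where
  "pd j M z = deriv (\<lambda>t. M (z(j := t))) (z j)"

lemma cpoly_tame: "cpoly d M \<Longrightarrow> tame d M"
  by (induction rule: cpoly.induct) auto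

text \<open>The induction carries an abstract family D, for which being polynomial, the chain rule
  and the coordinate derivative are proved together; \<open>cpoly_pd\<close> then identifies D with
  \<open>pd\<close>. The zero in the last slot of \<open>wirtinger\<close> expresses
  holomorphy.\<close>

lemma cpoly_derivs:
  assumes "cpoly d M"
  shows "\<exists>D. (\<forall>j. cpoly d (D j)) \<and> wirtinger d M D (\<lambda>_ _. 0) \<and>
    (\<forall>j z t. ((\<lambda>t. M (z(j := t))) has_field_derivative D j (z(j := t))) (at t))"
  using assms
proof (induction rule: cpoly.induct)
  case (const c)
  then show ?case by (intro exI[of _ "\<lambda>_ _. 0"]) (auto intro: cpoly.intros wirtinger_const)
next
  case (coord i)
  show ?case
  proof (intro exI[of _ "\<lambda>j _. of_bool (i = j)"] conjI allI)
    show "((\<lambda>t. (z(j := t)) i) has_field_derivative of_bool (i = j)) (at t)" for j t and z :: "nat \<Rightarrow> complex"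
      by (cases "i = j") (auto intro!: derivative_eq_intros)
  qed (use coord in \<open>auto intro: cpoly.intros wirtinger_coord\<close>)
next
  case (add M L)
  then obtain D D' where D: "\<And>j. cpoly d (D j)" "wirtinger d M D (\<lambda>_ _. 0)"
      "\<And>j z t. ((\<lambda>t. M (z(j := t))) has_field_derivative D j (z(j := t))) (at t)"
    and D': "\<And>j. cpoly d (D' j)" "wirtinger d L D' (\<lambda>_ _. 0)"
      "\<And>j z t. ((\<lambda>t. L (z(j := t))) has_field_derivative D' j (z(j := t))) (at t)" by blast
  have "wirtinger d (\<lambda>z. M z + L z) (\<lambda>j z. D j z + D' j z) (\<lambda>_ _. 0)"
    using wirtinger_add[OF D(2) D'(2)] by simp
  moreover have "((\<lambda>t. M (z(j := t)) + L (z(j := t))) has_field_derivative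
      D j (z(j := t)) + D' j (z(j := t))) (at t)" for j z t
    by (rule DERIV_add[OF D(3) D'(3)])
  moreover have "cpoly d (\<lambda>z. D j z + D' j z)" for j
    by (intro cpoly.intros D D')
  ultimately show ?case by (intro exI[of _ "\<lambda>j z. D j z + D' j z"]) blast
next
  case (mult M L)
  then obtain D D' where D: "\<And>j. cpoly d (D j)" "wirtinger d M D (\<lambda>_ _. 0)"
      "\<And>j z t. ((\<lambda>t. M (z(j := t))) has_field_derivative D j (z(j := t))) (at t)"
    and D': "\<And>j. cpoly d (D' j)" "wirtinger d L D' (\<lambda>_ _. 0)"
      "\<And>j z t. ((\<lambda>t. L (z(j := t))) has_field_derivative D' j (z(j := t))) (at t)" by blast
  have "wirtinger d (\<lambda>z. M z * L z) (\<lambda>j z. D j z * L z + M z * D' j z) (\<lambda>_ _. 0)"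
    using wirtinger_mult[OF D(2) D'(2)] by simp
  moreover have "cpoly d (\<lambda>z. D j z * L z + M z * D' j z)" for j
    by (intro cpoly.intros D D' mult)
  moreover have "((\<lambda>t. M (z(j := t)) * L (z(j := t))) has_field_derivative
      D j (z(j := t)) * L (z(j := t)) + M (z(j := t)) * D' j (z(j := t))) (at t)" for j z t
    by (rule DERIV_cong[OF DERIV_mult[OF D(3) D'(3)]]) (simp add: algebra_simps)
  ultimately show ?case by (intro exI[of _ "\<lambda>j z. D j z * L z + M z * D' j z"]) blast
qed

lemma cpoly_pd:
  assumes "cpoly d M"
  shows "cpoly d (pd j M)" and "wirtinger d M (\<lambda>j. pd j M) (\<lambda>_ _. 0)"
    and "((\<lambda>t. M (z(j := t))) has_field_derivative pd j M (z(j := t))) (at t)"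
proof -
  obtain D where D: "\<And>j. cpoly d (D j)" "wirtinger d M D (\<lambda>_ _. 0)"
      "\<And>j z t. ((\<lambda>t. M (z(j := t))) has_field_derivative D j (z(j := t))) (at t)"
    using cpoly_derivs[OF assms] by blast
  have "pd j M = D j" for j
  proof
    fix z show "pd j M z = D j z"
      unfolding pd_def using DERIV_imp_deriv[OF D(3)[of z j "z j"]] by simp
  qed
  then show "cpoly d (pd j M)" and "wirtinger d M (\<lambda>j. pd j M) (\<lambda>_ _. 0)"
    and "((\<lambda>t. M (z(j := t))) has_field_derivative pd j M (z(j := t))) (at t)"
    using D by auto
qed

section \<open>Gaussian integration by parts in complex coordinates\<close>

text \<open>The coordinates of g form three blocks of length d: the real vector x, then the real and
  the imaginary parts of \<zeta>. Division by sqrt 2 normalises E |\<zeta>_j|^2 = 1, while E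
  \<zeta>_j^2 = 0.\<close>

definition zeta :: "nat \<Rightarrow> (nat \<Rightarrow> real) \<Rightarrow> nat \<Rightarrow> complex" where
  "zeta d g j = Complex (g (d + j)) (g (2 * d + j)) / of_real (sqrt 2)"

definition Zc :: "nat \<Rightarrow> complex \<Rightarrow> (nat \<Rightarrow> real) \<Rightarrow> nat \<Rightarrow> complex" where
  "Zc d l g j = of_real (g j) + l * zeta d g j"

lemma gauss_coord_measurable: "k \<in> I \<Longrightarrow> (\<lambda>g. g k) \<in> borel_measurable (gauss I)"
  using measurable_component_singleton[of k I "\<lambda>_. std_normal_distribution"] by simp

lemma zeta_eq: "zeta d g j = of_real (g (d + j) / sqrt 2) + \<i> * of_real (g (2 * d + j) / sqrt 2)"
  by (simp add: zeta_def complex_eq_iff)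

lemma zeta_measurable: "j < d \<Longrightarrow> (\<lambda>g. zeta d g j) \<in> borel_measurable (gauss {..<3 * d})"
proof -
  assume "j < d"
  then have [measurable]: "(\<lambda>g. g (d + j)) \<in> borel_measurable (gauss {..<3 * d})"
     "(\<lambda>g. g (2 * d + j)) \<in> borel_measurable (gauss {..<3 * d})"
    by (auto intro!: gauss_coord_measurable)
  show ?thesis unfolding zeta_eq by measurable
qed

lemma Zc_measurable: "j < d \<Longrightarrow> (\<lambda>g. Zc d l g j) \<in> borel_measurable (gauss {..<3 * d})"
proof -
  assume "j < d"
  then have [measurable]: "(\<lambda>g. g j) \<in> borel_measurable (gauss {..<3 * d})"
     "(\<lambda>g. zeta d g j) \<in> borel_measurable (gauss {..<3 * d})"
    by (auto intro!: gauss_coord_measurable zeta_measurable)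
  show ?thesis unfolding Zc_def by measurable
qed

lemma wt_3:
  fixes g :: "nat \<Rightarrow> real"
  shows "wt {..<3 * d} g = (\<Prod>j<d. (1 + \<bar>g j\<bar>) * (1 + \<bar>g (d + j)\<bar>) * (1 + \<bar>g (2 * d + j)\<bar>))"
proof -
  have sh: "prod f {k..<k + d} = (\<Prod>j<d. f (k + j))" for k :: nat and f :: "nat \<Rightarrow> real"
    using prod.shift_bounds_nat_ivl[of f 0 k d] by (simp add: lessThan_atLeast0 add.commute)
  have "wt {..<3 * d} g = (\<Prod>m<3. prod (\<lambda>j. 1 + \<bar>g j\<bar>) {m * d..<m * d + d})"
    unfolding wt_def real_norm_def by (rule prod.nat_group[symmetric])
  also have "\<dots> = (\<Prod>j<d. (1 + \<bar>g j\<bar>) * (1 + \<bar>g (d + j)\<bar>) * (1 + \<bar>g (2 * d + j)\<bar>))"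
    unfolding sh by (simp add: numeral_3_eq_3 lessThan_Suc prod.distrib mult_2 mult_2_right ac_simps)
  finally show ?thesis .
qed

lemma wt_mono_prod:
  fixes a :: "'a::real_normed_vector" 
  shows "(\<And>j. j < d \<Longrightarrow> 1 + norm (z j) \<le> c * f j) \<Longrightarrow> wt {..<d} z \<le> c ^ d * (\<Prod>j<d. f j)"
proof -
  assume *: "\<And>j. j < d \<Longrightarrow> 1 + norm (z j) \<le> c * f j"
  have "wt {..<d} z \<le> (\<Prod>j<d. c * f j)"
    unfolding wt_def by (intro prod_mono) (use * in auto)
  then show ?thesis by (simp add: prod.distrib)
qed

lemma norm_zeta_le: "norm (zeta d g j) \<le> \<bar>g (d + j)\<bar> + \<bar>g (2 * d + j)\<bar>"
proof -
  have "norm (zeta d g j) \<le> norm (Complex (g (d + j)) (g (2 * d + j)))"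
    unfolding zeta_def by (simp add: norm_divide divide_le_eq mult_le_cancel_left1)
  also have "\<dots> \<le> \<bar>g (d + j)\<bar> + \<bar>g (2 * d + j)\<bar>"
    using cmod_le[of "Complex (g (d + j)) (g (2 * d + j))"] by simp
  finally show ?thesis .
qed

lemma one_plus_norm_Zc_le:
  "1 + norm (Zc d l g j) \<le> (1 + norm l) * ((1 + \<bar>g j\<bar>) * (1 + \<bar>g (d + j)\<bar>) * (1 + \<bar>g (2 * d + j)\<bar>))"
proof -
  let ?a = "\<bar>g j\<bar>" and ?b = "\<bar>g (d + j)\<bar>" and ?c = "\<bar>g (2 * d + j)\<bar>"
  have "norm (Zc d l g j) \<le> ?a + norm l * norm (zeta d g j)"
    unfolding Zc_def by (rule order_trans[OF norm_triangle_ineq]) (simp add: norm_mult)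
  also have "\<dots> \<le> ?a + norm l * (?b + ?c)"
    by (intro add_left_mono mult_left_mono norm_zeta_le) auto
  finally have "1 + norm (Zc d l g j) \<le> 1 + ?a + norm l * (?b + ?c)" by simp
  also have "\<dots> \<le> (1 + norm l) * (1 + ?a + ?b + ?c)"
    by (simp add: algebra_simps)
  also have "\<dots> \<le> (1 + norm l) * ((1 + ?a) * (1 + ?b) * (1 + ?c))"
    by (intro mult_left_mono) (simp_all add: algebra_simps)
  finally show ?thesis .
qed

lemma wt_Zc: "wt {..<d} (Zc d l g) \<le> (1 + norm l) ^ d * wt {..<3 * d} g"
  unfolding wt_3 by (rule wt_mono_prod) (rule one_plus_norm_Zc_le)

lemma coord_le_wt: "finite I \<Longrightarrow> k \<in> I \<Longrightarrow> 1 + norm (g k) \<le> wt I g"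
  using mult_left_mono[OF wt_ge_1[of "I - {k}" g], of "1 + norm (g k)"] wt_upd[of I k g "g k"] by simp

lemma norm_zeta_le_wt: "j < d \<Longrightarrow> norm (zeta d g j) \<le> 2 * wt {..<3 * d} g"
  using norm_zeta_le[of d g j] coord_le_wt[of "{..<3 * d}" "d + j" g] coord_le_wt[of "{..<3 * d}" "2 * d + j" g]
  by simp

text \<open>The constants do not depend on l, whose influence is the explicit power of 1 + |l|; this
  gives a common dominating function when l moves along a curve.\<close>

lemma tame_Zc_bound:
  assumes "tame d K"
  shows "\<exists>C m. C \<ge> 0 \<and> (\<forall>l g. norm (K (Zc d l g)) \<le> C * (1 + norm l) ^ (d * m) * wt {..<3 * d} g ^ m)"
proof -
  obtain C m where C: "C \<ge> 0" "\<And>z. norm (K z) \<le> C * wt {..<d} z ^ m" using tame_bound[OF assms] by blast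
  have "norm (K (Zc d l g)) \<le> C * (1 + norm l) ^ (d * m) * wt {..<3 * d} g ^ m" for l g
  proof -
    have "norm (K (Zc d l g)) \<le> C * wt {..<d} (Zc d l g) ^ m" by (rule C(2))
    also have "\<dots> \<le> C * ((1 + norm l) ^ d * wt {..<3 * d} g) ^ m"
      by (rule mult_left_mono[OF power_mono[OF wt_Zc less_imp_le[OF wt_pos]] C(1)])
    finally show ?thesis by (simp only: power_mult_distrib power_mult mult.assoc)
  qed
  with C(1) show ?thesis by blast
qed

lemma tame_Zc_measurable: "tame d K \<Longrightarrow> (\<lambda>g. K (Zc d l g)) \<in> borel_measurable (gauss {..<3 * d})"
  by (rule tame_measurable) (auto intro: Zc_measurable)

lemma tame_Zc_integrable: "tame d K \<Longrightarrow> integrable (gauss {..<3 * d}) (\<lambda>g. K (Zc d l g))"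
proof -
  assume K: "tame d K"
  obtain C m where "C \<ge> 0" "\<And>l g. norm (K (Zc d l g)) \<le> C * (1 + norm l) ^ (d * m) * wt {..<3 * d} g ^ m"
    using tame_Zc_bound[OF K] by blast
  then show ?thesis by (intro integrable_gauss_wt_bound[OF _ tame_Zc_measurable[OF K]]) auto
qed

lemma tame_Zc_integrable_coord:
  assumes K: "tame d K" and k: "k < 3 * d"
  shows "integrable (gauss {..<3 * d}) (\<lambda>g. g k *\<^sub>R K (Zc d l g))"
proof -
  obtain C m where C: "C \<ge> 0" "\<And>l g. norm (K (Zc d l g)) \<le> C * (1 + norm l) ^ (d * m) * wt {..<3 * d} g ^ m"
    using tame_Zc_bound[OF K] by blast
  have [measurable]: "(\<lambda>g. K (Zc d l g)) \<in> borel_measurable (gauss {..<3 * d})"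
    "(\<lambda>g. g k) \<in> borel_measurable (gauss {..<3 * d})"
    using k by (auto intro!: tame_Zc_measurable K gauss_coord_measurable)
  show ?thesis
  proof (rule integrable_gauss_wt_bound)
    fix g :: "nat \<Rightarrow> real"
    have "norm (g k *\<^sub>R K (Zc d l g)) \<le> wt {..<3 * d} g * (C * (1 + norm l) ^ (d * m) * wt {..<3 * d} g ^ m)"
      unfolding norm_scaleR
    proof (intro mult_mono C)
      show "\<bar>g k\<bar> \<le> wt {..<3 * d} g" using coord_le_wt[of "{..<3 * d}" k g] k by simp
    qed (auto intro: less_imp_le[OF wt_pos])
    then show "norm (g k *\<^sub>R K (Zc d l g)) \<le> (C * (1 + norm l) ^ (d * m)) * wt {..<3 * d} g ^ Suc m"
      by (simp add: ac_simps)
  qed auto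
qed

abbreviation EZ :: "nat \<Rightarrow> complex \<Rightarrow> ((nat \<Rightarrow> complex) \<Rightarrow> complex) \<Rightarrow> complex" where
  "EZ d l K \<equiv> (\<integral>g. K (Zc d l g) \<partial>gauss {..<3 * d})"

text \<open>One statement for all three blocks: by hypothesis \<open>c\<close>, the coordinate k of
  g moves only z_j, and does so along the complex direction c, so differentiating in g k applies c
  to \<open>K1 j\<close> and cnj c to \<open>K2 j\<close>. The directions used are 1, l / sqrt 2 and
  i l / sqrt 2.\<close>

lemma Zc_ibp:
  assumes K: "wirtinger d K K1 K2" "tame d K" "tame d (K1 j)" "tame d (K2 j)" and jk: "j < d" "k < 3 * d"
    and c: "\<And>g t i. i < d \<Longrightarrow> Zc d l (g(k := t)) i = Zc d l (g(k := 0)) i + (if i = j then of_real t * c else 0)"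
  shows "(\<integral>g. of_real (g k) * K (Zc d l g) \<partial>gauss {..<3 * d}) = EZ d l (K1 j) * c + EZ d l (K2 j) * cnj c"
proof -
  define L where "L z = K1 j z * c + K2 j z * cnj c" for z
  have L: "tame d L" unfolding L_def by (intro tame_add tame_mult K tame_const)
  have der: "((\<lambda>s. Zc d l (g(k := s)) i) has_vector_derivative (if i = j then c else 0)) (at t)" if "i < d" for g t i
  proof -
    have "((\<lambda>s. Zc d l (g(k := 0)) i + (if i = j then of_real s * c else 0)) has_vector_derivative (if i = j then c else 0)) (at t)"
      by (cases "i = j") (auto intro!: derivative_eq_intros)
    then show ?thesis by (subst c[OF that])
  qed
  have "(\<integral>g. g k *\<^sub>R K (Zc d l g) \<partial>gauss {..<3 * d}) = (\<integral>g. L (Zc d l g) \<partial>gauss {..<3 * d})"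
  proof -
    obtain C m where "C \<ge> 0" and C: "\<And>l g. norm (K (Zc d l g)) \<le> C * (1 + norm l) ^ (d * m) * wt {..<3 * d} g ^ m"
      using tame_Zc_bound[OF K(2)] by blast
    obtain C' m' where "C' \<ge> 0" and C': "\<And>l g. norm (L (Zc d l g)) \<le> C' * (1 + norm l) ^ (d * m') * wt {..<3 * d} g ^ m'"
      using tame_Zc_bound[OF L] by blast
    show ?thesis
    proof (rule gauss_ibp[OF _ _ _ _ _ _ C C'])
      fix g t
      have "((\<lambda>s. K (Zc d l (g(k := s)))) has_vector_derivative
          (\<Sum>i<d. K1 i (Zc d l (g(k := t))) * (if i = j then c else 0) + K2 i (Zc d l (g(k := t))) * cnj (if i = j then c else 0))) (at t)"
        by (rule wirtingerD[OF K(1) der])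
      also have "(\<Sum>i<d. K1 i (Zc d l (g(k := t))) * (if i = j then c else 0) + K2 i (Zc d l (g(k := t))) * cnj (if i = j then c else 0))
        = (\<Sum>i<d. if i = j then L (Zc d l (g(k := t))) else 0)"
        by (intro sum.cong) (auto simp: L_def)
      also have "\<dots> = L (Zc d l (g(k := t)))" using jk by simp
      finally show "((\<lambda>s. K (Zc d l (g(k := s)))) has_vector_derivative L (Zc d l (g(k := t)))) (at t)" .
      show "continuous_on UNIV (\<lambda>t. L (Zc d l (g(k := t))))"
      proof (rule tame_continuous[OF L])
        fix i assume "i < d"
        then show "continuous_on UNIV (\<lambda>t. Zc d l (g(k := t)) i)"
          using der by (meson continuous_at_imp_continuous_on has_vector_derivative_continuous)
      qed
    qed (use jk K L in \<open>auto intro!: tame_Zc_measurable\<close>)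
  qed
  then show ?thesis
    unfolding L_def scaleR_conv_of_real using K by (simp add: tame_Zc_integrable)
qed

context
  fixes d K K1 K2 j and l :: complex
  assumes K: "wirtinger d K K1 K2" "tame d K" "tame d (K1 j)" "tame d (K2 j)" and j: "j < d"
begin

lemma Zc_ibp_x: "(\<integral>g. of_real (g j) * K (Zc d l g) \<partial>gauss {..<3 * d}) = EZ d l (K1 j) + EZ d l (K2 j)"
proof -
  have "(\<integral>g. of_real (g j) * K (Zc d l g) \<partial>gauss {..<3 * d}) = EZ d l (K1 j) * 1 + EZ d l (K2 j) * cnj 1"
    by (rule Zc_ibp[OF K j]) (use j in \<open>auto simp: Zc_def zeta_def\<close>)
  then show ?thesis by simp
qed

lemma Zc_ibp_y:
  "(\<integral>g. of_real (g (d + j)) * K (Zc d l g) \<partial>gauss {..<3 * d})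
     = (l * EZ d l (K1 j) + cnj l * EZ d l (K2 j)) / of_real (sqrt 2)"
proof -
  have "(\<integral>g. of_real (g (d + j)) * K (Zc d l g) \<partial>gauss {..<3 * d})
     = EZ d l (K1 j) * (l / of_real (sqrt 2)) + EZ d l (K2 j) * cnj (l / of_real (sqrt 2))"
    by (rule Zc_ibp[OF K j]) (use j in \<open>auto simp: Zc_def zeta_eq algebra_simps\<close>)
  then show ?thesis by (simp add: field_simps)
qed

lemma Zc_ibp_y':
  "(\<integral>g. of_real (g (2 * d + j)) * K (Zc d l g) \<partial>gauss {..<3 * d})
     = (\<i> * l * EZ d l (K1 j) - \<i> * cnj l * EZ d l (K2 j)) / of_real (sqrt 2)"
proof -
  have "(\<integral>g. of_real (g (2 * d + j)) * K (Zc d l g) \<partial>gauss {..<3 * d})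
     = EZ d l (K1 j) * (\<i> * l / of_real (sqrt 2)) + EZ d l (K2 j) * cnj (\<i> * l / of_real (sqrt 2))"
    by (rule Zc_ibp[OF K j]) (use j in \<open>auto simp: Zc_def zeta_eq algebra_simps\<close>)
  then show ?thesis by (simp add: field_simps)
qed

lemma integrable_coord_mult_Zc: "k < 3 * d \<Longrightarrow> integrable (gauss {..<3 * d}) (\<lambda>g. of_real (g k) * K (Zc d l g))"
  using tame_Zc_integrable_coord[OF K(2)] by (simp add: scaleR_conv_of_real)

lemma zeta_mult_expand: "zeta d g j * K z = (of_real (g (d + j)) * K z + \<i> * (of_real (g (2 * d + j)) * K z)) / of_real (sqrt 2)"
  "cnj (zeta d g j) * K z = (of_real (g (d + j)) * K z - \<i> * (of_real (g (2 * d + j)) * K z)) / of_real (sqrt 2)"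
  unfolding zeta_eq by (simp_all add: field_simps)

lemma integrable_zeta_mult: "integrable (gauss {..<3 * d}) (\<lambda>g. zeta d g j * K (Zc d l g))"
  "integrable (gauss {..<3 * d}) (\<lambda>g. cnj (zeta d g j) * K (Zc d l g))"
  unfolding zeta_mult_expand using j
  by (auto intro!: integrable_divide Bochner_Integration.integrable_add Bochner_Integration.integrable_diff
      integrable_mult_right integrable_coord_mult_Zc)

lemma sqrt2_complex: "complex_of_real (sqrt 2) * complex_of_real (sqrt 2) = 2"
  by (simp flip: of_real_mult)

text \<open>Since E \<zeta>_j^2 = 0, the variable \<zeta>_j has covariance 0 with z_j and covariance
  cnj l with cnj z_j; hence only the derivative in cnj z_j survives.\<close>

lemma Zc_ibp_zeta: "(\<integral>g. zeta d g j * K (Zc d l g) \<partial>gauss {..<3 * d}) = cnj l * EZ d l (K2 j)"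
proof -
  have "(\<integral>g. zeta d g j * K (Zc d l g) \<partial>gauss {..<3 * d})
    = ((l * EZ d l (K1 j) + cnj l * EZ d l (K2 j)) / of_real (sqrt 2)
       + \<i> * ((\<i> * l * EZ d l (K1 j) - \<i> * cnj l * EZ d l (K2 j)) / of_real (sqrt 2))) / of_real (sqrt 2)"
    unfolding zeta_mult_expand Zc_ibp_y[symmetric] Zc_ibp_y'[symmetric] using j
    by (simp add: integrable_coord_mult_Zc Bochner_Integration.integral_add)
  also have "\<dots> = (2 * (cnj l * EZ d l (K2 j))) / (complex_of_real (sqrt 2) * complex_of_real (sqrt 2))"
    by (simp add: field_simps)
  also have "\<dots> = cnj l * EZ d l (K2 j)" unfolding sqrt2_complex by simp
  finally show ?thesis .
qed

lemma Zc_ibp_cnj_zeta: "(\<integral>g. cnj (zeta d g j) * K (Zc d l g) \<partial>gauss {..<3 * d}) = l * EZ d l (K1 j)"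
proof -
  have "(\<integral>g. cnj (zeta d g j) * K (Zc d l g) \<partial>gauss {..<3 * d})
    = ((l * EZ d l (K1 j) + cnj l * EZ d l (K2 j)) / of_real (sqrt 2)
       - \<i> * ((\<i> * l * EZ d l (K1 j) - \<i> * cnj l * EZ d l (K2 j)) / of_real (sqrt 2))) / of_real (sqrt 2)"
    unfolding zeta_mult_expand Zc_ibp_y[symmetric] Zc_ibp_y'[symmetric] using j
    by (simp add: integrable_coord_mult_Zc Bochner_Integration.integral_diff)
  also have "\<dots> = (2 * (l * EZ d l (K1 j))) / (complex_of_real (sqrt 2) * complex_of_real (sqrt 2))"
    by (simp add: field_simps)
  also have "\<dots> = l * EZ d l (K1 j)" unfolding sqrt2_complex by simp
  finally show ?thesis .
qed

text \<open>The coefficients are the covariances of cnj z_j with cnj z_j, which is 1 because only x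
  contributes, and with z_j, which is 1 + |l|^2.\<close>

lemma Zc_ibp_cnj_z: "EZ d l (\<lambda>z. cnj (z j) * K z) = EZ d l (K2 j) + (1 + (norm l)\<^sup>2) * EZ d l (K1 j)"
proof -
  have "EZ d l (\<lambda>z. cnj (z j) * K z) = (\<integral>g. of_real (g j) * K (Zc d l g) + cnj l * (cnj (zeta d g j) * K (Zc d l g)) \<partial>gauss {..<3 * d})"
    by (simp add: Zc_def algebra_simps)
  also have "\<dots> = (EZ d l (K1 j) + EZ d l (K2 j)) + cnj l * (l * EZ d l (K1 j))"
    using j by (simp add: integrable_coord_mult_Zc integrable_zeta_mult Zc_ibp_x Zc_ibp_cnj_zeta)
  also have "cnj l * (l * EZ d l (K1 j)) = of_real ((norm l)\<^sup>2) * EZ d l (K1 j)"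
    unfolding complex_norm_square by simp
  finally show ?thesis by (simp add: algebra_simps)
qed

end

text \<open>The t-derivative of K (x + \<lambda>(t) \<zeta>) is linear in \<zeta> and its conjugate,
  and integrating these by parts adds the derivative of the opposite type. Thus only the mixed
  derivatives \<open>L j\<close> remain, multiplied by the derivative of |\<lambda>|^2. That the two
  orders of mixed differentiation agree is a hypothesis, to be checked for each kernel.\<close>

lemma heat:
  fixes lam :: "real \<Rightarrow> complex"
  assumes K: "wirtinger d K K1 K2" "tame d K"
    and K1: "\<And>j. j < d \<Longrightarrow> wirtinger d (K1 j) (K11 j) (K12 j)" "\<And>j. j < d \<Longrightarrow> tame d (K1 j)"
    and K2: "\<And>j. j < d \<Longrightarrow> wirtinger d (K2 j) (K21 j) (K22 j)" "\<And>j. j < d \<Longrightarrow> tame d (K2 j)"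
    and t: "\<And>j. j < d \<Longrightarrow> tame d (K11 j j)" "\<And>j. j < d \<Longrightarrow> tame d (K22 j j)"
      "\<And>j. j < d \<Longrightarrow> tame d (L j)"
    and L: "\<And>j. j < d \<Longrightarrow> K12 j j = L j" "\<And>j. j < d \<Longrightarrow> K21 j j = L j"
    and lam: "\<And>t. (lam has_vector_derivative lam' t) (at t)"
    and R: "\<And>t. \<bar>t - t0\<bar> \<le> 1 \<Longrightarrow> norm (lam t) \<le> R" "\<And>t. \<bar>t - t0\<bar> \<le> 1 \<Longrightarrow> norm (lam' t) \<le> R"
  shows "((\<lambda>t. EZ d (lam t) K) has_vector_derivative
      of_real (2 * Re (lam' t0 * cnj (lam t0))) * (\<Sum>j<d. EZ d (lam t0) (L j))) (at t0)"
proof -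
  let ?G = "gauss {..<3 * d}"
  define D where "D t g = (\<Sum>j<d. K1 j (Zc d (lam t) g) * (lam' t * zeta d g j)
      + K2 j (Zc d (lam t) g) * cnj (lam' t * zeta d g j))" for t g
  have der: "((\<lambda>t. K (Zc d (lam t) g)) has_vector_derivative D t g) (at t)" for t g
    unfolding D_def
    by (rule wirtingerD[OF K(1)]) (auto simp: Zc_def intro!: derivative_eq_intros lam)
  have "\<exists>C m. C \<ge> 0 \<and> (\<forall>l g. norm (K1 j (Zc d l g)) + norm (K2 j (Zc d l g)) \<le> C * (1 + norm l) ^ m * wt {..<3 * d} g ^ m)"
    if j: "j < d" for j
  proof -
    obtain C m where C: "C \<ge> 0" "\<And>l g. norm (K1 j (Zc d l g)) \<le> C * (1 + norm l) ^ (d * m) * wt {..<3 * d} g ^ m"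
      using tame_Zc_bound[OF K1(2)[OF j]] by blast
    obtain C' m' where C': "C' \<ge> 0" "\<And>l g. norm (K2 j (Zc d l g)) \<le> C' * (1 + norm l) ^ (d * m') * wt {..<3 * d} g ^ m'"
      using tame_Zc_bound[OF K2(2)[OF j]] by blast
    define n where "n = d * m + m + d * m' + m'"
    have "norm (K1 j (Zc d l g)) + norm (K2 j (Zc d l g)) \<le> (C + C') * (1 + norm l) ^ n * wt {..<3 * d} g ^ n" for l g
    proof -
      have "norm (K1 j (Zc d l g)) \<le> C * (1 + norm l) ^ n * wt {..<3 * d} g ^ n"
        by (rule order_trans[OF C(2)], intro mult_mono power_increasing mult_nonneg_nonneg zero_le_power C)
          (auto simp: n_def wt_ge_1 less_imp_le[OF wt_pos])
      moreover have "norm (K2 j (Zc d l g)) \<le> C' * (1 + norm l) ^ n * wt {..<3 * d} g ^ n"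
        by (rule order_trans[OF C'(2)], intro mult_mono power_increasing mult_nonneg_nonneg zero_le_power C')
          (auto simp: n_def wt_ge_1 less_imp_le[OF wt_pos])
      ultimately show ?thesis by (simp add: algebra_simps)
    qed
    with C(1) C'(1) show ?thesis by (intro exI[of _ "C + C'"] exI[of _ n]) auto
  qed
  then obtain C m where C: "\<And>j. j < d \<Longrightarrow> C j \<ge> 0" and Cb: "\<And>j l g. j < d \<Longrightarrow>
      norm (K1 j (Zc d l g)) + norm (K2 j (Zc d l g)) \<le> C j * (1 + norm l) ^ m j * wt {..<3 * d} g ^ m j"
    by metis
  have R0: "0 \<le> R" using R(1)[of t0] order_trans[OF norm_ge_zero] by force
  have "((\<lambda>t. EZ d (lam t) K) has_vector_derivative (\<integral>g. D t0 g \<partial>?G)) (at t0)"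
  proof (rule has_vector_derivative_integral)
    show "integrable ?G (\<lambda>g. \<Sum>j<d. 2 * R * (C j * (1 + R) ^ m j) * wt {..<3 * d} g ^ Suc (m j))"
      by (intro Bochner_Integration.integrable_sum integrable_mult_right integrable_wt) auto
    show "norm (D t g) \<le> (\<Sum>j<d. 2 * R * (C j * (1 + R) ^ m j) * wt {..<3 * d} g ^ Suc (m j))"
      if t: "\<bar>t - t0\<bar> \<le> 1" for t g
      unfolding D_def
    proof (rule sum_norm_le)
      fix j assume "j \<in> {..<d}"
      then have j: "j < d" by simp
      have "norm (K1 j (Zc d (lam t) g) * (lam' t * zeta d g j) + K2 j (Zc d (lam t) g) * cnj (lam' t * zeta d g j))
         \<le> (norm (lam' t) * norm (zeta d g j)) * (norm (K1 j (Zc d (lam t) g)) + norm (K2 j (Zc d (lam t) g)))"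
        by (rule order_trans[OF norm_triangle_ineq]) (simp add: norm_mult algebra_simps)
      also have "\<dots> \<le> (R * (2 * wt {..<3 * d} g)) * (C j * (1 + R) ^ m j * wt {..<3 * d} g ^ m j)"
      proof (rule mult_mono)
        show "norm (lam' t) * norm (zeta d g j) \<le> R * (2 * wt {..<3 * d} g)"
          by (intro mult_mono R t norm_zeta_le_wt j R0) auto
        have "norm (K1 j (Zc d (lam t) g)) + norm (K2 j (Zc d (lam t) g)) \<le> C j * (1 + norm (lam t)) ^ m j * wt {..<3 * d} g ^ m j"
          by (rule Cb[OF j])
        also have "\<dots> \<le> C j * (1 + R) ^ m j * wt {..<3 * d} g ^ m j"
          by (intro mult_right_mono mult_left_mono power_mono add_left_mono R t C j zero_le_power)
             (auto simp: less_imp_le[OF wt_pos])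
        finally show "norm (K1 j (Zc d (lam t) g)) + norm (K2 j (Zc d (lam t) g)) \<le> C j * (1 + R) ^ m j * wt {..<3 * d} g ^ m j" .
      qed (auto intro!: mult_nonneg_nonneg R0 simp: less_imp_le[OF wt_pos])
      finally show "norm (K1 j (Zc d (lam t) g) * (lam' t * zeta d g j) + K2 j (Zc d (lam t) g) * cnj (lam' t * zeta d g j))
        \<le> 2 * R * (C j * (1 + R) ^ m j) * wt {..<3 * d} g ^ Suc (m j)" by (simp add: ac_simps)
    qed
    show "D t0 \<in> borel_measurable ?G"
      unfolding D_def
    proof (rule borel_measurable_sum)
      fix j assume "j \<in> {..<d}"
      then have j: "j < d" by simp
      have [measurable]: "(\<lambda>g. K1 j (Zc d (lam t0) g)) \<in> borel_measurable ?G"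
         "(\<lambda>g. K2 j (Zc d (lam t0) g)) \<in> borel_measurable ?G" "(\<lambda>g. zeta d g j) \<in> borel_measurable ?G"
        using j by (auto intro: tame_Zc_measurable K1 K2 zeta_measurable)
      have [measurable]: "(\<lambda>g. cnj (lam' t0 * zeta d g j)) \<in> borel_measurable ?G"
        by (rule measurable_compose[OF _ borel_measurable_continuous_onI[of cnj]])
          (auto intro: continuous_intros)
      show "(\<lambda>g. K1 j (Zc d (lam t0) g) * (lam' t0 * zeta d g j) + K2 j (Zc d (lam t0) g) * cnj (lam' t0 * zeta d g j))
        \<in> borel_measurable ?G"
        by measurable
    qed
  qed (auto intro: tame_Zc_integrable K der)
  also have "(\<integral>g. D t0 g \<partial>?G) = of_real (2 * Re (lam' t0 * cnj (lam t0))) * (\<Sum>j<d. EZ d (lam t0) (L j))"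
  proof -
    have i: "integrable ?G (\<lambda>g. zeta d g j * K1 j (Zc d (lam t0) g))"
       "integrable ?G (\<lambda>g. cnj (zeta d g j) * K2 j (Zc d (lam t0) g))" 
       "(\<integral>g. zeta d g j * K1 j (Zc d (lam t0) g) \<partial>?G) = cnj (lam t0) * EZ d (lam t0) (L j)"
       "(\<integral>g. cnj (zeta d g j) * K2 j (Zc d (lam t0) g) \<partial>?G) = lam t0 * EZ d (lam t0) (L j)"
      if j: "j < d" for j
    proof -
      have t1: "tame d (K12 j j)" "tame d (K21 j j)" using L t j by auto
      note a = K1(1)[OF j] K1(2)[OF j] t(1)[OF j] t1(1) j
      note b = K2(1)[OF j] K2(2)[OF j] t1(2) t(2)[OF j] j
      show "integrable ?G (\<lambda>g. zeta d g j * K1 j (Zc d (lam t0) g))" by (rule integrable_zeta_mult(1)[OF a])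
      show "integrable ?G (\<lambda>g. cnj (zeta d g j) * K2 j (Zc d (lam t0) g))" by (rule integrable_zeta_mult(2)[OF b])
      show "(\<integral>g. zeta d g j * K1 j (Zc d (lam t0) g) \<partial>?G) = cnj (lam t0) * EZ d (lam t0) (L j)"
        using Zc_ibp_zeta[OF a, of "lam t0"] L(1)[OF j] by simp
      show "(\<integral>g. cnj (zeta d g j) * K2 j (Zc d (lam t0) g) \<partial>?G) = lam t0 * EZ d (lam t0) (L j)"
        using Zc_ibp_cnj_zeta[OF b, of "lam t0"] L(2)[OF j] by simp
    qed
    have "(\<integral>g. D t0 g \<partial>?G) = (\<integral>g. (\<Sum>j<d. lam' t0 * (zeta d g j * K1 j (Zc d (lam t0) g)) + cnj (lam' t0) * (cnj (zeta d g j) * K2 j (Zc d (lam t0) g))) \<partial>?G)"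
      unfolding D_def by (intro Bochner_Integration.integral_cong sum.cong refl) (simp add: algebra_simps)
    also have "\<dots> = (\<Sum>j<d. lam' t0 * (cnj (lam t0) * EZ d (lam t0) (L j)) + cnj (lam' t0) * (lam t0 * EZ d (lam t0) (L j)))"
      by (subst Bochner_Integration.integral_sum) (auto simp: i intro!: sum.cong)
    also have "\<dots> = (lam' t0 * cnj (lam t0) + cnj (lam' t0) * lam t0) * (\<Sum>j<d. EZ d (lam t0) (L j))"
      by (simp add: sum_distrib_left algebra_simps sum.distrib)
    also have "lam' t0 * cnj (lam t0) + cnj (lam' t0) * lam t0 = of_real (2 * Re (lam' t0 * cnj (lam t0)))"
      by (simp add: complex_eq_iff)
    finally show ?thesis .
  qed
  finally show ?thesis .
qed

section \<open>Log-convexity of the moments of a polynomial\<close>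

lemma pd_unique:
  "((\<lambda>t. M (z(j := t))) has_field_derivative D) (at (z j)) \<Longrightarrow> pd j M z = D"
  unfolding pd_def by (rule DERIV_imp_deriv)

lemma pd_mult:
  assumes "cpoly d M" "cpoly d L"
  shows "pd j (\<lambda>z. M z * L z) z = pd j M z * L z + M z * pd j L z"
proof (rule pd_unique)
  have "((\<lambda>t. M (z(j := t)) * L (z(j := t))) has_field_derivative
     (pd j M (z(j := z j)) * L (z(j := z j)) + pd j L (z(j := z j)) * M (z(j := z j)))) (at (z j))"
    by (rule DERIV_mult[OF cpoly_pd(3)[OF assms(1)] cpoly_pd(3)[OF assms(2)]])
  then show "((\<lambda>t. M (z(j := t)) * L (z(j := t))) has_field_derivative
     (pd j M z * L z + M z * pd j L z)) (at (z j))" by (simp add: mult.commute)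
qed

lemma pd_const: "pd j (\<lambda>_. c) z = 0"
  by (rule pd_unique) simp

text \<open>As 2 r / (1 + r^2) is the derivative of log H for H = 1 + r^2, the functions B and C are
  the first two derivatives of A in log H, and \<open>cs\<close> says that log A is convex in log H.
  So the slope B / A is nondecreasing, and a value above \<kappa> would persist and violate
  \<open>growth\<close>.\<close>

lemma slope_bound_of_growth:
  fixes A B C :: "real \<Rightarrow> real"
  assumes A': "\<And>r. (A has_real_derivative 2 * r / (1 + r\<^sup>2) * B r) (at r)"
    and B': "\<And>r. (B has_real_derivative 2 * r / (1 + r\<^sup>2) * C r) (at r)"
    and pos: "\<And>r. A r > 0"
    and cs: "\<And>r. (B r)\<^sup>2 \<le> A r * C r"
    and growth: "\<And>r. r \<ge> 0 \<Longrightarrow> A r \<le> D * (1 + r\<^sup>2) powr \<kappa>"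
    and r: "r \<ge> 0"
  shows "B r \<le> \<kappa> * A r" and "A r \<le> (1 + r\<^sup>2) powr \<kappa> * A 0"
proof -
  have H: "1 + s\<^sup>2 > 0" for s :: real by (simp add: add_pos_nonneg)
  define f where "f s = B s / A s" for s
  have f': "(f has_real_derivative 2 * s / (1 + s\<^sup>2) * ((A s * C s - (B s)\<^sup>2) / (A s)\<^sup>2)) (at s)" for s
  proof -
    have "(f has_real_derivative ((2 * s / (1 + s\<^sup>2) * C s) * A s - B s * (2 * s / (1 + s\<^sup>2) * B s)) / (A s * A s)) (at s)"
      unfolding f_def using pos[of s] by (intro DERIV_divide A' B') auto
    moreover have "(X * c * a - b * (X * b)) / (a * a) = X * ((a * c - b\<^sup>2) / a\<^sup>2)" for X a b c :: real
      unfolding times_divide_eq_right power2_eq_square by (simp add: algebra_simps)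
    ultimately show ?thesis by (simp only:)
  qed
  have f_mono: "f s \<le> f t" if "0 \<le> s" "s \<le> t" for s t
  proof (rule DERIV_nonneg_imp_nondecreasing[OF that(2)])
    fix x assume x: "s \<le> x" "x \<le> t"
    have "0 \<le> 2 * x / (1 + x\<^sup>2) * ((A x * C x - (B x)\<^sup>2) / (A x)\<^sup>2)"
      using x that H[of x] cs[of x] by (intro mult_nonneg_nonneg divide_nonneg_nonneg) auto
    then show "\<exists>y. (f has_real_derivative y) (at x) \<and> 0 \<le> y" using f' by blast
  qed
  have lnA': "((\<lambda>s. ln (A s) - c * ln (1 + s\<^sup>2)) has_real_derivative 2 * s / (1 + s\<^sup>2) * (f s - c)) (at s)" for c s
  proof -
    have "((\<lambda>s. ln (A s)) has_real_derivative 1 / A s * (2 * s / (1 + s\<^sup>2) * B s)) (at s)"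
      by (rule DERIV_cong[OF DERIV_chain2[OF DERIV_ln[OF pos] A']]) (simp add: inverse_eq_divide)
    moreover have "((\<lambda>s. c * ln (1 + s\<^sup>2)) has_real_derivative c * (2 * s / (1 + s\<^sup>2))) (at s)"
      using H[of s] by (auto intro!: derivative_eq_intros simp: inverse_eq_divide)
    ultimately have "((\<lambda>s. ln (A s) - c * ln (1 + s\<^sup>2)) has_real_derivative
        1 / A s * (2 * s / (1 + s\<^sup>2) * B s) - c * (2 * s / (1 + s\<^sup>2))) (at s)"
      by (rule DERIV_diff)
    moreover have "1 / a * (X * b) - c * X = X * (b / a - c)" for X a b :: real
      by (simp add: algebra_simps)
    ultimately show ?thesis by (simp only: f_def)
  qed
  have slope: "f s \<le> \<kappa>" if s: "s \<ge> 0" for s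
  proof (rule ccontr)
    assume "\<not> f s \<le> \<kappa>"
    \<comment> \<open>A slope of \<kappa> + \<delta> at s makes log A grow beyond s at least like
      (\<kappa> + \<delta>) log H, so \<open>growth\<close> would keep \<delta> log H
      bounded.\<close>
    define \<delta> where "\<delta> = f s - \<kappa>"
    have \<delta>: "\<delta> > 0" using \<open>\<not> f s \<le> \<kappa>\<close> by (simp add: \<delta>_def)
    define g where "g t = ln (A t) - (\<kappa> + \<delta>) * ln (1 + t\<^sup>2)" for t
    have g: "g s \<le> g t" if t: "t \<ge> s" for t
    proof (rule DERIV_nonneg_imp_nondecreasing[OF t])
      fix x assume x: "s \<le> x" "x \<le> t"
      have "0 \<le> 2 * x / (1 + x\<^sup>2) * (f x - (\<kappa> + \<delta>))"
        using x s H[of x] f_mono[OF s x(1)] by (intro mult_nonneg_nonneg divide_nonneg_nonneg) (auto simp: \<delta>_def)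
      then show "\<exists>y. (g has_real_derivative y) (at x) \<and> 0 \<le> y"
        unfolding g_def using lnA' by blast
    qed
    have D: "D > 0" using growth[of 0] pos[of 0] by (simp add: zero_less_mult_iff)
    have bound: "\<delta> * ln (1 + t\<^sup>2) \<le> ln D - g s" if t: "t \<ge> s" for t
    proof -
      have "ln (A t) \<le> ln (D * (1 + t\<^sup>2) powr \<kappa>)"
        using growth[of t] pos[of t] t s by simp
      also have "\<dots> = ln D + \<kappa> * ln (1 + t\<^sup>2)"
        using D H[of t] by (simp add: ln_mult ln_powr)
      finally show ?thesis using g[OF t] by (simp add: g_def algebra_simps)
    qed
    \<comment> \<open>X is the value of log H at the point t to be chosen: the first entry violates
      \<open>bound\<close>, the second ensures t \<ge> s.\<close>
    define X where "X = max ((ln D - g s) / \<delta> + 1) (ln (1 + s\<^sup>2))"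
    define t where "t = sqrt (exp X - 1)"
    have "X \<ge> 0" unfolding X_def by (simp add: le_max_iff_disj)
    then have t2: "t\<^sup>2 = exp X - 1" unfolding t_def by simp
    have "exp (ln (1 + s\<^sup>2)) \<le> exp X" unfolding X_def by simp
    then have "1 + s\<^sup>2 \<le> exp X" using H[of s] by simp
    then have "t \<ge> s" unfolding t_def by (intro real_le_rsqrt) simp
    from bound[OF this] have "\<delta> * X \<le> ln D - g s" unfolding t2 by simp
    moreover have "\<delta> * X \<ge> \<delta> * ((ln D - g s) / \<delta> + 1)" unfolding X_def using \<delta> by (intro mult_left_mono) auto
    moreover have "\<delta> * ((ln D - g s) / \<delta> + 1) = ln D - g s + \<delta>" using \<delta> by (simp add: distrib_left)
    ultimately show False using \<delta> by linarith
  qed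
  show "B r \<le> \<kappa> * A r" using slope[OF r] pos[of r] by (simp add: f_def divide_le_eq)
  have "ln (A r) - \<kappa> * ln (1 + r\<^sup>2) \<le> ln (A 0) - \<kappa> * ln (1 + 0\<^sup>2)"
  proof (rule DERIV_nonpos_imp_nonincreasing[OF r])
    fix x assume x: "0 \<le> x" "x \<le> r"
    have "2 * x / (1 + x\<^sup>2) * (f x - \<kappa>) \<le> 0"
      using x slope[OF x(1)] H[of x] by (intro mult_nonneg_nonpos divide_nonneg_nonneg) auto
    then show "\<exists>y. ((\<lambda>r. ln (A r) - \<kappa> * ln (1 + r\<^sup>2)) has_real_derivative y) (at x) \<and> y \<le> 0" using lnA' by blast
  qed
  then have "ln (A r) \<le> ln ((1 + r\<^sup>2) powr \<kappa> * A 0)"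
    using pos[of 0] H[of r] by (simp add: ln_mult ln_powr)
  then show "A r \<le> (1 + r\<^sup>2) powr \<kappa> * A 0"
    using pos[of r] pos[of 0] H[of r] by (subst (asm) ln_le_cancel_iff) auto
qed

text \<open>Let N act on the kernel (w wb + \<epsilon>)^a as xi times the first minus eta times the
  second derivative in w, and let its conjugate act likewise in wb. With v = 1 / (w wb +
  \<epsilon>), the left-hand side is the product of s minus N and s minus its conjugate, applied to
  the kernel and divided by it. In the application wb, xb, eb are the conjugates of w, xi, eta,
  which makes the right-hand side a combination of squared moduli; as independent letters they leave
  a polynomial identity.\<close>

lemma jet_form_identity:
  fixes s a v w wb xi xb eta eb :: complex
  shows "s * s - s * (a * v * wb * xi - a * (a - 1) * v^2 * wb^2 * eta)
     - s * (a * v * w * xb - a * (a - 1) * v^2 * w^2 * eb)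
     + (a * xi * (((a - 1) * v^2 * w * wb + v) * xb - ((a - 1) * (a - 2) * v^3 * w^2 * wb + 2 * (a - 1) * v^2 * w) * eb)
      - a * (a - 1) * eta * (((a - 2) * v^3 * w * wb^2 + 2 * v^2 * wb) * xb
          - ((a - 2) * (a - 3) * v^4 * w^2 * wb^2 + 4 * (a - 2) * v^3 * w * wb + 2 * v^2) * eb))
   = (s - a * xi * wb * v + a * (a - 1) * eta * wb^2 * v^2) * (s - a * xb * w * v + a * (a - 1) * eb * w^2 * v^2)
     + a * (v * (1 - w * wb * v)) * ((- xi + 2 * (a - 1) * eta * wb * v) * (- xb + 2 * (a - 1) * eb * w * v))
     + 2 * a * (a - 1) * (v * (1 - w * wb * v))^2 * (eta * eb)"
  by algebra

section \<open>The kernel of the moments, its derivatives and the heat equation for it\<close>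

locale log_convexity =
  fixes d :: nat and P :: "(nat \<Rightarrow> complex) \<Rightarrow> complex" and e :: real
  assumes P: "cpoly d P" and e: "e > 0"
begin

definition q :: "(nat \<Rightarrow> complex) \<Rightarrow> real" where "q z = (cmod (P z))\<^sup>2 + e"
definition Q :: "real \<Rightarrow> (nat \<Rightarrow> complex) \<Rightarrow> complex" where "Q b z = of_real (q z powr b)"
text \<open>With M holomorphic this family contains F (b = a, k = 0, M = 1) and both terms of N F,
  and its span is closed under differentiation in cnj P: either b drops by one and M gains a factor
  P, or k drops by one.\<close>

definition T :: "real \<Rightarrow> nat \<Rightarrow> ((nat \<Rightarrow> complex) \<Rightarrow> complex) \<Rightarrow> (nat \<Rightarrow> complex) \<Rightarrow> complex" where
  "T b k M z = Q b z * cnj (P z) ^ k * M z"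
text \<open>\<open>T1 j\<close>, \<open>T2 j\<close> and \<open>T12 j\<close> are the derivatives of \<open>T\<close> with respect to \<open>z\<^sub>j\<close>, to \<open>cnj z\<^sub>j\<close> and
  to both; \<open>S\<close> and \<open>S'\<close> are the first and second derivatives of \<open>T\<close> with respect to \<open>cnj P\<close>; and \<open>Nb\<close> is
  the operator \<open>N\<^sup>*\<close> applied to \<open>T\<close>.\<close>

definition T1 where
  "T1 b k M j z = of_real b * T (b - 1) (Suc k) (\<lambda>z. pd j P z * M z) z + T b k (pd j M) z"
definition S where
  "S b k M z = of_real b * T (b - 1) k (\<lambda>z. P z * M z) z + of_nat k * T b (k - 1) M z"
definition T2 where
  "T2 b k M j z = S b k M z * cnj (pd j P z)"
definition T12 where
  "T12 b k M j z = (of_real b * S (b - 1) (Suc k) (\<lambda>z. pd j P z * M z) z + S b k (pd j M) z) * cnj (pd j P z)"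
definition S' where
  "S' b k M z = of_real b * S (b - 1) k (\<lambda>z. P z * M z) z + of_nat k * S b (k - 1) M z"
definition xi where "xi z = (\<Sum>j<d. z j * pd j P z - pd j (pd j P) z)"
definition eta where "eta z = (\<Sum>j<d. (pd j P z)\<^sup>2)"
definition Nb where "Nb b k M z = S b k M z * cnj (xi z) - S' b k M z * cnj (eta z)"

lemma q_pos: "q z > 0"
  unfolding q_def using e by (simp add: add_nonneg_pos)

lemma Q_minus_1: "Q (b - 1) z = Q b z / of_real (q z)"
  unfolding Q_def using q_pos[of z] by (simp add: powr_diff)

lemma cpoly_pds [intro]: "cpoly d M \<Longrightarrow> cpoly d (pd j M)"
  by (rule cpoly_pd)

lemma tame_cpoly_intro [intro]: "cpoly d M \<Longrightarrow> tame d M"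
  by (rule cpoly_tame)

lemma tame_Q [intro!]: "tame d (Q b)"
  unfolding Q_def q_def using P e by (intro tame_powr tame_cpoly_intro)

lemma tame_T [intro!]: "tame d M \<Longrightarrow> tame d (T b k M)"
  unfolding T_def by (intro tame_mult tame_power tame_cnj tame_cpoly_intro[OF P] tame_Q)

lemma tame_S [intro!]: "tame d M \<Longrightarrow> tame d (S b k M)"
  unfolding S_def by (intro tame_add tame_mult tame_const tame_T tame_cpoly_intro[OF P])

lemma tame_T1 [intro!]: "cpoly d M \<Longrightarrow> tame d (T1 b k M j)"
  unfolding T1_def using P by (intro tame_add tame_mult tame_const tame_T tame_cpoly_intro cpoly_pds)

lemma tame_T2 [intro!]: "tame d M \<Longrightarrow> tame d (T2 b k M j)"
  unfolding T2_def by (intro tame_mult tame_cnj tame_S tame_cpoly_intro[OF cpoly_pds[OF P]])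

lemma wirtinger_Q: "wirtinger d (Q b) (\<lambda>j z. of_real b * Q (b - 1) z * (cnj (P z) * pd j P z)) (\<lambda>j z. of_real b * Q (b - 1) z * (P z * cnj (pd j P z)))"
proof -
  have "Q b = (\<lambda>z. of_real (((cmod (P z))\<^sup>2 + e) powr b))" unfolding Q_def q_def by auto
  then show ?thesis
    using wirtinger_powr[OF cpoly_pd(2)[OF P] e, of b] unfolding Q_def q_def by simp
qed

lemma wirtinger_T: assumes M: "cpoly d M" shows "wirtinger d (T b k M) (T1 b k M) (T2 b k M)"
proof -
  have "wirtinger d (\<lambda>z. (Q b z * cnj (P z) ^ k) * M z)
     (\<lambda>j z. (of_real b * Q (b - 1) z * (cnj (P z) * pd j P z) * cnj (P z) ^ k + Q b z * (of_nat k * cnj (P z) ^ (k - 1) * 0)) * M z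
          + (Q b z * cnj (P z) ^ k) * pd j M z)
     (\<lambda>j z. (of_real b * Q (b - 1) z * (P z * cnj (pd j P z)) * cnj (P z) ^ k + Q b z * (of_nat k * cnj (P z) ^ (k - 1) * cnj (pd j P z))) * M z
          + (Q b z * cnj (P z) ^ k) * 0)"
    using wirtinger_mult[OF wirtinger_mult[OF wirtinger_Q wirtinger_power[OF wirtinger_cnj[OF cpoly_pd(2)[OF P]]]] cpoly_pd(2)[OF M], of b k] by simp
  then show ?thesis
    by (rule wirtinger_cong) (auto simp: T_def T1_def T2_def S_def algebra_simps)
qed

lemma cpoly_mult_P [intro]: "cpoly d M \<Longrightarrow> cpoly d (\<lambda>z. P z * M z)"
  using P by (rule cpoly.mult)

lemma wirtinger_S: assumes M: "cpoly d M"
  shows "wirtinger d (S b k M)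
    (\<lambda>j z. of_real b * T1 (b - 1) k (\<lambda>z. P z * M z) j z + of_nat k * T1 b (k - 1) M j z)
    (\<lambda>j z. S' b k M z * cnj (pd j P z))"
  by (rule wirtinger_cong[OF wirtinger_add[OF wirtinger_cmult[OF wirtinger_T[OF cpoly_mult_P[OF M]]] wirtinger_cmult[OF wirtinger_T[OF M]]]],
      rule S_def[symmetric], rule refl) (simp add: T2_def S'_def algebra_simps)

lemma wirtinger_T2: assumes M: "cpoly d M"
  shows "wirtinger d (T2 b k M i)
    (\<lambda>j z. (of_real b * T1 (b - 1) k (\<lambda>z. P z * M z) j z + of_nat k * T1 b (k - 1) M j z) * cnj (pd i P z))
    (\<lambda>j z. S' b k M z * cnj (pd j P z) * cnj (pd i P z) + S b k M z * cnj (pd j (pd i P) z))"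
  by (rule wirtinger_cong[OF wirtinger_mult[OF wirtinger_S[OF M] wirtinger_cnj[OF cpoly_pd(2)[OF cpoly_pds[OF P]]]]],
      rule T2_def[symmetric]) simp_all

lemma wirtinger_T1: assumes M: "cpoly d M"
  shows "wirtinger d (T1 b k M i)
    (\<lambda>j z. of_real b * T1 (b - 1) (Suc k) (\<lambda>z. pd i P z * M z) j z + T1 b k (pd i M) j z)
    (\<lambda>j z. of_real b * T2 (b - 1) (Suc k) (\<lambda>z. pd i P z * M z) j z + T2 b k (pd i M) j z)"
  by (rule wirtinger_cong[OF wirtinger_add[OF wirtinger_cmult[OF wirtinger_T[OF cpoly.mult[OF cpoly_pds[OF P] M]]] wirtinger_T[OF cpoly_pds[OF M]]]],
      rule T1_def[symmetric]) simp_all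

lemma mixed_eq1: "of_real b * T2 (b - 1) (Suc k) (\<lambda>z. pd j P z * M z) j z + T2 b k (pd j M) j z = T12 b k M j z"
  unfolding T2_def T12_def by (simp add: algebra_simps)

text \<open>Commutation of mixed derivatives: differentiating first in cnj z_j and then in z_j
  reproduces the \<open>T12\<close> that \<open>mixed_eq1\<close> reaches in the other order. The
  truncated difference k - 1 at k = 0 always carries the factor \<open>of_nat k\<close>, and the
  case split makes this visible.\<close>

lemma mixed_eq2: assumes M: "cpoly d M"
  shows "(of_real b * T1 (b - 1) k (\<lambda>z. P z * M z) j z + of_nat k * T1 b (k - 1) M j z) * cnj (pd j P z) = T12 b k M j z"
proof (cases k)
  case 0
  then show ?thesis unfolding T12_def T1_def S_def T_def pd_mult[OF P M]
    by (simp add: algebra_simps)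
next
  case (Suc k')
  then show ?thesis unfolding T12_def T1_def S_def T_def pd_mult[OF P M]
    by (simp add: algebra_simps)
qed

lemma tame_T12 [intro!]: "cpoly d M \<Longrightarrow> tame d (T12 b k M j)"
  unfolding T12_def using P by (intro tame_mult tame_add tame_cnj tame_S tame_const tame_cpoly_intro cpoly_pds)

lemma tame_S' [intro!]: "tame d M \<Longrightarrow> tame d (S' b k M)"
  unfolding S'_def by (intro tame_add tame_mult tame_const tame_S tame_cpoly_intro[OF P])

lemma heat_T:
  assumes M: "cpoly d M" and lam: "\<And>t. (lam has_vector_derivative lam' t) (at t)"
    and R: "\<And>t. \<bar>t - t0\<bar> \<le> 1 \<Longrightarrow> norm (lam t) \<le> R" "\<And>t. \<bar>t - t0\<bar> \<le> 1 \<Longrightarrow> norm (lam' t) \<le> R"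
  shows "((\<lambda>t. EZ d (lam t) (T b k M)) has_vector_derivative
      of_real (2 * Re (lam' t0 * cnj (lam t0))) * (\<Sum>j<d. EZ d (lam t0) (T12 b k M j))) (at t0)"
proof (rule heat[OF wirtinger_T[OF M] _ wirtinger_T1[OF M] _ wirtinger_T2[OF M] _ _ _ _ _ _ lam R])
  show "(\<lambda>z. of_real b * T2 (b - 1) (Suc k) (\<lambda>z. pd j P z * M z) j z + T2 b k (pd j M) j z) = T12 b k M j" for j
    by (rule ext) (rule mixed_eq1)
  show "(\<lambda>z. (of_real b * T1 (b - 1) k (\<lambda>z. P z * M z) j z + of_nat k * T1 b (k - 1) M j z) * cnj (pd j P z)) = T12 b k M j" for j
    by (rule ext) (rule mixed_eq2[OF M])
  show "tame d (\<lambda>z. of_real b * T1 (b - 1) (Suc k) (\<lambda>z. pd j P z * M z) j z + T1 b k (pd j M) j z)" for j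
    using P M by (intro tame_add tame_mult tame_const tame_T1 cpoly_pds cpoly.mult)
  show "tame d (\<lambda>z. S' b k M z * cnj (pd j P z) * cnj (pd j P z) + S b k M z * cnj (pd j (pd j P) z))" for j
    using P M by (intro tame_add tame_mult tame_const tame_S tame_S' tame_cnj tame_cpoly_intro cpoly_pds)
qed (use M in auto)

text \<open>\<open>Zc_ibp_cnj_z\<close>, applied to the derivative \<open>T2\<close> of T in cnj
  z_j, trades multiplication by cnj z_j for H times the mixed derivative plus the second derivative
  in cnj z_j. Dividing by H turns the heat equation in |\<lambda>|^2 into one in log H with
  generator \<open>Nb\<close>.\<close>

lemma Nb_eq:
  assumes M: "cpoly d M"
  shows "(1 + (norm l)\<^sup>2) * (\<Sum>j<d. EZ d l (T12 b k M j)) = EZ d l (Nb b k M)"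
proof -
  define K22 where "K22 j z = S' b k M z * cnj (pd j P z) * cnj (pd j P z) + S b k M z * cnj (pd j (pd j P) z)" for j z
  have t22: "tame d (K22 j)" for j
    unfolding K22_def using P M by (intro tame_add tame_mult tame_const tame_S tame_S' tame_cnj tame_cpoly_intro cpoly_pds)
  have ib: "(1 + (norm l)\<^sup>2) * EZ d l (T12 b k M j) = EZ d l (\<lambda>z. cnj (z j) * T2 b k M j z) - EZ d l (K22 j)"
    if j: "j < d" for j
  proof -
    have "EZ d l (\<lambda>z. cnj (z j) * T2 b k M j z) = EZ d l (K22 j) + (1 + (norm l)\<^sup>2) *
       EZ d l (\<lambda>z. (of_real b * T1 (b - 1) k (\<lambda>z. P z * M z) j z + of_nat k * T1 b (k - 1) M j z) * cnj (pd j P z))"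
      unfolding K22_def using P M j
      by (intro Zc_ibp_cnj_z[OF wirtinger_T2[OF M]] tame_add tame_mult tame_const tame_S tame_S' tame_cnj tame_cpoly_intro cpoly_pds
          tame_T1 tame_T2 cpoly_mult_P) auto
    then show ?thesis unfolding mixed_eq2[OF M] by simp
  qed
  have "(1 + (norm l)\<^sup>2) * (\<Sum>j<d. EZ d l (T12 b k M j)) = (\<Sum>j<d. EZ d l (\<lambda>z. cnj (z j) * T2 b k M j z - K22 j z))"
    unfolding sum_distrib_left
  proof (intro sum.cong refl)
    fix j assume "j \<in> {..<d}"
    then have j: "j < d" by simp
    have "tame d (\<lambda>z. cnj (z j) * T2 b k M j z)" using j M by (intro tame_mult tame_cnj tame_coord tame_T2 tame_cpoly_intro)
    then show "(1 + (norm l)\<^sup>2) * EZ d l (T12 b k M j) = EZ d l (\<lambda>z. cnj (z j) * T2 b k M j z - K22 j z)"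
      unfolding ib[OF j] by (subst Bochner_Integration.integral_diff) (auto intro: tame_Zc_integrable[where K = "\<lambda>z. cnj (z j) * T2 b k M j z"] tame_Zc_integrable[OF t22])
  qed
  also have "\<dots> = EZ d l (\<lambda>z. \<Sum>j<d. cnj (z j) * T2 b k M j z - K22 j z)"
  proof (rule Bochner_Integration.integral_sum[symmetric])
    fix j assume "j \<in> {..<d}"
    then have "tame d (\<lambda>z. cnj (z j) * T2 b k M j z - K22 j z)"
      by (intro tame_diff tame_mult tame_cnj tame_coord tame_T2 t22 tame_cpoly_intro[OF M]) auto
    then show "integrable (gauss {..<3 * d}) (\<lambda>g. cnj (Zc d l g j) * T2 b k M j (Zc d l g) - K22 j (Zc d l g))"
      by (rule tame_Zc_integrable)
  qed
  also have "(\<lambda>z. \<Sum>j<d. cnj (z j) * T2 b k M j z - K22 j z) = Nb b k M"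
    by (rule ext) (simp add: Nb_def T2_def K22_def xi_def eta_def sum_distrib_left sum_subtractf sum.distrib
        algebra_simps power2_eq_square)
  finally show ?thesis by simp
qed

end

lemma cpoly_sum: "finite I \<Longrightarrow> (\<And>i. i \<in> I \<Longrightarrow> cpoly d (M i)) \<Longrightarrow> cpoly d (\<lambda>z. \<Sum>i\<in>I. M i z)"
  by (induction I rule: finite_induct) (auto intro: cpoly.intros)

lemma cpoly_prod: "finite I \<Longrightarrow> (\<And>i. i \<in> I \<Longrightarrow> cpoly d (M i)) \<Longrightarrow> cpoly d (\<lambda>z. \<Prod>i\<in>I. M i z)"
  by (induction I rule: finite_induct) (auto intro: cpoly.intros)

lemma cpoly_power: "cpoly d M \<Longrightarrow> cpoly d (\<lambda>z. M z ^ n)"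
  by (induction n) (auto intro: cpoly.intros)

lemma cpoly_diff: "cpoly d M \<Longrightarrow> cpoly d L \<Longrightarrow> cpoly d (\<lambda>z. M z - L z)"
  using cpoly.add[of d M "\<lambda>z. (-1) * L z"] cpoly.mult[OF cpoly.const[of d "-1"], of L] by simp

section \<open>Positivity of the two-jet and convexity of log A in log H\<close>

context log_convexity
begin

lemma cpoly_xi: "cpoly d xi"
  unfolding xi_def[abs_def] using P
  by (intro cpoly_sum cpoly_diff cpoly.mult cpoly.coord cpoly_pds) auto

lemma cpoly_eta: "cpoly d eta"
  unfolding eta_def[abs_def] using P by (intro cpoly_sum cpoly_power cpoly_pds) auto

lemma tame_Nb: "cpoly d M \<Longrightarrow> tame d (Nb b k M)"
  unfolding Nb_def[abs_def]
  by (intro tame_diff tame_mult tame_S tame_S' tame_cnj tame_cpoly_intro cpoly_xi cpoly_eta)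

lemma heat_Nb:
  assumes M: "cpoly d M"
  shows "((\<lambda>t. EZ d (of_real t) (T b k M)) has_vector_derivative
      of_real (2 * r / (1 + r\<^sup>2)) * EZ d (of_real r) (Nb b k M)) (at r)"
proof -
  have "((\<lambda>t. EZ d (of_real t) (T b k M)) has_vector_derivative
      of_real (2 * Re (1 * cnj (of_real r))) * (\<Sum>j<d. EZ d (of_real r) (T12 b k M j))) (at r)"
  proof (rule heat_T[OF M, where R = "\<bar>r\<bar> + 1" and lam' = "\<lambda>_. 1"])
    show "(complex_of_real has_vector_derivative 1) (at t)" for t
      using has_vector_derivative_of_real[OF DERIV_ident] by simp
  qed auto
  also have "(\<Sum>j<d. EZ d (of_real r) (T12 b k M j)) = EZ d (of_real r) (Nb b k M) / of_real (1 + r\<^sup>2)"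
  proof -
    have "complex_of_real (1 + r\<^sup>2) \<noteq> 0" by (metis of_real_eq_0_iff add_pos_nonneg less_irrefl zero_less_one zero_le_power2)
    then show ?thesis using Nb_eq[OF M, of "of_real r" b k] by (simp add: eq_divide_eq mult.commute)
  qed
  finally show ?thesis by simp
qed

lemma S_0: "S b 0 M z = of_real b * T (b - 1) 0 (\<lambda>z. P z * M z) z"
  by (simp add: S_def)

context
  fixes a :: real
  assumes a: "a \<ge> 1"
begin

text \<open>This is N F: the first derivative of the kernel in the value of P times
  \<open>xi\<close>, minus the second one times \<open>eta\<close>. As \<open>xi\<close> and
  \<open>eta\<close> are holomorphic, the conjugate operator treats them as constants, so
  \<open>NG\<close> is again a combination of values of \<open>Nb\<close>.\<close>

definition G where "G z = of_real a * T (a - 1) 1 xi z - of_real (a * (a - 1)) * T (a - 2) 2 eta z"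
definition NG where "NG z = of_real a * Nb (a - 1) 1 xi z - of_real (a * (a - 1)) * Nb (a - 2) 2 eta z"

lemma cnj_G: "Nb a 0 (\<lambda>_. 1) z = cnj (G z)"
  unfolding Nb_def G_def S'_def S_0 T_def by (simp add: Q_def algebra_simps power2_eq_square)

lemma T_1: "T a 0 (\<lambda>_. 1) z = of_real (q z powr a)"
  unfolding T_def Q_def by simp

text \<open>Since v (1 - w wb v) = e / q^2, the squares in \<open>jet_form_identity\<close> have
  weights 1, a e / q^2 and 2 a (a - 1) (e / q^2)^2. The last weight is where a \<ge> 1
  enters.\<close>

lemma form_nonneg: "0 \<le> Re (of_real (s * s) * T a 0 (\<lambda>_. 1) z - of_real s * G z - of_real s * cnj (G z) + NG z)"
proof -
  define v where "v = inverse (complex_of_real (q z))"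
  let ?w = "P z" and ?wb = "cnj (P z)" and ?x = "xi z" and ?xb = "cnj (xi z)" and ?y = "eta z" and ?yb = "cnj (eta z)"
  let ?a = "complex_of_real a"
  have Q1: "Q (a - 1) z = Q a z * v" "Q (a - 2) z = Q a z * v ^ 2" "Q (a - 3) z = Q a z * v ^ 3" "Q (a - 4) z = Q a z * v ^ 4"
    using Q_minus_1[of a z] Q_minus_1[of "a - 1" z] Q_minus_1[of "a - 2" z] Q_minus_1[of "a - 3" z]
    by (simp_all add: v_def divide_inverse power2_eq_square power3_eq_cube power4_eq_xxxx mult.assoc)
  have num: "a - 1 - 1 = a - 2" "a - 2 - 1 = a - 3" "a - 3 - 1 = a - 4" "a - 1 - 1 - 1 = a - 3" "a - 2 - 1 - 1 = a - 4" by simp_all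
  have "of_real (s * s) * T a 0 (\<lambda>_. 1) z - of_real s * G z - of_real s * cnj (G z) + NG z
    = Q a z * (of_real s * of_real s - of_real s * (?a * v * ?wb * ?x - ?a * (?a - 1) * v^2 * ?wb^2 * ?y)
     - of_real s * (?a * v * ?w * ?xb - ?a * (?a - 1) * v^2 * ?w^2 * ?yb)
     + (?a * ?x * (((?a - 1) * v^2 * ?w * ?wb + v) * ?xb - ((?a - 1) * (?a - 2) * v^3 * ?w^2 * ?wb + 2 * (?a - 1) * v^2 * ?w) * ?yb)
      - ?a * (?a - 1) * ?y * (((?a - 2) * v^3 * ?w * ?wb^2 + 2 * v^2 * ?wb) * ?xb
          - ((?a - 2) * (?a - 3) * v^4 * ?w^2 * ?wb^2 + 4 * (?a - 2) * v^3 * ?w * ?wb + 2 * v^2) * ?yb)))"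
  proof -
    have v: "cnj v = v" unfolding v_def by simp
    have Qc: "cnj (Q a z) = Q a z" unfolding Q_def by simp
    show ?thesis
      unfolding G_def NG_def Nb_def S'_def S_def T_def num Q1
      by (simp add: v Qc num Q1 numeral_2_eq_2[symmetric]) algebra
  qed
  also have "\<dots> = Q a z * ((of_real s - ?a * ?x * ?wb * v + ?a * (?a - 1) * ?y * ?wb^2 * v^2) * (of_real s - ?a * ?xb * ?w * v + ?a * (?a - 1) * ?yb * ?w^2 * v^2)
     + ?a * (v * (1 - ?w * ?wb * v)) * ((- ?x + 2 * (?a - 1) * ?y * ?wb * v) * (- ?xb + 2 * (?a - 1) * ?yb * ?w * v))
     + 2 * ?a * (?a - 1) * (v * (1 - ?w * ?wb * v))^2 * (?y * ?yb))"
    by (subst jet_form_identity) (rule refl)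
  also have "\<dots> = of_real (q z powr a * ((cmod (of_real s - ?a * ?x * ?wb * v + ?a * (?a - 1) * ?y * ?wb^2 * v^2))\<^sup>2
     + a * (e / (q z)\<^sup>2) * (cmod (- ?x + 2 * (?a - 1) * ?y * ?wb * v))\<^sup>2
     + 2 * a * (a - 1) * (e / (q z)\<^sup>2)\<^sup>2 * (cmod ?y)\<^sup>2))"
  proof -
    have "?w * ?wb = of_real (q z - e)"
      unfolding q_def by (simp add: complex_norm_square[symmetric])
    then have "v * (1 - ?w * ?wb * v) = of_real (e / (q z)\<^sup>2)"
      using q_pos[of z] unfolding v_def by (simp add: field_simps power2_eq_square)
    moreover have "cnj v = v" unfolding v_def by simp
    ultimately show ?thesis
      unfolding of_real_mult of_real_add complex_norm_square Q_def by simp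
  qed
  finally show ?thesis using a e by simp
qed

definition Ar where "Ar r = Re (EZ d (complex_of_real r) (T a 0 (\<lambda>_. 1)))"
definition Br where "Br r = Re (EZ d (complex_of_real r) G)"
definition Cr where "Cr r = Re (EZ d (complex_of_real r) NG)"

lemma EZ_cnj_G: "EZ d l (Nb a 0 (\<lambda>_. 1)) = cnj (EZ d l G)"
  unfolding cnj_G by (rule Bochner_Integration.integral_cnj)

lemma Ar_deriv: "(Ar has_real_derivative 2 * r / (1 + r\<^sup>2) * Br r) (at r)"
proof -
  have "(Ar has_vector_derivative Re (of_real (2 * r / (1 + r\<^sup>2)) * EZ d (of_real r) (Nb a 0 (\<lambda>_. 1)))) (at r)"
    unfolding Ar_def by (intro bounded_linear.has_vector_derivative[OF bounded_linear_Re] heat_Nb cpoly.const)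
  then show ?thesis unfolding EZ_cnj_G by (simp add: Br_def has_real_derivative_iff_has_vector_derivative)
qed

lemma tame_G: "tame d G"
  unfolding G_def[abs_def] by (intro tame_diff tame_mult tame_const tame_T tame_cpoly_intro cpoly_xi cpoly_eta)

lemma tame_NG: "tame d NG"
  unfolding NG_def[abs_def] by (intro tame_diff tame_mult tame_const tame_Nb cpoly_xi cpoly_eta)

lemma EZ_G: "EZ d l G = of_real a * EZ d l (T (a - 1) 1 xi) - of_real (a * (a - 1)) * EZ d l (T (a - 2) 2 eta)"
proof -
  have "tame d (T (a - 1) 1 xi)" "tame d (T (a - 2) 2 eta)"
    by (intro tame_T tame_cpoly_intro cpoly_xi cpoly_eta)+
  from this[THEN tame_Zc_integrable[where l = l]] show ?thesis
    unfolding G_def by (subst Bochner_Integration.integral_diff) simp_all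
qed

lemma EZ_NG: "EZ d l NG = of_real a * EZ d l (Nb (a - 1) 1 xi) - of_real (a * (a - 1)) * EZ d l (Nb (a - 2) 2 eta)"
proof -
  have "tame d (Nb (a - 1) 1 xi)" "tame d (Nb (a - 2) 2 eta)"
    by (intro tame_Nb cpoly_xi cpoly_eta)+
  from this[THEN tame_Zc_integrable[where l = l]] show ?thesis
    unfolding NG_def by (subst Bochner_Integration.integral_diff) simp_all
qed

lemma Br_deriv: "(Br has_real_derivative 2 * r / (1 + r\<^sup>2) * Cr r) (at r)"
proof -
  let ?c = "complex_of_real (2 * r / (1 + r\<^sup>2))"
  have "(Br has_vector_derivative Re (of_real a * (?c * EZ d (of_real r) (Nb (a - 1) 1 xi))
      - of_real (a * (a - 1)) * (?c * EZ d (of_real r) (Nb (a - 2) 2 eta)))) (at r)"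
    unfolding Br_def EZ_G
    by (intro bounded_linear.has_vector_derivative[OF bounded_linear_Re] has_vector_derivative_diff
        has_vector_derivative_mult_right heat_Nb cpoly_xi cpoly_eta)
  also have "of_real a * (?c * EZ d (of_real r) (Nb (a - 1) 1 xi))
      - of_real (a * (a - 1)) * (?c * EZ d (of_real r) (Nb (a - 2) 2 eta)) = ?c * EZ d (of_real r) NG"
    unfolding EZ_NG by (simp only: algebra_simps)
  also have "Re (?c * EZ d (of_real r) NG) = 2 * r / (1 + r\<^sup>2) * Cr r"
    unfolding Cr_def by simp
  finally show ?thesis by (simp add: has_real_derivative_iff_has_vector_derivative)
qed

lemma Ar_eq: "EZ d l (T a 0 (\<lambda>_. 1)) = of_real (\<integral>g. q (Zc d l g) powr a \<partial>gauss {..<3 * d})"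
  unfolding T_1 by (rule integral_complex_of_real)

lemma q_powr_integrable: "integrable (gauss {..<3 * d}) (\<lambda>g. q (Zc d l g) powr a)"
proof -
  have "integrable (gauss {..<3 * d}) (\<lambda>g. T a 0 (\<lambda>_. 1) (Zc d l g))"
    by (intro tame_Zc_integrable tame_T tame_const)
  then show ?thesis unfolding T_1 by (simp add: complex_of_real_integrable_eq)
qed

lemma Ar_pos: "Ar r > 0"
proof -
  interpret prob_space "gauss {..<3 * d}" by (rule prob_space_gauss)
  have "(\<integral>g. e powr a \<partial>gauss {..<3 * d}) \<le> (\<integral>g. q (Zc d (of_real r) g) powr a \<partial>gauss {..<3 * d})"
    using a e by (intro integral_mono q_powr_integrable powr_mono2) (auto simp: q_def)
  then have "e powr a \<le> (\<integral>g. q (Zc d (of_real r) g) powr a \<partial>gauss {..<3 * d})"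
    by (simp add: prob_space)
  moreover have "0 < e powr a" using e by simp
  ultimately have "0 < (\<integral>g. q (Zc d (of_real r) g) powr a \<partial>gauss {..<3 * d})" by linarith
  then show ?thesis unfolding Ar_def Ar_eq by simp
qed

text \<open>The integral of \<open>form_nonneg\<close> is a quadratic polynomial in the real
  constant s that never becomes negative; its value at the minimiser s = B / A is the discriminant
  inequality.\<close>

lemma cauchy_schwarz: "(Br r)\<^sup>2 \<le> Ar r * Cr r"
proof -
  have *: "0 \<le> s * s * Ar r - 2 * s * Br r + Cr r" for s
  proof -
    let ?Z = "Zc d (of_real r)"
    have i: "integrable (gauss {..<3 * d}) (\<lambda>g. T a 0 (\<lambda>_. 1) (?Z g))"
      "integrable (gauss {..<3 * d}) (\<lambda>g. G (?Z g))" "integrable (gauss {..<3 * d}) (\<lambda>g. cnj (G (?Z g)))"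
      "integrable (gauss {..<3 * d}) (\<lambda>g. NG (?Z g))"
      using tame_Zc_integrable[OF tame_cnj[OF tame_G]]
      by (auto intro!: tame_Zc_integrable tame_G tame_NG tame_T tame_const)
    have j: "integrable (gauss {..<3 * d}) (\<lambda>g. of_real (s * s) * T a 0 (\<lambda>_. 1) (?Z g) - of_real s * G (?Z g) - of_real s * cnj (G (?Z g)) + NG (?Z g))"
      by (intro Bochner_Integration.integrable_add Bochner_Integration.integrable_diff integrable_mult_right i)
    have "0 \<le> (\<integral>g. Re (of_real (s * s) * T a 0 (\<lambda>_. 1) (?Z g) - of_real s * G (?Z g) - of_real s * cnj (G (?Z g)) + NG (?Z g)) \<partial>gauss {..<3 * d})"
      by (intro Bochner_Integration.integral_nonneg form_nonneg)
    also have "\<dots> = Re (\<integral>g. of_real (s * s) * T a 0 (\<lambda>_. 1) (?Z g) - of_real s * G (?Z g) - of_real s * cnj (G (?Z g)) + NG (?Z g) \<partial>gauss {..<3 * d})"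
      by (rule integral_Re[OF j])
    also have "\<dots> = Re (of_real (s * s) * EZ d (of_real r) (T a 0 (\<lambda>_. 1)) - of_real s * EZ d (of_real r) G - of_real s * cnj (EZ d (of_real r) G) + EZ d (of_real r) NG)"
      by (simp only: i Bochner_Integration.integral_add Bochner_Integration.integral_diff Bochner_Integration.integrable_diff
          Bochner_Integration.integrable_add integrable_mult_right integral_mult_right_zero Bochner_Integration.integral_cnj)
    also have "\<dots> = s * s * Ar r - 2 * s * Br r + Cr r"
      by (simp add: Ar_def Br_def Cr_def)
    finally show ?thesis .
  qed
  have "0 \<le> Ar r * ((Br r / Ar r) * (Br r / Ar r) * Ar r - 2 * (Br r / Ar r) * Br r + Cr r)"
    using *[of "Br r / Ar r"] Ar_pos[of r] by (intro mult_nonneg_nonneg) auto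
  also have "\<dots> = Ar r * Cr r - (Br r)\<^sup>2"
    using Ar_pos[of r] by (simp add: field_simps power2_eq_square)
  finally show ?thesis by simp
qed

end

end

section \<open>Dependence on |\<lambda>| alone, growth at infinity, and comparison with \<lambda> =
  0\<close>

context log_convexity
begin

text \<open>Along the circle of radius r the factor Re (\<lambda>' cnj \<lambda>) of
  \<open>heat_T\<close> vanishes, so the moment is constant there. The moment bound for real
  \<lambda> thereby extends to the whole circle.\<close>

lemma EZ_rotate:
  "EZ d (of_real r * cis t) (T b k (\<lambda>_. 1)) = EZ d (of_real r) (T b k (\<lambda>_. 1))"
proof -
  let ?f = "\<lambda>t. EZ d (of_real r * cis t) (T b k (\<lambda>_. 1))"
  have cis: "(cis has_vector_derivative \<i> * cis t) (at t)" for t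
    unfolding cis_conv_exp[abs_def]
    by (rule has_vector_derivative_eq_rhs[OF field_vector_diff_chain_at[OF
          has_vector_derivative_mult_right[OF has_vector_derivative_of_real[OF DERIV_ident]] DERIV_exp, unfolded o_def]]) simp
  have "(?f has_vector_derivative of_real (2 * Re ((of_real r * (\<i> * cis t)) * cnj (of_real r * cis t)))
      * (\<Sum>j<d. EZ d (of_real r * cis t) (T12 b k (\<lambda>_. 1) j))) (at t)" for t
    by (rule heat_T[OF cpoly.const, where R = "\<bar>r\<bar>" and lam' = "\<lambda>t. of_real r * (\<i> * cis t)"])
       (auto intro!: has_vector_derivative_mult_right cis simp: norm_mult)
  moreover have "Re ((of_real r * (\<i> * cis t)) * cnj (of_real r * cis t)) = 0" for t
    by (simp add: cis.ctr algebra_simps)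
  ultimately have "(?f has_vector_derivative 0) (at t)" for t by simp
  then have "(?f has_derivative (\<lambda>h. 0)) (at t within UNIV)" for t
    by (simp add: has_vector_derivative_def)
  then have "?f constant_on UNIV"
    using has_derivative_zero_constant[of UNIV ?f] by (auto simp: constant_on_def)
  then obtain y where y: "\<And>t. ?f t = y" unfolding constant_on_def by blast
  from y[of t] y[of 0] show ?thesis by simp
qed

text \<open>The degree enters through \<open>bd\<close>, as growth of order n in |l|. Passing from 1
  + r to H by (1 + r)^2 \<le> 2 (1 + r^2) costs a power of 2, which is absorbed by D; only the
  exponent n a matters for the slope.\<close>

lemma growth:
  assumes a: "a \<ge> 1" and c: "c \<ge> 0"
    and bd: "\<And>l g. norm (P (Zc d l g)) \<le> c * (1 + norm l) ^ n * wt {..<3 * d} g ^ m"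
  shows "\<exists>D. \<forall>r\<ge>0. Ar a r \<le> D * (1 + r\<^sup>2) powr (real n * a)"
proof -
  define N where "N = nat \<lceil>a\<rceil>"
  have N: "a \<le> real N" unfolding N_def by linarith
  define D where "D = ((c\<^sup>2 + e) * 2 ^ n) powr a * (\<integral>g. wt {..<3 * d} g ^ (2 * m * N) \<partial>gauss {..<3 * d})"
  have "Ar a r \<le> D * (1 + r\<^sup>2) powr (real n * a)" if r: "r \<ge> 0" for r
  proof -
    have H: "1 + r\<^sup>2 > 0" by (simp add: add_pos_nonneg)
    have pt: "q (Zc d (of_real r) g) powr a \<le> ((c\<^sup>2 + e) * 2 ^ n) powr a * (1 + r\<^sup>2) powr (real n * a) * wt {..<3 * d} g ^ (2 * m * N)" for g
    proof -
      let ?w = "wt {..<3 * d} g"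
      have w1: "1 \<le> ?w ^ k" for k by (rule one_le_power[OF wt_ge_1])
      have "(1 + r)\<^sup>2 \<le> 2 * (1 + r\<^sup>2)"
        using zero_le_power2[of "r - 1"] by (simp add: power2_eq_square algebra_simps)
      then have H2: "((1 + r)\<^sup>2) ^ n \<le> 2 ^ n * (1 + r\<^sup>2) ^ n"
        using power_mono[of "(1 + r)\<^sup>2" "2 * (1 + r\<^sup>2)" n] by (simp only: power_mult_distrib[symmetric]) simp
      have "(cmod (P (Zc d (of_real r) g)))\<^sup>2 \<le> (c * (1 + r) ^ n * ?w ^ m)\<^sup>2"
        using bd[of "of_real r" g] r by (intro power_mono) auto
      also have "\<dots> = c\<^sup>2 * ((1 + r)\<^sup>2) ^ n * ?w ^ (2 * m)"
        by (simp add: power_mult_distrib power_mult[symmetric] mult.commute)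
      also have "\<dots> \<le> c\<^sup>2 * (2 ^ n * (1 + r\<^sup>2) ^ n) * ?w ^ (2 * m)"
        by (intro mult_right_mono mult_left_mono H2) (auto intro: zero_le_power less_imp_le[OF wt_pos])
      finally have 1: "(cmod (P (Zc d (of_real r) g)))\<^sup>2 \<le> c\<^sup>2 * (2 ^ n * (1 + r\<^sup>2) ^ n) * ?w ^ (2 * m)" .
      have "1 \<le> (2 ^ n * (1 + r\<^sup>2) ^ n) * ?w ^ (2 * m)"
        by (rule mult_ge1_I[OF mult_ge1_I]) (auto simp: w1)
      then have "e \<le> e * ((2 ^ n * (1 + r\<^sup>2) ^ n) * ?w ^ (2 * m))" using e by simp
      with 1 have "q (Zc d (of_real r) g) \<le> (c\<^sup>2 + e) * 2 ^ n * (1 + r\<^sup>2) ^ n * ?w ^ (2 * m)"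
        unfolding q_def by (simp add: algebra_simps)
      then have "q (Zc d (of_real r) g) powr a \<le> ((c\<^sup>2 + e) * 2 ^ n * (1 + r\<^sup>2) ^ n * ?w ^ (2 * m)) powr a"
        using q_pos a by (intro powr_mono2) (auto intro: less_imp_le)
      also have "\<dots> = ((c\<^sup>2 + e) * 2 ^ n) powr a * ((1 + r\<^sup>2) ^ n) powr a * (?w ^ (2 * m)) powr a"
        using e H by (simp add: powr_mult zero_le_power less_imp_le[OF wt_pos])
      also have "((1 + r\<^sup>2) ^ n) powr a = (1 + r\<^sup>2) powr (real n * a)"
        using H by (simp add: powr_realpow[symmetric] powr_powr)
      also have "(?w ^ (2 * m)) powr a \<le> (?w ^ (2 * m)) powr real N"
        using N w1 by (intro powr_mono) auto
      also have "(?w ^ (2 * m)) powr real N = ?w ^ (2 * m * N)"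
        using wt_pos[of "{..<3 * d}" g] by (simp add: powr_realpow power_mult)
      finally show ?thesis by (simp add: mult_left_mono)
    qed
    have "(\<integral>g. q (Zc d (of_real r) g) powr a \<partial>gauss {..<3 * d})
       \<le> (\<integral>g. ((c\<^sup>2 + e) * 2 ^ n) powr a * (1 + r\<^sup>2) powr (real n * a) * wt {..<3 * d} g ^ (2 * m * N) \<partial>gauss {..<3 * d})"
      by (intro integral_mono q_powr_integrable[OF a] integrable_mult_right integrable_wt pt) auto
    then show ?thesis unfolding Ar_def[OF a] Ar_eq[OF a] D_def by (simp add: ac_simps)
  qed
  then show ?thesis by blast
qed

theorem moment_growth:
  assumes a: "a \<ge> 1" and c: "c \<ge> 0"
    and bd: "\<And>l g. norm (P (Zc d l g)) \<le> c * (1 + norm l) ^ n * wt {..<3 * d} g ^ m"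
    and r: "r \<ge> 0"
  shows "(\<integral>g. q (Zc d (of_real r * cis t) g) powr a \<partial>gauss {..<3 * d})
      \<le> (1 + r\<^sup>2) powr (real n * a) * (\<integral>g. q (Zc d 0 g) powr a \<partial>gauss {..<3 * d})"
proof -
  obtain D where D: "\<And>r. r \<ge> 0 \<Longrightarrow> Ar a r \<le> D * (1 + r\<^sup>2) powr (real n * a)"
    using growth[OF a c bd] by blast
  have "Ar a r \<le> (1 + r\<^sup>2) powr (real n * a) * Ar a 0"
    by (rule slope_bound_of_growth(2)[OF Ar_deriv[OF a] Br_deriv[OF a] Ar_pos[OF a] cauchy_schwarz[OF a] D r])
  moreover have "Ar a r = Re (EZ d (of_real r * cis t) (T a 0 (\<lambda>_. 1)))"
    unfolding EZ_rotate Ar_def[OF a] ..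
  then have "Ar a r = (\<integral>g. q (Zc d (of_real r * cis t) g) powr a \<partial>gauss {..<3 * d})"
    unfolding Ar_eq[OF a] by (simp only: Re_complex_of_real)
  moreover have "Ar a 0 = (\<integral>g. q (Zc d 0 g) powr a \<partial>gauss {..<3 * d})"
    unfolding Ar_def[OF a] Ar_eq[OF a] by simp
  ultimately show ?thesis by simp
qed

text \<open>For a = 1 the mixed derivative of |P|^2 + e is |\<partial>_j P|^2, so the slope in log H
  at H = 1 is the integrated squared gradient. The slope bound at that point gives the factor n
  without any loss.\<close>

theorem gradient_L2_growth:
  assumes c: "c \<ge> 0"
    and bd: "\<And>l g. norm (P (Zc d l g)) \<le> c * (1 + norm l) ^ n * wt {..<3 * d} g ^ m"
  shows "(\<Sum>j<d. \<integral>g. (cmod (pd j P (Zc d 0 g)))\<^sup>2 \<partial>gauss {..<3 * d})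
      \<le> real n * (\<integral>g. q (Zc d 0 g) \<partial>gauss {..<3 * d})"
proof -
  have a: "(1 :: real) \<le> 1" by simp
  obtain D where D: "\<And>r. r \<ge> 0 \<Longrightarrow> Ar 1 r \<le> D * (1 + r\<^sup>2) powr (real n * 1)"
    using growth[OF a c bd] by blast
  have *: "Br 1 0 \<le> (real n * 1) * Ar 1 0"
    by (rule slope_bound_of_growth(1)[OF Ar_deriv[OF a] Br_deriv[OF a] Ar_pos[OF a] cauchy_schwarz[OF a] D order_refl])
  have T12: "T12 1 0 (\<lambda>_. 1) j z = of_real ((cmod (pd j P z))\<^sup>2)" for j z
    using q_pos[of z] unfolding T12_def S_def T_def Q_def
    by (simp add: pd_const complex_norm_square powr_zero_eq_one flip: of_real_power)
  have "cnj (EZ d 0 (G 1)) = EZ d 0 (Nb 1 0 (\<lambda>_. 1))" by (rule EZ_cnj_G[OF a, symmetric])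
  also have "\<dots> = (\<Sum>j<d. EZ d 0 (T12 1 0 (\<lambda>_. 1) j))"
    using Nb_eq[OF cpoly.const[of d 1], of 0 1 0] by (simp only: norm_zero) simp
  also have "\<dots> = of_real (\<Sum>j<d. \<integral>g. (cmod (pd j P (Zc d 0 g)))\<^sup>2 \<partial>gauss {..<3 * d})"
    unfolding T12 of_real_sum by (intro sum.cong refl integral_complex_of_real)
  finally have "Re (cnj (EZ d 0 (G 1))) = (\<Sum>j<d. \<integral>g. (cmod (pd j P (Zc d 0 g)))\<^sup>2 \<partial>gauss {..<3 * d})"
    by (simp only: Re_complex_of_real)
  then have "Br 1 0 = (\<Sum>j<d. \<integral>g. (cmod (pd j P (Zc d 0 g)))\<^sup>2 \<partial>gauss {..<3 * d})"
    unfolding Br_def[OF a] by simp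
  moreover have "Ar 1 0 = (\<integral>g. q (Zc d 0 g) \<partial>gauss {..<3 * d})"
    unfolding Ar_def[OF a] Ar_eq[OF a] using q_pos by (simp add: less_imp_le)
  ultimately show ?thesis using * by simp
qed

end

section \<open>Complexified polynomials on complex lines\<close>

lemma powr_le_tangent:
  fixes x r :: real
  assumes "0 \<le> r" "r \<le> 1" "x \<ge> 0"
  shows "x powr r \<le> 1 + r * (x - 1)"
proof (cases "x = 0")
  case False
  then have x: "x > 0" using assms by simp
  have "exp ((1 - r) *\<^sub>R 0 + r *\<^sub>R ln x) \<le> (1 - r) * exp 0 + r * exp (ln x)"
    by (rule convex_onD[OF exp_convex]) (use assms in auto)
  then show ?thesis using x by (simp add: powr_def algebra_simps)
qed (use assms in auto)

text \<open>The concave case with exponent 1 / s at the point (u / m)^s, rearranged. It plays the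
  part of Jensen's inequality: when m is the mean of u, the linear term integrates to zero.\<close>

lemma powr_ge_tangent:
  fixes u m s :: real
  assumes s: "s \<ge> 1" and u: "u \<ge> 0" and m: "m > 0"
  shows "m powr s + s * m powr (s - 1) * (u - m) \<le> u powr s"
proof -
  have "((u / m) powr s) powr (1 / s) \<le> 1 + 1 / s * ((u / m) powr s - 1)"
    by (rule powr_le_tangent) (use s in auto)
  then have "u / m \<le> 1 + 1 / s * ((u / m) powr s - 1)"
    using s u m by (simp add: powr_powr)
  then have "s * (u / m - 1) \<le> (u / m) powr s - 1"
    using s by (simp add: field_simps)
  then have "m powr s * (1 + s * (u / m - 1)) \<le> m powr s * (u / m) powr s"
    by (intro mult_left_mono) auto
  also have "m powr s * (u / m) powr s = u powr s"
    using u m by (simp add: powr_divide)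
  also have "m powr s * (1 + s * (u / m - 1)) = m powr s + s * (m powr s / m) * (u - m)"
    using m by (simp add: field_simps)
  also have "m powr s / m = m powr (s - 1)" using m by (simp add: powr_diff)
  finally show ?thesis .
qed

lemma powr_le_tangent_at:
  fixes u m s :: real
  assumes s: "0 \<le> s" "s \<le> 1" and u: "u \<ge> 0" and m: "m > 0"
  shows "u powr s \<le> m powr s + s * m powr (s - 1) * (u - m)"
proof -
  have "(u / m) powr s \<le> 1 + s * (u / m - 1)"
    by (rule powr_le_tangent) (use s u m in auto)
  then have "m powr s * (u / m) powr s \<le> m powr s * (1 + s * (u / m - 1))"
    by (intro mult_left_mono) auto
  also have "m powr s * (u / m) powr s = u powr s"
    using u m by (simp add: powr_divide)
  also have "m powr s * (1 + s * (u / m - 1)) = m powr s + s * (m powr s / m) * (u - m)"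
    using m by (simp add: field_simps)
  also have "m powr s / m = m powr (s - 1)" using m by (simp add: powr_diff)
  finally show ?thesis .
qed

lemma power_mean:
  fixes y :: "'i \<Rightarrow> real"
  assumes "finite I" "I \<noteq> {}" "\<And>i. i \<in> I \<Longrightarrow> y i \<ge> 0" and p: "p \<ge> 1"
  shows "((\<Sum>i\<in>I. y i) / card I) powr p \<le> (\<Sum>i\<in>I. y i powr p) / card I"
proof -
  define m where "m = (\<Sum>i\<in>I. y i) / card I"
  have c: "real (card I) > 0" using assms by (simp add: card_gt_0_iff)
  have "m \<ge> 0" unfolding m_def using assms by (intro divide_nonneg_nonneg sum_nonneg) auto
  show ?thesis
  proof (cases "m = 0")
    case True
    then show ?thesis unfolding m_def[symmetric] by (simp add: sum_nonneg)
  next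
    case False
    then have m: "m > 0" using \<open>m \<ge> 0\<close> by simp
    have "(\<Sum>i\<in>I. m powr p + p * m powr (p - 1) * (y i - m)) \<le> (\<Sum>i\<in>I. y i powr p)"
      by (intro sum_mono powr_ge_tangent p assms m)
    also have "(\<Sum>i\<in>I. m powr p + p * m powr (p - 1) * (y i - m))
        = card I * m powr p + p * m powr (p - 1) * ((\<Sum>i\<in>I. y i) - card I * m)"
      by (simp add: sum.distrib sum_distrib_left[symmetric] sum_subtractf)
    also have "(\<Sum>i\<in>I. y i) - card I * m = 0" unfolding m_def using c by simp
    finally show ?thesis unfolding m_def[symmetric] using c by (simp add: field_simps)
  qed
qed

text \<open>Weighting the values at the n + 1 roots of unity by w^(k n) = w^(-k) keeps exactly the
  coefficients of index i with n + 1 dividing i + n, and among 0, ..., n this is i = 1 only. The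
  weights have modulus 1, so the bound is a plain mean over the circle.\<close>

lemma coeff_1_roots_of_unity:
  fixes H :: "complex poly"
  assumes deg: "degree H \<le> n" and n: "n \<ge> 1" and r: "r > 0"
  shows "r * cmod (coeff H 1) \<le> (\<Sum>k<Suc n. cmod (poly H (of_real r * cis (2 * pi * real k / real (Suc n))))) / real (Suc n)"
proof -
  define w where "w = cis (2 * pi / real (Suc n))"
  have wk: "cis (2 * pi * real k / real (Suc n)) = w ^ k" for k
    unfolding w_def Complex.DeMoivre by (simp add: algebra_simps)
  have w1: "w ^ j = 1 \<longleftrightarrow> Suc n dvd j" for j
  proof -
    have "w ^ j = exp (2 * of_real pi * \<i> * of_nat j / of_nat (Suc n))"
      unfolding wk[symmetric] cis_conv_exp by (simp add: mult_ac)
    then show ?thesis using complex_root_unity_eq_1[of "Suc n" j] by simp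
  qed
  have geo: "(\<Sum>k<Suc n. (w ^ j) ^ k) = (if Suc n dvd j then of_nat (Suc n) else 0)" for j
  proof (cases "Suc n dvd j")
    case True
    then show ?thesis using w1[of j] by simp
  next
    case False
    then have ne: "w ^ j \<noteq> 1" using w1 by simp
    moreover have "(w ^ j) ^ Suc n = 1" unfolding power_mult[symmetric] w1 by (rule dvd_triv_right)
    ultimately show ?thesis using False geometric_sum[OF ne, of "Suc n"]
      by (simp del: sum.lessThan_Suc power_Suc)
  qed
  have "(\<Sum>k<Suc n. w ^ (k * n) * poly H (of_real r * w ^ k)) = of_nat (Suc n) * (of_real r * coeff H 1)"
  proof -
    have "(\<Sum>k<Suc n. w ^ (k * n) * poly H (of_real r * w ^ k))
       = (\<Sum>k<Suc n. \<Sum>i\<le>n. coeff H i * of_real r ^ i * (w ^ (i + n)) ^ k)"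
    proof (intro sum.cong refl)
      fix k
      have "poly H (of_real r * w ^ k) = (\<Sum>i\<le>n. coeff H i * (of_real r * w ^ k) ^ i)"
        unfolding poly_altdef using deg by (intro sum.mono_neutral_left) (auto simp: coeff_eq_0)
      then show "w ^ (k * n) * poly H (of_real r * w ^ k) = (\<Sum>i\<le>n. coeff H i * of_real r ^ i * (w ^ (i + n)) ^ k)"
        by (simp add: sum_distrib_left power_mult_distrib power_add power_mult[symmetric] mult.commute mult.left_commute mult.assoc)
    qed
    also have "\<dots> = (\<Sum>i\<le>n. coeff H i * of_real r ^ i * (\<Sum>k<Suc n. (w ^ (i + n)) ^ k))"
      by (subst sum.swap) (simp only: sum_distrib_left)
    also have "\<dots> = (\<Sum>i\<le>n. if i = 1 then coeff H 1 * of_real r * of_nat (Suc n) else 0)"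
    proof (intro sum.cong refl)
      fix i assume "i \<in> {..n}"
      then have "Suc n dvd i + n \<longleftrightarrow> i = 1"
      proof (cases i)
        case 0
        then show ?thesis using n by (auto dest: dvd_imp_le)
      next
        case (Suc i')
        have "Suc n dvd i' \<longleftrightarrow> i' = 0"
          using \<open>i \<in> {..n}\<close> Suc by (auto dest: dvd_imp_le)
        moreover have "i + n = Suc n + i'" using Suc by simp
        ultimately show ?thesis using Suc by (simp only: dvd_add_right_iff[OF dvd_refl]) simp
      qed
      then show "coeff H i * of_real r ^ i * (\<Sum>k<Suc n. (w ^ (i + n)) ^ k)
         = (if i = 1 then coeff H 1 * of_real r * of_nat (Suc n) else 0)"
        unfolding geo by simp
    qed
    also have "\<dots> = of_nat (Suc n) * (of_real r * coeff H 1)" using n by simp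
    finally show ?thesis .
  qed
  then have "real (Suc n) * (r * cmod (coeff H 1)) = cmod (\<Sum>k<Suc n. w ^ (k * n) * poly H (of_real r * w ^ k))"
    using r by (simp add: norm_mult del: of_nat_Suc)
  also have "\<dots> \<le> (\<Sum>k<Suc n. cmod (poly H (of_real r * w ^ k)))"
    by (rule sum_norm_le) (simp add: norm_mult norm_power w_def)
  finally show ?thesis unfolding wk by (simp add: field_simps)
qed

section \<open>Complexification, restriction to complex lines, and marginals\<close>

lemma cpoly_depends: "cpoly d M \<Longrightarrow> (\<And>j. j < d \<Longrightarrow> z j = w j) \<Longrightarrow> M z = M w"
  by (induction rule: cpoly.induct) auto

lemma Zc_0: "Zc d 0 g = (\<lambda>j. of_real (g j))"
  by (rule ext) (simp add: Zc_def)

text \<open>The degree of P is recorded in two forms: as growth in l, which controls the slope of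
  the moments at infinity, and as the degree on every complex line, which is what the root-of-unity
  average requires.\<close>

lemma poly_fun_complexify:
  assumes "poly_fun d n P"
  obtains Q where "cpoly d Q" "\<And>x. Q (\<lambda>i. of_real (x i)) = of_real (P x)"
    "\<exists>c m. c \<ge> 0 \<and> (\<forall>l g. norm (Q (Zc d l g)) \<le> c * (1 + norm l) ^ n * wt {..<3 * d} g ^ m)"
    "\<And>x v. \<exists>H. degree H \<le> n \<and> (\<forall>l. Q (\<lambda>i. x i + l * v i) = poly H l)"
proof -
  obtain A a where A: "finite A" "\<And>m. m \<in> A \<Longrightarrow> (\<Sum>i<d. m i) \<le> n"
      and P: "\<And>x. P x = (\<Sum>m\<in>A. a m * (\<Prod>i<d. x i ^ m i))"
    using assms unfolding poly_fun_def by blast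
  define Q where "Q z = (\<Sum>m\<in>A. complex_of_real (a m) * (\<Prod>i<d. z i ^ m i))" for z :: "nat \<Rightarrow> complex"
  show thesis
  proof (rule that)
    show "cpoly d Q"
      unfolding Q_def using A by (intro cpoly_sum cpoly.mult cpoly.const cpoly_prod cpoly_power cpoly.coord) auto
    show "Q (\<lambda>i. of_real (x i)) = of_real (P x)" for x
      unfolding Q_def P by simp
    show "\<exists>c m. c \<ge> 0 \<and> (\<forall>l g. norm (Q (Zc d l g)) \<le> c * (1 + norm l) ^ n * wt {..<3 * d} g ^ m)"
    proof (intro exI[of _ "\<Sum>m\<in>A. \<bar>a m\<bar>"] exI[of _ n] conjI allI)
      fix l :: complex and g :: "nat \<Rightarrow> real"
      let ?b = "\<lambda>j. (1 + \<bar>g j\<bar>) * (1 + \<bar>g (d + j)\<bar>) * (1 + \<bar>g (2 * d + j)\<bar>)"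
      have b: "1 \<le> ?b j" for j by (intro mult_ge1_I) auto
      have "norm (Q (Zc d l g)) \<le> (\<Sum>m\<in>A. \<bar>a m\<bar> * ((1 + norm l) ^ n * wt {..<3 * d} g ^ n))"
        unfolding Q_def
      proof (rule sum_norm_le)
        fix m assume m: "m \<in> A"
        have mi: "m i \<le> n" if "i < d" for i
          using A(2)[OF m] member_le_sum[of i "{..<d}" m] that by simp
        have "norm (\<Prod>i<d. Zc d l g i ^ m i) \<le> (\<Prod>i<d. (1 + norm l) ^ m i * ?b i ^ n)"
          unfolding prod_norm[symmetric]
        proof (intro prod_mono conjI norm_ge_zero)
          fix i assume "i \<in> {..<d}"
          then have i: "i < d" by simp
          have "norm (Zc d l g i ^ m i) \<le> ((1 + norm l) * ?b i) ^ m i"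
            unfolding norm_power using one_plus_norm_Zc_le[of d l g i] by (intro power_mono) auto
          also have "\<dots> = (1 + norm l) ^ m i * ?b i ^ m i" by (rule power_mult_distrib)
          also have "\<dots> \<le> (1 + norm l) ^ m i * ?b i ^ n"
            by (intro mult_left_mono power_increasing mi[OF i] b) auto
          finally show "norm (Zc d l g i ^ m i) \<le> (1 + norm l) ^ m i * ?b i ^ n" .
        qed
        also have "\<dots> = (1 + norm l) ^ (\<Sum>i<d. m i) * wt {..<3 * d} g ^ n"
          unfolding wt_3 prod.distrib[of "\<lambda>i. (1 + norm l) ^ m i"] power_sum prod_power_distrib ..
        also have "\<dots> \<le> (1 + norm l) ^ n * wt {..<3 * d} g ^ n"
          by (intro mult_right_mono power_increasing A(2)[OF m]) (auto intro!: zero_le_power less_imp_le[OF wt_pos])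
        finally show "norm (complex_of_real (a m) * (\<Prod>i<d. Zc d l g i ^ m i)) \<le> \<bar>a m\<bar> * ((1 + norm l) ^ n * wt {..<3 * d} g ^ n)"
          unfolding norm_mult by (simp add: mult_left_mono)
      qed
      then show "norm (Q (Zc d l g)) \<le> (\<Sum>m\<in>A. \<bar>a m\<bar>) * (1 + norm l) ^ n * wt {..<3 * d} g ^ n"
        by (simp add: sum_distrib_right mult.assoc)
    qed (auto intro: sum_nonneg)
    show "\<exists>H. degree H \<le> n \<and> (\<forall>l. Q (\<lambda>i. x i + l * v i) = poly H l)" for x v
    proof (intro exI conjI allI)
      let ?H = "\<Sum>m\<in>A. smult (complex_of_real (a m)) (\<Prod>i<d. [:x i, v i:] ^ m i)"
      show "degree ?H \<le> n"
      proof (rule degree_sum_le[OF A(1)])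
        fix m assume m: "m \<in> A"
        have "degree (\<Prod>i<d. [:x i, v i:] ^ m i) \<le> (\<Sum>i<d. degree ([:x i, v i:] ^ m i))"
          by (rule degree_prod_sum_le[unfolded o_def]) simp
        also have "\<dots> \<le> (\<Sum>i<d. m i)"
        proof (rule sum_mono)
          fix i
          have "degree ([:x i, v i:] ^ m i) \<le> degree [:x i, v i:] * m i" by (rule degree_power_le)
          also have "\<dots> \<le> 1 * m i" by (intro mult_right_mono) auto
          finally show "degree ([:x i, v i:] ^ m i) \<le> m i" by simp
        qed
        also have "\<dots> \<le> n" by (rule A(2)[OF m])
        finally show "degree (smult (complex_of_real (a m)) (\<Prod>i<d. [:x i, v i:] ^ m i)) \<le> n"
          using degree_smult_le order_trans by blast
      qed
      show "Q (\<lambda>i. x i + l * v i) = poly ?H l" for l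
        unfolding Q_def by (simp add: poly_sum poly_prod)
    qed
  qed
qed

text \<open>The derivative at 0 along the real parameter of the line is computed twice, by the chain
  rule for Q and from the polynomial H.\<close>

lemma line_coeff:
  assumes Q: "cpoly d Q" and H: "\<And>l. Q (\<lambda>i. x i + l * v i) = poly H l"
  shows "coeff H 1 = (\<Sum>j<d. pd j Q x * v j)"
proof -
  have "((\<lambda>s. Q (\<lambda>i. x i + of_real s * v i)) has_vector_derivative
     (\<Sum>j<d. pd j Q (\<lambda>i. x i + of_real 0 * v i) * v j + 0 * cnj (v j))) (at 0)"
    by (rule wirtingerD[OF cpoly_pd(2)[OF Q]])
       (auto intro!: derivative_eq_intros has_vector_derivative_of_real DERIV_ident)
  then have 1: "((\<lambda>s. poly H (of_real s)) has_vector_derivative (\<Sum>j<d. pd j Q x * v j)) (at 0)"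
    unfolding H by simp
  have "((\<lambda>s. poly H (of_real s)) has_vector_derivative poly (pderiv H) (of_real 0)) (at (0::real))"
    by (rule has_vector_derivative_real_field) (rule poly_DERIV)
  from vector_derivative_unique_at[OF 1 this] show ?thesis
    by (simp add: poly_0_coeff_0 coeff_pderiv)
qed

text \<open>On the real axis Q takes real values, so the imaginary part of its derivative there is
  the derivative of the zero function; the real part is the derivative of P.\<close>

lemma partial_deriv_eq_pd:
  assumes Q: "cpoly d Q" and QP: "\<And>x. Q (\<lambda>i. of_real (x i)) = complex_of_real (P x)"
  shows "pd i Q (\<lambda>i. of_real (x i)) = of_real (partial_deriv i P x)"
    and "((\<lambda>t. P (x(i := t))) has_real_derivative partial_deriv i P x) (at (x i))"
proof -
  let ?X = "\<lambda>i. complex_of_real (x i)"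
  define D where "D = pd i Q ?X"
  have "((\<lambda>t. Q (?X(i := t))) has_field_derivative pd i Q (?X(i := ?X i))) (at (?X i))"
    by (rule cpoly_pd(3)[OF Q])
  then have "((\<lambda>t. Q (?X(i := t))) has_field_derivative D) (at (of_real (x i)))"
    unfolding D_def by (simp only: fun_upd_idem)
  then have "((\<lambda>t. Q (?X(i := of_real t))) has_vector_derivative D) (at (x i))"
    by (rule has_vector_derivative_real_field)
  also have "(\<lambda>t. Q (?X(i := of_real t))) = (\<lambda>t. of_real (P (x(i := t))))"
    unfolding QP[symmetric] by (intro ext arg_cong[of _ _ Q]) auto
  finally have D: "((\<lambda>t. complex_of_real (P (x(i := t)))) has_vector_derivative D) (at (x i))" .
  have re: "((\<lambda>t. P (x(i := t))) has_real_derivative Re D) (at (x i))"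
    using bounded_linear.has_vector_derivative[OF bounded_linear_Re D]
    by (simp add: has_real_derivative_iff_has_vector_derivative)
  have "((\<lambda>t. 0 :: real) has_real_derivative Im D) (at (x i))"
    using bounded_linear.has_vector_derivative[OF bounded_linear_Im D]
    by (simp add: has_real_derivative_iff_has_vector_derivative)
  then have "Im D = 0" using DERIV_unique DERIV_const by blast
  moreover have pD: "partial_deriv i P x = Re D"
    unfolding partial_deriv_def by (rule DERIV_imp_deriv[OF re])
  ultimately show "pd i Q ?X = of_real (partial_deriv i P x)"
    unfolding D_def[symmetric] by (simp add: complex_eq_iff)
  show "((\<lambda>t. P (x(i := t))) has_real_derivative partial_deriv i P x) (at (x i))"
    using re pD by simp
qed

lemma gauss_marginal:
  fixes f :: "(nat \<Rightarrow> real) \<Rightarrow> real"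
  assumes J: "J \<subseteq> I" "finite I" and f: "f \<in> borel_measurable (gauss J)"
    and dep: "\<And>g. f (restrict g J) = f g"
  shows "(\<integral>g. f g \<partial>gauss I) = (\<integral>g. f g \<partial>gauss J)"
proof -
  interpret product_prob_space "\<lambda>_::nat. std_normal_distribution"
    by standard
  have "(\<integral>g. f g \<partial>gauss J) = (\<integral>g. f g \<partial>distr (gauss I) (gauss J) (\<lambda>g. restrict g J))"
    using distr_restrict[OF J] by simp
  also have "\<dots> = (\<integral>g. f (restrict g J) \<partial>gauss I)"
    by (rule integral_distr[OF measurable_restrict_subset[OF J(1)] f])
  finally show ?thesis unfolding dep ..
qed

section \<open>Moments of Gaussian linear forms\<close>

definition lin_form :: "nat set \<Rightarrow> (nat \<Rightarrow> real) \<Rightarrow> (nat \<Rightarrow> real) \<Rightarrow> real" where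
  "lin_form I v g = (\<Sum>i\<in>I. v i * g i)"

lemma lin_form_bound:
  assumes "finite I"
  shows "\<bar>lin_form I v g\<bar> \<le> (\<Sum>i\<in>I. \<bar>v i\<bar>) * wt I g"
proof -
  have "\<bar>lin_form I v g\<bar> \<le> (\<Sum>i\<in>I. \<bar>v i\<bar> * wt I g)"
    unfolding lin_form_def
  proof (rule sum_norm_le[where 'a = real, unfolded real_norm_def])
    fix i assume "i \<in> I"
    then have "\<bar>g i\<bar> \<le> wt I g" using coord_le_wt[OF assms, of i g] by simp
    then show "\<bar>v i * g i\<bar> \<le> \<bar>v i\<bar> * wt I g" by (simp add: abs_mult mult_left_mono)
  qed
  then show ?thesis by (simp add: sum_distrib_right)
qed

lemma lin_form_measurable [measurable]: "lin_form I v \<in> borel_measurable (gauss I)"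
proof -
  have "(\<lambda>g. \<Sum>i\<in>I. v i * g i) \<in> borel_measurable (gauss I)"
    by (intro borel_measurable_sum borel_measurable_times gauss_coord_measurable) auto
  then show ?thesis unfolding lin_form_def[abs_def] .
qed

lemma lin_form_power_bound:
  assumes "finite I"
  shows "\<bar>c * lin_form I v g ^ k\<bar> \<le> (\<bar>c\<bar> * (\<Sum>i\<in>I. \<bar>v i\<bar>) ^ k) * wt I g ^ k"
  unfolding abs_mult power_abs mult.assoc power_mult_distrib[symmetric]
  by (intro mult_left_mono power_mono lin_form_bound assms) auto

lemma lin_form_power_integrable: "finite I \<Longrightarrow> integrable (gauss I) (\<lambda>g. lin_form I v g ^ k)"
  using lin_form_power_bound[of I 1 v _ k] by (intro integrable_gauss_wt_bound) auto

lemma lin_form_upd: "finite I \<Longrightarrow> i \<in> I \<Longrightarrow> lin_form I v (g(i := t)) = v i * t + lin_form (I - {i}) v g"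
  unfolding lin_form_def by (subst sum.remove[of I i]) auto

text \<open>One factor of the power is expanded as the sum of the v_i g_i, and each g_i is
  integrated by parts; every term returns v_i^2 times the same lower moment.\<close>

lemma lin_form_moment_step:
  assumes I: "finite I"
  shows "(\<integral>g. lin_form I v g ^ (Suc k + 1) \<partial>gauss I) = real (Suc k) * (\<Sum>i\<in>I. (v i)\<^sup>2) * (\<integral>g. lin_form I v g ^ k \<partial>gauss I)"
proof -
  have ib: "(\<integral>g. g i *\<^sub>R lin_form I v g ^ Suc k \<partial>gauss I) = (\<integral>g. (real (Suc k) * v i) * lin_form I v g ^ k \<partial>gauss I)"
    if i: "i \<in> I" for i
  proof (rule gauss_ibp[OF I i])
    show "((\<lambda>t. lin_form I v (g(i := t)) ^ Suc k) has_vector_derivative (real (Suc k) * v i) * lin_form I v (g(i := t)) ^ k) (at t)" for g t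
      unfolding lin_form_upd[OF I i] has_real_derivative_iff_has_vector_derivative[symmetric]
    proof -
      have "((\<lambda>t. v i * t + lin_form (I - {i}) v g) has_real_derivative v i) (at t)"
        by (auto intro!: derivative_eq_intros)
      from DERIV_power[OF this, of "Suc k"]
      show "((\<lambda>t. (v i * t + lin_form (I - {i}) v g) ^ Suc k) has_real_derivative
          real (Suc k) * v i * (v i * t + lin_form (I - {i}) v g) ^ k) (at t)"
        by (simp only: diff_Suc_Suc minus_nat.diff_0 mult_ac)
    qed
    show "continuous_on UNIV (\<lambda>t. (real (Suc k) * v i) * lin_form I v (g(i := t)) ^ k)" for g
      unfolding lin_form_upd[OF I i] by (intro continuous_intros)
    show "norm (lin_form I v g ^ Suc k) \<le> (\<bar>1\<bar> * (\<Sum>i\<in>I. \<bar>v i\<bar>) ^ Suc k) * wt I g ^ Suc k" for g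
      using lin_form_power_bound[OF I, of 1 v g "Suc k"] by simp
    show "norm ((real (Suc k) * v i) * lin_form I v g ^ k) \<le> (\<bar>real (Suc k) * v i\<bar> * (\<Sum>i\<in>I. \<bar>v i\<bar>) ^ k) * wt I g ^ k" for g
      using lin_form_power_bound[OF I, of "real (Suc k) * v i" v g k] by simp
  qed (use I i in measurable)
  have int: "integrable (gauss I) (\<lambda>g. g i *\<^sub>R lin_form I v g ^ Suc k)" if i: "i \<in> I" for i
  proof (rule integrable_gauss_wt_bound[OF I])
    have [measurable]: "(\<lambda>g. g i) \<in> borel_measurable (gauss I)" by (rule gauss_coord_measurable[OF i])
    show "(\<lambda>g. g i *\<^sub>R lin_form I v g ^ Suc k) \<in> borel_measurable (gauss I)" by measurable
    show "norm (g i *\<^sub>R lin_form I v g ^ Suc k) \<le> (\<Sum>i\<in>I. \<bar>v i\<bar>) ^ Suc k * wt I g ^ Suc (Suc k)" for g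
    proof -
      have "\<bar>g i\<bar> \<le> wt I g" using coord_le_wt[OF I i, of g] by simp
      then have "\<bar>g i\<bar> * \<bar>lin_form I v g ^ Suc k\<bar> \<le> wt I g * ((\<Sum>i\<in>I. \<bar>v i\<bar>) ^ Suc k * wt I g ^ Suc k)"
        using lin_form_power_bound[OF I, of 1 v g "Suc k"] by (intro mult_mono) (auto intro: less_imp_le[OF wt_pos])
      then show ?thesis by (simp add: abs_mult mult_ac)
    qed
  qed
  have "(\<integral>g. lin_form I v g ^ (Suc k + 1) \<partial>gauss I) = (\<integral>g. (\<Sum>i\<in>I. v i * (g i *\<^sub>R lin_form I v g ^ Suc k)) \<partial>gauss I)"
    by (intro Bochner_Integration.integral_cong refl) (simp add: lin_form_def sum_distrib_right mult_ac)
  also have "\<dots> = (\<Sum>i\<in>I. v i * (\<integral>g. g i *\<^sub>R lin_form I v g ^ Suc k \<partial>gauss I))"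
    using int by (simp only: Bochner_Integration.integral_sum integrable_mult_right integral_mult_right_zero)
  also have "\<dots> = (\<Sum>i\<in>I. v i * (\<integral>g. (real (Suc k) * v i) * lin_form I v g ^ k \<partial>gauss I))"
    using ib by simp
  also have "\<dots> = real (Suc k) * (\<Sum>i\<in>I. (v i)\<^sup>2) * (\<integral>g. lin_form I v g ^ k \<partial>gauss I)"
    by (simp add: sum_distrib_left sum_distrib_right power2_eq_square mult_ac)
  finally show ?thesis .
qed

text \<open>The exact moment is (2 k - 1)!! V^k with V the variance. The power (k / 2)^k replaces
  the double factorial by a form that combines with real exponents and still has the order k^k up to
  an exponential factor.\<close>

lemma lin_form_even_moment_ge:
  assumes I: "finite I"
  shows "(real k / 2 * (\<Sum>i\<in>I. (v i)\<^sup>2)) ^ k \<le> (\<integral>g. lin_form I v g ^ (2 * k) \<partial>gauss I)"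
proof (induction k)
  case 0
  interpret prob_space "gauss I" by (rule prob_space_gauss)
  show ?case by (simp add: prob_space)
next
  case (Suc k)
  define V where "V = (\<Sum>i\<in>I. (v i)\<^sup>2)"
  have V: "V \<ge> 0" unfolding V_def by (simp add: sum_nonneg)
  \<comment> \<open>For k \<ge> 1 one has (k + 1)^k \<le> e k^k \<le> 3 k^k and 3 (k + 1) / 2 \<le>
    2 k + 1; the case k = 0 is direct.\<close>
  have num: "(real (Suc k) / 2) ^ Suc k \<le> real (Suc (2 * k)) * (real k / 2) ^ k"
  proof (cases "k = 0")
    case False
    then have k: "real k \<ge> 1" by simp
    have "real (Suc k) ^ k = (1 + 1 / real k) ^ k * real k ^ k"
      using k by (simp add: power_mult_distrib[symmetric] distrib_right add.commute)
    also have "(1 + 1 / real k) ^ k \<le> exp (1 / real k) ^ k"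
      by (intro power_mono exp_ge_add_one_self) auto
    also have "exp (1 / real k) ^ k = exp 1"
      using k by (simp add: exp_of_nat_mult[symmetric])
    also have "exp 1 \<le> (3 :: real)" by (rule exp_le)
    finally have "real (Suc k) ^ k \<le> 3 * real k ^ k" by (simp add: mult_right_mono)
    then have "(real (Suc k) / 2) ^ k \<le> 3 * (real k / 2) ^ k"
      by (simp add: power_divide divide_right_mono)
    then have "(real (Suc k) / 2) ^ Suc k \<le> real (Suc k) / 2 * (3 * (real k / 2) ^ k)"
      unfolding power_Suc by (intro mult_left_mono) auto
    also have "\<dots> = (real (Suc k) / 2 * 3) * (real k / 2) ^ k" by simp
    also have "\<dots> \<le> real (Suc (2 * k)) * (real k / 2) ^ k"
      using k by (intro mult_right_mono) auto
    finally show ?thesis .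
  qed simp
  have "(real (Suc k) / 2 * V) ^ Suc k = (real (Suc k) / 2) ^ Suc k * V ^ Suc k" by (rule power_mult_distrib)
  also have "\<dots> \<le> (real (Suc (2 * k)) * (real k / 2) ^ k) * V ^ Suc k"
    using V by (intro mult_right_mono num) auto
  also have "\<dots> = real (Suc (2 * k)) * V * (real k / 2 * V) ^ k"
    by (simp only: power_mult_distrib power_Suc mult_ac)
  also have "\<dots> \<le> real (Suc (2 * k)) * V * (\<integral>g. lin_form I v g ^ (2 * k) \<partial>gauss I)"
    using Suc.IH V unfolding V_def[symmetric] by (intro mult_left_mono mult_nonneg_nonneg) auto
  also have "\<dots> = (\<integral>g. lin_form I v g ^ (2 * Suc k) \<partial>gauss I)"
    using lin_form_moment_step[OF I, of v "2 * k"] by (simp add: V_def)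
  finally show ?case unfolding V_def .
qed

lemma abs_lin_powr_integrable:
  assumes I: "finite I" and p: "p \<ge> 0"
  shows "integrable (gauss I) (\<lambda>g. \<bar>lin_form I v g\<bar> powr p)"
proof (rule Bochner_Integration.integrable_bound)
  define N where "N = nat \<lceil>p\<rceil>"
  have N: "p \<le> real N" unfolding N_def by linarith
  show "integrable (gauss I) (\<lambda>g. 1 + \<bar>lin_form I v g ^ N\<bar>)"
  proof -
    interpret prob_space "gauss I" by (rule prob_space_gauss)
    show ?thesis by (intro Bochner_Integration.integrable_add integrable_abs lin_form_power_integrable I) auto
  qed
  show "AE g in gauss I. norm (\<bar>lin_form I v g\<bar> powr p) \<le> norm (1 + \<bar>lin_form I v g ^ N\<bar>)"
  proof (rule AE_I2)
    fix g
    have "\<bar>lin_form I v g\<bar> powr p \<le> 1 + \<bar>lin_form I v g\<bar> ^ N"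
    proof (cases "\<bar>lin_form I v g\<bar> \<le> 1")
      case True
      then have "\<bar>lin_form I v g\<bar> powr p \<le> 1 powr p" using p by (intro powr_mono2) auto
      then show ?thesis by (simp add: add_increasing2)
    next
      case False
      then have "\<bar>lin_form I v g\<bar> powr p \<le> \<bar>lin_form I v g\<bar> powr real N" using N by (intro powr_mono) auto
      then show ?thesis using False by (simp add: powr_realpow)
    qed
    then show "norm (\<bar>lin_form I v g\<bar> powr p) \<le> norm (1 + \<bar>lin_form I v g ^ N\<bar>)" by (simp add: power_abs)
  qed
qed measurable

text \<open>Jensen's inequality raises the even moment of order 2 k, with k the integer part of p /
  2, to order p through the exponent s = p / (2 k) \<ge> 1. The 8 is the 2 of the even moment bound
  times the 4 of k \<ge> p / 4.\<close>

lemma abs_lin_powr_ge: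
  assumes I: "finite I" and p: "p \<ge> 2"
  shows "(p / 8) powr (p / 2) * sqrt (\<Sum>i\<in>I. (v i)\<^sup>2) powr p \<le> (\<integral>g. \<bar>lin_form I v g\<bar> powr p \<partial>gauss I)"
proof -
  define V where "V = (\<Sum>i\<in>I. (v i)\<^sup>2)"
  have V: "V \<ge> 0" unfolding V_def by (simp add: sum_nonneg)
  define k where "k = nat \<lfloor>p / 2\<rfloor>"
  have k1: "k \<ge> 1" using p unfolding k_def by (simp add: le_nat_iff le_floor_iff)
  have kp: "real k \<le> p / 2" "p / 2 < real k + 1" using p unfolding k_def by linarith+
  \<comment> \<open>From p / 2 < k + 1 \<le> 2 k.\<close>
  have k4: "p / 4 \<le> real k" using kp k1 p by linarith
  define m where "m = (\<integral>g. lin_form I v g ^ (2 * k) \<partial>gauss I)"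
  define s where "s = p / (2 * real k)"
  have s: "s \<ge> 1" using kp k1 unfolding s_def by (simp add: field_simps)
  have mk: "(real k / 2 * V) ^ k \<le> m" unfolding V_def m_def by (rule lin_form_even_moment_ge[OF I])
  show ?thesis
  proof (cases "V = 0")
    case True
    then show ?thesis unfolding V_def[symmetric] by simp
  next
    case False
    then have Vp: "V > 0" using V by simp
    have m: "m > 0" by (rule less_le_trans[OF _ mk]) (use Vp k1 in auto)
    interpret prob_space "gauss I" by (rule prob_space_gauss)
    have pt: "\<bar>x\<bar> powr p = (x ^ (2 * k)) powr s" for x :: real
    proof -
      have "x ^ (2 * k) = \<bar>x\<bar> ^ (2 * k)" by (simp add: power_even_abs)
      then show ?thesis using k1 by (cases "x = 0") (auto simp: powr_realpow[symmetric] powr_powr s_def)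
    qed
    have "m powr s + s * m powr (s - 1) * (m - m) = (\<integral>g. m powr s + s * m powr (s - 1) * (lin_form I v g ^ (2 * k) - m) \<partial>gauss I)"
      using lin_form_power_integrable[OF I, of v "2 * k"] by (simp add: m_def prob_space)
    also have "\<dots> \<le> (\<integral>g. \<bar>lin_form I v g\<bar> powr p \<partial>gauss I)"
    proof (rule integral_mono)
      show "m powr s + s * m powr (s - 1) * (lin_form I v g ^ (2 * k) - m) \<le> \<bar>lin_form I v g\<bar> powr p" for g
        unfolding pt by (rule powr_ge_tangent[OF s _ m]) simp
      show "integrable (gauss I) (\<lambda>g. m powr s + s * m powr (s - 1) * (lin_form I v g ^ (2 * k) - m))"
        by (intro Bochner_Integration.integrable_add integrable_mult_right Bochner_Integration.integrable_diff
            lin_form_power_integrable I) auto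
    qed (intro abs_lin_powr_integrable I, use p in simp)
    finally have "m powr s \<le> (\<integral>g. \<bar>lin_form I v g\<bar> powr p \<partial>gauss I)" by simp
    moreover have "((real k / 2 * V) ^ k) powr s \<le> m powr s"
      using mk s V by (intro powr_mono2) auto
    moreover have "((real k / 2 * V) ^ k) powr s = (real k / 2 * V) powr (p / 2)"
      using k1 Vp by (simp add: powr_realpow[symmetric] powr_powr s_def)
    moreover have "(p / 8 * V) powr (p / 2) \<le> (real k / 2 * V) powr (p / 2)"
      using k4 V p by (intro powr_mono2 mult_right_mono) auto
    moreover have "(p / 8 * V) powr (p / 2) = (p / 8) powr (p / 2) * sqrt V powr p"
    proof -
      have "(p / 8 * V) powr (p / 2) = (p / 8) powr (p / 2) * V powr (p / 2)"
        by (rule powr_mult)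
      also have "V powr (p / 2) = sqrt V powr p"
        using Vp by (simp add: powr_half_sqrt[symmetric] powr_powr)
      finally show ?thesis .
    qed
    ultimately show ?thesis unfolding V_def[symmetric] by linarith
  qed
qed

section \<open>The gradient bounds\<close>

lemma tame_norm_powr_integrable:
  assumes K: "tame d K" and p: "p \<ge> 0"
  shows "integrable (gauss {..<3 * d}) (\<lambda>g. norm (K (Zc d l g)) powr p)"
proof -
  have "integrable (gauss {..<3 * d}) (\<lambda>g. (\<lambda>z. complex_of_real (((cmod (K z))\<^sup>2 + 1) powr (p / 2))) (Zc d l g))"
    by (rule tame_Zc_integrable[OF tame_powr[OF K]]) simp
  then have i: "integrable (gauss {..<3 * d}) (\<lambda>g. ((cmod (K (Zc d l g)))\<^sup>2 + 1) powr (p / 2))"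
    by (simp only: complex_of_real_integrable_eq)
  have [measurable]: "(\<lambda>g. K (Zc d l g)) \<in> borel_measurable (gauss {..<3 * d})"
    by (rule tame_Zc_measurable[OF K])
  show ?thesis
  proof (rule Bochner_Integration.integrable_bound[OF i])
    have "cmod w powr p \<le> ((cmod w)\<^sup>2 + 1) powr (p / 2)" for w
    proof -
      have "cmod w powr p = ((cmod w)\<^sup>2) powr (p / 2)"
        by (cases "w = 0") (auto simp: powr_realpow[symmetric] powr_powr simp del: powr_numeral)
      also have "\<dots> \<le> ((cmod w)\<^sup>2 + 1) powr (p / 2)" using p by (intro powr_mono2) auto
      finally show ?thesis .
    qed
    then show "AE g in gauss {..<3 * d}. norm (norm (K (Zc d l g)) powr p) \<le> norm (((cmod (K (Zc d l g)))\<^sup>2 + 1) powr (p / 2))"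
      by simp
  qed measurable
qed

section \<open>The gradient bounds for one polynomial, through its random directional
  derivative\<close>

context
  fixes d n P Q and p :: real
  assumes Q: "cpoly d Q" and QP: "\<And>x. Q (\<lambda>i. of_real (x i)) = complex_of_real (P x)"
    and bd: "\<exists>c m. c \<ge> 0 \<and> (\<forall>l g. norm (Q (Zc d l g)) \<le> c * (1 + norm l) ^ n * wt {..<3 * d} g ^ m)"
    and line: "\<And>x v. \<exists>H. degree H \<le> n \<and> (\<forall>l. Q (\<lambda>i. x i + l * v i) = poly H l)"
    and n: "n \<ge> 1" and p: "p \<ge> 2"
begin

lemma Q_Zc_0: "Q (Zc d 0 g) = complex_of_real (P g)"
  unfolding Zc_0 by (rule QP)

lemma P_measurable: "P \<in> borel_measurable (gauss {..<d})"
proof -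
  have "(\<lambda>g. Q (\<lambda>i. of_real (g i))) \<in> borel_measurable (gauss {..<d})"
    by (rule tame_measurable[OF cpoly_tame[OF Q]])
       (intro measurable_compose[OF gauss_coord_measurable borel_measurable_of_real] borel_measurable_of_real, auto intro: gauss_coord_measurable)
  then have "(\<lambda>g. Re (complex_of_real (P g))) \<in> borel_measurable (gauss {..<d})"
    unfolding QP by (rule measurable_compose) (intro borel_measurable_continuous_onI continuous_intros)
  then show ?thesis by simp
qed

lemma partial_deriv_measurable: "partial_deriv j P \<in> borel_measurable (gauss {..<d})"
proof -
  have "(\<lambda>g. pd j Q (\<lambda>i. of_real (g i))) \<in> borel_measurable (gauss {..<d})"
    by (rule tame_measurable[OF cpoly_tame[OF cpoly_pd(1)[OF Q]]])
       (auto intro: borel_measurable_of_real gauss_coord_measurable)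
  then have "(\<lambda>g. Re (complex_of_real (partial_deriv j P g))) \<in> borel_measurable (gauss {..<d})"
    unfolding partial_deriv_eq_pd(1)[OF Q QP]
    by (rule measurable_compose) (intro borel_measurable_continuous_onI continuous_intros)
  then show ?thesis by simp
qed

lemma grad_norm_measurable: "grad_norm d P \<in> borel_measurable (gauss {..<d})"
proof -
  have [measurable]: "\<And>j. partial_deriv j P \<in> borel_measurable (gauss {..<d})" by (rule partial_deriv_measurable)
  show ?thesis unfolding grad_norm_def[abs_def] L2_set_def by measurable
qed

lemma P_restrict: "P (restrict g {..<d}) = P g"
proof -
  have "complex_of_real (P (restrict g {..<d})) = complex_of_real (P g)"
    unfolding QP[symmetric] by (rule cpoly_depends[OF Q]) auto
  then show ?thesis by simp
qed

lemma partial_deriv_restrict: "partial_deriv j P (restrict g {..<d}) = partial_deriv j P g"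
proof -
  have "complex_of_real (partial_deriv j P (restrict g {..<d})) = complex_of_real (partial_deriv j P g)"
    unfolding partial_deriv_eq_pd(1)[OF Q QP, symmetric] by (rule cpoly_depends[OF cpoly_pd(1)[OF Q]]) auto
  then show ?thesis by simp
qed

lemma grad_norm_restrict: "grad_norm d P (restrict g {..<d}) = grad_norm d P g"
  unfolding grad_norm_def partial_deriv_restrict ..

lemma sub3: "{..<d} \<subseteq> {..<3 * d}" "finite {..<3 * d}" by auto

lemma marginal_P:
  fixes h :: "real \<Rightarrow> real"
  assumes [measurable]: "h \<in> borel_measurable borel"
  shows "(\<integral>g. h (P g) \<partial>gauss {..<3 * d}) = (\<integral>g. h (P g) \<partial>gauss {..<d})"
  using P_measurable by (intro gauss_marginal[OF sub3]) (auto simp: P_restrict)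

lemma abs_P_powr_integrable: "integrable (gauss {..<3 * d}) (\<lambda>g. ((P g)\<^sup>2 + e) powr (p / 2))" if e: "e > 0"
proof -
  have "integrable (gauss {..<3 * d}) (\<lambda>g. (\<lambda>z. complex_of_real (((cmod (Q z))\<^sup>2 + e) powr (p / 2))) (Zc d 0 g))"
    by (rule tame_Zc_integrable[OF tame_powr[OF cpoly_tame[OF Q] e]])
  then show ?thesis unfolding complex_of_real_integrable_eq Q_Zc_0 by simp
qed

lemma limit_e:
  "(\<lambda>k. \<integral>g. ((P g)\<^sup>2 + 1 / real (Suc k)) powr (p / 2) \<partial>gauss {..<3 * d}) \<longlonglongrightarrow> (\<integral>g. \<bar>P g\<bar> powr p \<partial>gauss {..<3 * d})"
proof (rule integral_dominated_convergence)
  have [measurable]: "P \<in> borel_measurable (gauss {..<3 * d})"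
  proof -
    have "(\<lambda>g. P (restrict g {..<d})) \<in> borel_measurable (gauss {..<3 * d})"
      by (rule measurable_compose[OF measurable_restrict_subset[OF sub3(1)] P_measurable])
    then show ?thesis unfolding P_restrict .
  qed
  show "integrable (gauss {..<3 * d}) (\<lambda>g. ((P g)\<^sup>2 + 1) powr (p / 2))"
    by (rule abs_P_powr_integrable) simp
  show "AE g in gauss {..<3 * d}. (\<lambda>k. ((P g)\<^sup>2 + 1 / real (Suc k)) powr (p / 2)) \<longlonglongrightarrow> \<bar>P g\<bar> powr p"
  proof (rule AE_I2)
    fix g
    have "(\<lambda>k. ((P g)\<^sup>2 + 1 / real (Suc k)) powr (p / 2)) \<longlonglongrightarrow> ((P g)\<^sup>2 + 0) powr (p / 2)"
      using p by (intro tendsto_powr2 tendsto_add tendsto_const LIMSEQ_Suc[OF lim_1_over_n]) auto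
    also have "((P g)\<^sup>2 + 0) powr (p / 2) = \<bar>P g\<bar> powr p"
    proof -
      have "(P g)\<^sup>2 = \<bar>P g\<bar> powr 2" by simp
      then show ?thesis by (simp only: add_0_right powr_powr) simp
    qed
    finally show "(\<lambda>k. ((P g)\<^sup>2 + 1 / real (Suc k)) powr (p / 2)) \<longlonglongrightarrow> \<bar>P g\<bar> powr p" .
  qed
  show "AE g in gauss {..<3 * d}. norm (((P g)\<^sup>2 + 1 / real (Suc k)) powr (p / 2)) \<le> ((P g)\<^sup>2 + 1) powr (p / 2)" for k
    using p by (intro AE_I2) (auto intro!: powr_mono2)
  show "(\<lambda>g. ((P g)\<^sup>2 + 1 / real (Suc k)) powr (p / 2)) \<in> borel_measurable (gauss {..<3 * d})" for k
    by measurable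
  show "(\<lambda>g. \<bar>P g\<bar> powr p) \<in> borel_measurable (gauss {..<3 * d})"
    by measurable
qed

text \<open>For every e > 0 the left-hand side is at most the moment of |Q|^2 + e, to which
  \<open>moment_growth\<close> applies; letting e = 1 / (k + 1) tend to 0 on the right removes the
  shift.\<close>

lemma circle_bound:
  assumes r: "r \<ge> 0"
  shows "(\<integral>g. cmod (Q (Zc d (of_real r * cis t) g)) powr p \<partial>gauss {..<3 * d})
     \<le> (1 + r\<^sup>2) powr (real n * (p / 2)) * (\<integral>g. \<bar>P g\<bar> powr p \<partial>gauss {..<3 * d})"
proof -
  let ?G = "gauss {..<3 * d}"
  obtain c m where c: "c \<ge> 0" and b: "\<And>l g. norm (Q (Zc d l g)) \<le> c * (1 + norm l) ^ n * wt {..<3 * d} g ^ m"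
    using bd by blast
  have p2: "p / 2 \<ge> 1" using p by simp
  have e: "(\<integral>g. cmod (Q (Zc d (of_real r * cis t) g)) powr p \<partial>?G)
     \<le> (1 + r\<^sup>2) powr (real n * (p / 2)) * (\<integral>g. ((P g)\<^sup>2 + e) powr (p / 2) \<partial>?G)" if e: "e > 0" for e
  proof -
    interpret log_convexity d Q e by standard (use Q e in auto)
    have "(\<integral>g. cmod (Q (Zc d (of_real r * cis t) g)) powr p \<partial>?G) \<le> (\<integral>g. q (Zc d (of_real r * cis t) g) powr (p / 2) \<partial>?G)"
    proof (rule integral_mono)
      fix g
      let ?w = "Q (Zc d (of_real r * cis t) g)"
      have "cmod ?w powr p = ((cmod ?w)\<^sup>2) powr (p / 2)"
        by (cases "?w = 0") (auto simp: powr_realpow[symmetric] powr_powr simp del: powr_numeral)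
      also have "\<dots> \<le> q (Zc d (of_real r * cis t) g) powr (p / 2)"
        unfolding q_def using p e by (intro powr_mono2) auto
      finally show "cmod ?w powr p \<le> q (Zc d (of_real r * cis t) g) powr (p / 2)" .
    qed (use p in \<open>auto intro: tame_norm_powr_integrable cpoly_tame[OF Q] q_powr_integrable[OF p2]\<close>)
    also have "\<dots> \<le> (1 + r\<^sup>2) powr (real n * (p / 2)) * (\<integral>g. q (Zc d 0 g) powr (p / 2) \<partial>?G)"
      by (rule moment_growth[OF p2 c b r])
    also have "(\<lambda>g. q (Zc d 0 g)) = (\<lambda>g. (P g)\<^sup>2 + e)"
      unfolding q_def Q_Zc_0 by simp
    finally show ?thesis .
  qed
  show ?thesis
  proof (rule LIMSEQ_le_const[OF tendsto_mult_left[OF limit_e]])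
    show "\<exists>N. \<forall>k\<ge>N. (\<integral>g. cmod (Q (Zc d (of_real r * cis t) g)) powr p \<partial>?G)
      \<le> (1 + r\<^sup>2) powr (real n * (p / 2)) * (\<integral>g. ((P g)\<^sup>2 + 1 / real (Suc k)) powr (p / 2) \<partial>?G)"
      using e by (intro exI[of _ 0]) auto
  qed
qed

text \<open>The linear coefficient of l |-> Q (x + l \<zeta>). For fixed x it is a complex Gaussian
  variable with E |.|^2 = |DP x|^2, so its moments measure the gradient.\<close>

definition dir_deriv :: "(nat \<Rightarrow> real) \<Rightarrow> complex" where
  "dir_deriv g = (\<Sum>j<d. of_real (partial_deriv j P g) * zeta d g j)"

lemma dir_deriv_pointwise:
  assumes r: "r > 0"
  shows "r powr p * cmod (dir_deriv g) powr p
    \<le> (\<Sum>k<Suc n. cmod (Q (Zc d (of_real r * cis (2 * pi * real k / real (Suc n))) g)) powr p) / real (Suc n)"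
proof -
  obtain H where H: "degree H \<le> n" "\<And>l. Q (\<lambda>i. of_real (g i) + l * zeta d g i) = poly H l"
    using line[of "\<lambda>i. of_real (g i)" "zeta d g"] by blast
  have Z: "Q (Zc d l g) = poly H l" for l
    unfolding Zc_def[abs_def] by (rule H(2))
  have "coeff H 1 = dir_deriv g"
    unfolding dir_deriv_def line_coeff[OF Q H(2)] partial_deriv_eq_pd(1)[OF Q QP] ..
  then have "r * cmod (dir_deriv g) \<le> (\<Sum>k<Suc n. cmod (Q (Zc d (of_real r * cis (2 * pi * real k / real (Suc n))) g))) / real (Suc n)"
    unfolding Z using coeff_1_roots_of_unity[OF H(1) n r] by simp
  then have "(r * cmod (dir_deriv g)) powr p \<le> ((\<Sum>k<Suc n. cmod (Q (Zc d (of_real r * cis (2 * pi * real k / real (Suc n))) g))) / real (card {..<Suc n})) powr p"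
    using r p by (intro powr_mono2) auto
  also have "\<dots> \<le> (\<Sum>k<Suc n. cmod (Q (Zc d (of_real r * cis (2 * pi * real k / real (Suc n))) g)) powr p) / real (card {..<Suc n})"
    using p by (intro power_mean) auto
  finally show ?thesis using r by (simp only: powr_mult card_lessThan)
qed

lemma dir_deriv_measurable: "dir_deriv \<in> borel_measurable (gauss {..<3 * d})"
proof -
  have "(\<lambda>g. complex_of_real (partial_deriv j P (restrict g {..<d}))) \<in> borel_measurable (gauss {..<3 * d})" for j
  proof -
    have [measurable]: "(\<lambda>g. partial_deriv j P (restrict g {..<d})) \<in> borel_measurable (gauss {..<3 * d})"
      by (rule measurable_compose[OF measurable_restrict_subset[OF sub3(1)] partial_deriv_measurable])
    show ?thesis by measurable
  qed
  then have "(\<lambda>g. \<Sum>j<d. of_real (partial_deriv j P g) * zeta d g j) \<in> borel_measurable (gauss {..<3 * d})"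
    unfolding partial_deriv_restrict by (intro borel_measurable_sum borel_measurable_times zeta_measurable) auto
  then show ?thesis unfolding dir_deriv_def[abs_def] .
qed

lemma dir_deriv_integrable: "integrable (gauss {..<3 * d}) (\<lambda>g. cmod (dir_deriv g) powr p)"
proof (rule Bochner_Integration.integrable_bound)
  show "integrable (gauss {..<3 * d}) (\<lambda>g. (\<Sum>k<Suc n. cmod (Q (Zc d (of_real 1 * cis (2 * pi * real k / real (Suc n))) g)) powr p) / real (Suc n))"
    using p by (intro integrable_divide Bochner_Integration.integrable_sum tame_norm_powr_integrable cpoly_tame[OF Q]) auto
  show "AE g in gauss {..<3 * d}. norm (cmod (dir_deriv g) powr p) \<le> norm ((\<Sum>k<Suc n. cmod (Q (Zc d (of_real 1 * cis (2 * pi * real k / real (Suc n))) g)) powr p) / real (Suc n))"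
  proof (rule AE_I2)
    fix g
    have "cmod (dir_deriv g) powr p \<le> (\<Sum>k<Suc n. cmod (Q (Zc d (of_real 1 * cis (2 * pi * real k / real (Suc n))) g)) powr p) / real (Suc n)"
      using dir_deriv_pointwise[of 1 g] by (simp only: powr_one_eq_one mult_1 zero_less_one)
    then show "norm (cmod (dir_deriv g) powr p) \<le> norm ((\<Sum>k<Suc n. cmod (Q (Zc d (of_real 1 * cis (2 * pi * real k / real (Suc n))) g)) powr p) / real (Suc n))"
      unfolding real_norm_def abs_of_nonneg[OF powr_ge_zero] by (rule order_trans[OF _ abs_ge_self])
  qed
  show "(\<lambda>g. cmod (dir_deriv g) powr p) \<in> borel_measurable (gauss {..<3 * d})"
    using dir_deriv_measurable by measurable
qed

lemma dir_deriv_upper: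
  assumes r: "r > 0"
  shows "r powr p * (\<integral>g. cmod (dir_deriv g) powr p \<partial>gauss {..<3 * d})
    \<le> (1 + r\<^sup>2) powr (real n * (p / 2)) * (\<integral>g. \<bar>P g\<bar> powr p \<partial>gauss {..<3 * d})"
proof -
  let ?G = "gauss {..<3 * d}" and ?l = "\<lambda>k. of_real r * cis (2 * pi * real k / real (Suc n))"
  let ?B = "(1 + r\<^sup>2) powr (real n * (p / 2)) * (\<integral>g. \<bar>P g\<bar> powr p \<partial>?G)"
  have i: "integrable ?G (\<lambda>g. cmod (Q (Zc d (?l k) g)) powr p)" for k
    using p by (intro tame_norm_powr_integrable cpoly_tame[OF Q]) auto
  have "r powr p * (\<integral>g. cmod (dir_deriv g) powr p \<partial>?G) = (\<integral>g. r powr p * cmod (dir_deriv g) powr p \<partial>?G)"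
    by simp
  also have "\<dots> \<le> (\<integral>g. (\<Sum>k<Suc n. cmod (Q (Zc d (?l k) g)) powr p) / real (Suc n) \<partial>?G)"
    by (intro integral_mono dir_deriv_pointwise r integrable_mult_right dir_deriv_integrable integrable_divide Bochner_Integration.integrable_sum i)
  also have "\<dots> = (\<Sum>k<Suc n. (\<integral>g. cmod (Q (Zc d (?l k) g)) powr p \<partial>?G)) / real (Suc n)"
    by (simp only: integral_divide_zero Bochner_Integration.integral_sum i)
  also have "\<dots> \<le> (\<Sum>k<Suc n. ?B) / real (Suc n)"
    using r by (intro divide_right_mono sum_mono circle_bound) auto
  also have "\<dots> = ?B" by (simp only: sum_constant card_lessThan) simp
  finally show ?thesis .
qed

text \<open>For fixed x the real part is a real Gaussian linear form in the remaining 2 d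
  coordinates, of variance |DP x|^2 / 2. Dropping the imaginary part leaves (1 / sqrt 2)^p times the
  factor (p / 8)^(p/2) of \<open>abs_lin_powr_ge\<close>, which is (p / 16)^(p/2).\<close>

lemma dir_deriv_lower:
  "(p / 16) powr (p / 2) * (\<integral>g. grad_norm d P g powr p \<partial>gauss {..<d}) \<le> (\<integral>g. cmod (dir_deriv g) powr p \<partial>gauss {..<3 * d})"
proof -
  define J where "J = {d..<3 * d}"
  have J: "finite J" "{..<d} \<inter> J = {}" "{..<d} \<union> J = {..<3 * d}" unfolding J_def by auto
  \<comment> \<open>The indices from 2 d on carry the imaginary parts of \<zeta>, which do not enter
    the real part.\<close>
  define v where "v x i = (if i < 2 * d then partial_deriv (i - d) P x else 0)" for x i
  have sumJ: "(\<Sum>i\<in>J. f i) = (\<Sum>j<d. f (d + j))" if "\<And>i. i \<ge> 2 * d \<Longrightarrow> f i = 0" for f :: "nat \<Rightarrow> real"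
  proof -
    have "(\<Sum>i\<in>J. f i) = (\<Sum>i\<in>{d..<2 * d}. f i)"
      unfolding J_def using that by (intro sum.mono_neutral_right) auto
    also have "\<dots> = (\<Sum>j<d. f (d + j))"
      using sum.shift_bounds_nat_ivl[of f 0 d d] by (simp add: lessThan_atLeast0 add.commute mult_2)
    finally show ?thesis .
  qed
  let ?m = "merge {..<d} J"
  have mx: "partial_deriv j P (?m (x, y)) = partial_deriv j P x" for j x y
  proof -
    have "restrict (?m (x, y)) {..<d} = restrict x {..<d}" by (auto simp: restrict_def merge_def)
    then show ?thesis by (metis partial_deriv_restrict)
  qed
  have re: "Re (dir_deriv (?m (x, y))) = lin_form J (v x) y / sqrt 2" for x y
  proof -
    have "Re (dir_deriv (?m (x, y))) = (\<Sum>j<d. partial_deriv j P x * (y (d + j) / sqrt 2))"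
      unfolding dir_deriv_def Re_sum
    proof (intro sum.cong refl)
      fix j assume "j \<in> {..<d}"
      then have "?m (x, y) (d + j) = y (d + j)" by (auto simp: merge_def J_def)
      then show "Re (of_real (partial_deriv j P (?m (x, y))) * zeta d (?m (x, y)) j) = partial_deriv j P x * (y (d + j) / sqrt 2)"
        unfolding mx zeta_eq by simp
    qed
    also have "\<dots> = (\<Sum>i\<in>J. v x i * y i) / sqrt 2"
      by (subst sumJ) (auto simp: v_def sum_divide_distrib)
    finally show ?thesis unfolding lin_form_def .
  qed
  have L2: "sqrt (\<Sum>i\<in>J. (v x i)\<^sup>2) = grad_norm d P x" for x
    unfolding grad_norm_def L2_set_def by (subst sumJ) (auto simp: v_def)
  have inner: "(p / 16) powr (p / 2) * grad_norm d P x powr p \<le> (\<integral>y. cmod (dir_deriv (?m (x, y))) powr p \<partial>gauss J)"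
    if x: "integrable (gauss J) (\<lambda>y. cmod (dir_deriv (?m (x, y))) powr p)" for x
  proof -
    have "(p / 16) powr (p / 2) * grad_norm d P x powr p = (1 / sqrt 2) powr p * ((p / 8) powr (p / 2) * sqrt (\<Sum>i\<in>J. (v x i)\<^sup>2) powr p)"
    proof -
      have "(1 / sqrt 2) powr p = (1 / 2) powr (p / 2)"
        by (simp add: powr_half_sqrt[symmetric] powr_powr powr_divide)
      moreover have "(p / 16) powr (p / 2) = (1 / 2 * (p / 8)) powr (p / 2)" by simp
      ultimately show ?thesis unfolding L2 by (simp only: powr_mult mult.assoc)
    qed
    also have "\<dots> \<le> (1 / sqrt 2) powr p * (\<integral>y. \<bar>lin_form J (v x) y\<bar> powr p \<partial>gauss J)"
      by (intro mult_left_mono abs_lin_powr_ge J p) auto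
    also have "\<dots> = (\<integral>y. (1 / sqrt 2) powr p * \<bar>lin_form J (v x) y\<bar> powr p \<partial>gauss J)" by simp
    also have "\<dots> \<le> (\<integral>y. cmod (dir_deriv (?m (x, y))) powr p \<partial>gauss J)"
    proof (rule integral_mono)
      show "(1 / sqrt 2) powr p * \<bar>lin_form J (v x) y\<bar> powr p \<le> cmod (dir_deriv (?m (x, y))) powr p" for y
      proof -
        have "(1 / sqrt 2 * \<bar>lin_form J (v x) y\<bar>) powr p \<le> cmod (dir_deriv (?m (x, y))) powr p"
          using p abs_Re_le_cmod[of "dir_deriv (?m (x, y))"] unfolding re by (intro powr_mono2) auto
        then show ?thesis by (simp only: powr_mult)
      qed
      show "integrable (gauss J) (\<lambda>y. (1 / sqrt 2) powr p * \<bar>lin_form J (v x) y\<bar> powr p)"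
        using p by (intro integrable_mult_right abs_lin_powr_integrable J) auto
    qed (rule x)
    finally show ?thesis .
  qed
  interpret I1: finite_product_sigma_finite "\<lambda>_::nat. std_normal_distribution" "{..<d}" by standard simp
  interpret I2: finite_product_sigma_finite "\<lambda>_::nat. std_normal_distribution" J by standard (rule J)
  interpret P: pair_sigma_finite "gauss {..<d}" "gauss J" ..
  have m1: "?m \<in> gauss {..<d} \<Otimes>\<^sub>M gauss J \<rightarrow>\<^sub>M gauss {..<3 * d}"
    using measurable_merge[of "{..<d}" J "\<lambda>_. std_normal_distribution"] unfolding J(3) .
  have distr: "distr (gauss {..<d} \<Otimes>\<^sub>M gauss J) (gauss {..<3 * d}) ?m = gauss {..<3 * d}"
    using std_normal_prod.distr_merge[of "{..<d}" J] J by simp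
  have int2: "integrable (gauss {..<d} \<Otimes>\<^sub>M gauss J) (\<lambda>xy. cmod (dir_deriv (?m xy)) powr p)"
    by (rule integrable_distr[OF m1]) (simp add: distr dir_deriv_integrable)
  have "(\<integral>g. cmod (dir_deriv g) powr p \<partial>gauss {..<3 * d}) = (\<integral>x. (\<integral>y. cmod (dir_deriv (?m (x, y))) powr p \<partial>gauss J) \<partial>gauss {..<d})"
    using std_normal_prod.product_integral_fold[of "{..<d}" J "\<lambda>g. cmod (dir_deriv g) powr p"] J dir_deriv_integrable by simp
  \<comment> \<open>By Fubini the inner integral exists for almost every x, and the conditional
    bound is used for those x.\<close>
  also have "\<dots> \<ge> (\<integral>x. (p / 16) powr (p / 2) * grad_norm d P x powr p \<partial>gauss {..<d})"
  proof (rule integral_mono_AE')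
    show "integrable (gauss {..<d}) (\<lambda>x. \<integral>y. cmod (dir_deriv (?m (x, y))) powr p \<partial>gauss J)"
      by (rule P.integrable_fst'[OF int2])
    show "AE x in gauss {..<d}. (p / 16) powr (p / 2) * grad_norm d P x powr p \<le> (\<integral>y. cmod (dir_deriv (?m (x, y))) powr p \<partial>gauss J)"
      using P.AE_integrable_fst'[OF int2] by eventually_elim (rule inner)
  qed simp
  finally show ?thesis by simp
qed

text \<open>The two estimates of the directional derivative combine to D \<le> (16 e n / p)^(p/2) E
  for the p-th powers of the norms. The resulting constant sqrt (16 e) is at most 2 e sqrt 2,
  because e \<ge> 2 gives 16 e \<le> 8 e^2.\<close>

lemma Lp_gradient_bound:
  "gauss_Lp_grad d p P \<le> 2 * exp 1 * sqrt 2 * sqrt (real n / p) * gauss_Lp d p P"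
proof -
  define E where "E = (\<integral>g. \<bar>P g\<bar> powr p \<partial>gauss {..<d})"
  define D where "D = (\<integral>g. grad_norm d P g powr p \<partial>gauss {..<d})"
  have E: "(\<integral>g. \<bar>P g\<bar> powr p \<partial>gauss {..<3 * d}) = E"
    unfolding E_def by (rule marginal_P) measurable
  have E0: "E \<ge> 0" and D0: "D \<ge> 0" unfolding E_def D_def by auto
  have n0: "real n > 0" using n by simp
  \<comment> \<open>This radius turns (1 + r^2)^(n p / 2) into at most e^(p/2), so the dependence on
    n is carried by r^(-p) = n^(p/2).\<close>
  define r where "r = 1 / sqrt (real n)"
  have r: "r > 0" using n0 by (simp add: r_def)
  have r2: "r\<^sup>2 = 1 / real n" using n0 by (simp add: r_def power_divide)
  have rp: "r powr p = (1 / real n) powr (p / 2)"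
  proof -
    have "r powr p = (r powr 2) powr (p / 2)" by (simp add: powr_powr)
    then show ?thesis using r r2 by simp
  qed
  have "(1 / real n) powr (p / 2) * ((p / 16) powr (p / 2) * D) \<le> r powr p * (\<integral>g. cmod (dir_deriv g) powr p \<partial>gauss {..<3 * d})"
    unfolding rp D_def by (intro mult_left_mono dir_deriv_lower) auto
  also have "\<dots> \<le> (1 + r\<^sup>2) powr (real n * (p / 2)) * E"
    using dir_deriv_upper[OF r] unfolding E .
  also have "\<dots> \<le> exp 1 powr (p / 2) * E"
  proof (intro mult_right_mono E0)
    have "(1 + r\<^sup>2) powr (real n * (p / 2)) \<le> exp (1 / real n) powr (real n * (p / 2))"
      unfolding r2 using n0 p by (intro powr_mono2 exp_ge_add_one_self) auto
    also have "\<dots> = exp 1 powr (p / 2)" using n0 by (simp add: powr_def)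
    finally show "(1 + r\<^sup>2) powr (real n * (p / 2)) \<le> exp 1 powr (p / 2)" .
  qed
  also have "(1 / real n) powr (p / 2) * ((p / 16) powr (p / 2) * D) = (p / (16 * real n)) powr (p / 2) * D"
  proof -
    have "p / (16 * real n) = 1 / real n * (p / 16)" by simp
    then show ?thesis by (simp only: powr_mult mult.assoc)
  qed
  finally have 1: "(p / (16 * real n)) powr (p / 2) * D \<le> exp 1 powr (p / 2) * E" .
  have "D = (16 * real n / p * (p / (16 * real n))) powr (p / 2) * D" using n0 p by simp
  also have "\<dots> = (16 * real n / p) powr (p / 2) * ((p / (16 * real n)) powr (p / 2) * D)"
    by (simp only: powr_mult mult.assoc)
  also have "\<dots> \<le> (16 * real n / p) powr (p / 2) * (exp 1 powr (p / 2) * E)"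
    by (intro mult_left_mono 1) auto
  also have "\<dots> = (16 * exp 1 * real n / p) powr (p / 2) * E"
  proof -
    have "16 * exp 1 * real n / p = 16 * real n / p * exp 1" by simp
    then show ?thesis by (simp only: powr_mult mult.assoc)
  qed
  finally have "D powr (1 / p) \<le> ((16 * exp 1 * real n / p) powr (p / 2) * E) powr (1 / p)"
    using D0 p by (intro powr_mono2) auto
  also have "\<dots> = sqrt (16 * exp 1 * real n / p) * E powr (1 / p)"
  proof -
    have "p / 2 * (1 / p) = 1 / 2" "16 * exp 1 * real n / p \<ge> 0" using p by auto
    then show ?thesis by (simp only: powr_mult powr_powr powr_half_sqrt)
  qed
  also have "\<dots> \<le> (2 * exp 1 * sqrt 2 * sqrt (real n / p)) * E powr (1 / p)"
  proof (rule mult_right_mono)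
    have "16 * exp 1 * (real n / p) \<le> (2 * exp 1 * sqrt 2)\<^sup>2 * (real n / p)"
    proof (rule mult_right_mono)
      have "2 \<le> exp (1::real)" using exp_ge_add_one_self[of "1::real"] by simp
      then have "16 * exp 1 \<le> 8 * (exp 1 * exp (1::real))" by simp
      then show "16 * exp 1 \<le> (2 * exp 1 * sqrt 2)\<^sup>2" by (simp add: power_mult_distrib power2_eq_square)
    qed (use p in auto)
    then have "sqrt (16 * exp 1 * (real n / p)) \<le> sqrt ((2 * exp 1 * sqrt 2)\<^sup>2 * (real n / p))"
      by (rule real_sqrt_le_mono)
    also have "\<dots> = sqrt ((2 * exp 1 * sqrt 2)\<^sup>2) * sqrt (real n / p)" by (rule real_sqrt_mult)
    also have "sqrt ((2 * exp 1 * sqrt 2)\<^sup>2) = 2 * exp 1 * sqrt (2 :: real)"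
      by (rule real_sqrt_abs[THEN trans]) simp
    finally show "sqrt (16 * exp 1 * real n / p) \<le> 2 * exp 1 * sqrt 2 * sqrt (real n / p)"
      unfolding times_divide_eq_right .
  qed simp
  finally show ?thesis
    unfolding gauss_Lp_grad_def gauss_Lp_def std_gaussian_def D_def E_def
    by (simp add: grad_norm_def L2_set_nonneg)
qed

lemma L2_gradient_bound:
  "gauss_Lp_grad d 2 P \<le> sqrt (real n) * gauss_Lp d 2 P"
proof -
  let ?G = "gauss {..<3 * d}"
  obtain c m where c: "c \<ge> 0" and b: "\<And>l g. norm (Q (Zc d l g)) \<le> c * (1 + norm l) ^ n * wt {..<3 * d} g ^ m"
    using bd by blast
  have iP: "integrable ?G (\<lambda>g. (P g)\<^sup>2)"
    using tame_norm_powr_integrable[OF cpoly_tame[OF Q], of 2 0] unfolding Q_Zc_0 by simp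
  have iD: "integrable ?G (\<lambda>g. (partial_deriv j P g)\<^sup>2)" for j
    using tame_norm_powr_integrable[OF cpoly_tame[OF cpoly_pd(1)[OF Q, of j]], of 2 0]
    unfolding Zc_0 partial_deriv_eq_pd(1)[OF Q QP] by simp
  interpret prob_space ?G by (rule prob_space_gauss)
  have *: "(\<Sum>j<d. \<integral>g. (partial_deriv j P g)\<^sup>2 \<partial>?G) \<le> real n * ((\<integral>g. (P g)\<^sup>2 \<partial>?G) + e)" if e: "e > 0" for e
  proof -
    interpret log_convexity d Q e by standard (use Q e in auto)
    show ?thesis
      using gradient_L2_growth[OF c b] iP unfolding q_def Q_Zc_0 unfolding Zc_0 partial_deriv_eq_pd(1)[OF Q QP]
      by (simp add: prob_space)
  qed
  have "(\<Sum>j<d. \<integral>g. (partial_deriv j P g)\<^sup>2 \<partial>?G) \<le> real n * (\<integral>g. (P g)\<^sup>2 \<partial>?G)"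
  proof (rule field_le_epsilon)
    fix e :: real assume e: "e > 0"
    show "(\<Sum>j<d. \<integral>g. (partial_deriv j P g)\<^sup>2 \<partial>?G) \<le> real n * (\<integral>g. (P g)\<^sup>2 \<partial>?G) + e"
      using *[of "e / real n"] e n by (simp add: distrib_left)
  qed
  also have "(\<Sum>j<d. \<integral>g. (partial_deriv j P g)\<^sup>2 \<partial>?G) = (\<integral>g. (grad_norm d P g)\<^sup>2 \<partial>?G)"
    unfolding grad_norm_def L2_set_def by (simp add: iD sum_nonneg)
  also have "\<dots> = (\<integral>g. (grad_norm d P g)\<^sup>2 \<partial>gauss {..<d})"
    using grad_norm_measurable by (intro gauss_marginal[OF sub3]) (auto simp: grad_norm_restrict)
  also have "(\<integral>g. (P g)\<^sup>2 \<partial>?G) = (\<integral>g. (P g)\<^sup>2 \<partial>gauss {..<d})"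
    by (rule marginal_P) measurable
  finally have "sqrt (\<integral>g. (grad_norm d P g)\<^sup>2 \<partial>gauss {..<d}) \<le> sqrt (real n * (\<integral>g. (P g)\<^sup>2 \<partial>gauss {..<d}))"
    by (rule real_sqrt_le_mono)
  then show ?thesis
    unfolding gauss_Lp_grad_def gauss_Lp_def std_gaussian_def
    by (simp add: powr_half_sqrt real_sqrt_mult)
qed

end

theorem gradient_bound_Lp:
  assumes "n \<ge> 1" "p \<ge> 2"
  shows "gradient_bound d n p (2 * exp 1 * sqrt 2 * sqrt (real n / p))"
  unfolding gradient_bound_def
proof (intro allI impI)
  fix P assume "poly_fun d n P"
  then obtain Q where Q: "cpoly d Q" "\<And>x. Q (\<lambda>i. of_real (x i)) = of_real (P x)"
    "\<exists>c m. c \<ge> 0 \<and> (\<forall>l g. norm (Q (Zc d l g)) \<le> c * (1 + norm l) ^ n * wt {..<3 * d} g ^ m)"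
    "\<And>x v. \<exists>H. degree H \<le> n \<and> (\<forall>l. Q (\<lambda>i. x i + l * v i) = poly H l)"
    by (rule poly_fun_complexify) (rule that; assumption)
  show "gauss_Lp_grad d p P \<le> 2 * exp 1 * sqrt 2 * sqrt (real n / p) * gauss_Lp d p P"
    by (rule Lp_gradient_bound[OF Q assms])
qed

theorem gradient_bound_L2:
  assumes "n \<ge> 1"
  shows "gradient_bound d n 2 (sqrt (real n))"
  unfolding gradient_bound_def
proof (intro allI impI)
  fix P assume "poly_fun d n P"
  then obtain Q where Q: "cpoly d Q" "\<And>x. Q (\<lambda>i. of_real (x i)) = of_real (P x)"
    "\<exists>c m. c \<ge> 0 \<and> (\<forall>l g. norm (Q (Zc d l g)) \<le> c * (1 + norm l) ^ n * wt {..<3 * d} g ^ m)"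
    "\<And>x v. \<exists>H. degree H \<le> n \<and> (\<forall>l. Q (\<lambda>i. x i + l * v i) = poly H l)"
    by (rule poly_fun_complexify) (rule that; assumption)
  show "gauss_Lp_grad d 2 P \<le> sqrt (real n) * gauss_Lp d 2 P"
    by (rule L2_gradient_bound[OF Q assms order_refl])
qed

section \<open>Optimality for the exponent two\<close>

text \<open>The probabilists' Hermite polynomials, generated by x - d/dx, the adjoint of d/dx in the
  Gaussian L^2 space.\<close>

fun hermite :: "nat \<Rightarrow> real poly" where
  "hermite 0 = 1"
| "hermite (Suc n) = [:0, 1:] * hermite n - pderiv (hermite n)"

lemma pderiv_hermite: "pderiv (hermite (Suc n)) = smult (real (Suc n)) (hermite n)"
proof (induction n)
  case 0
  show ?case by (simp add: pderiv_pCons)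
next
  case (Suc n)
  have "pderiv (hermite (Suc (Suc n))) = [:0, 1:] * pderiv (hermite (Suc n)) + hermite (Suc n) - pderiv (pderiv (hermite (Suc n)))"
    by (simp only: hermite.simps(2)[of "Suc n"] pderiv_diff pderiv_mult) (simp add: pderiv_pCons)
  also have "\<dots> = smult (real (Suc n)) ([:0, 1:] * hermite n - pderiv (hermite n)) + hermite (Suc n)"
    unfolding Suc.IH by (simp only: pderiv_smult mult_smult_right smult_diff_right)
  also have "\<dots> = smult (real (Suc (Suc n))) (hermite (Suc n))"
  proof -
    have "smult (real (Suc (Suc n))) H = smult (real (Suc n)) H + smult 1 H" for H :: "real poly"
      by (simp only: smult_add_left[symmetric]) simp
    then show ?thesis by (simp only: hermite.simps(2)[symmetric] smult_1_left)
  qed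
  finally show ?case .
qed

lemma degree_hermite: "degree (hermite n) \<le> n"
proof (induction n)
  case (Suc n)
  have "degree ([:0, 1:] * hermite n) \<le> Suc n"
    using degree_mult_le[of "[:0, 1:]" "hermite n"] Suc by simp
  moreover have "degree (pderiv (hermite n)) \<le> Suc n" using Suc by (simp add: degree_pderiv)
  ultimately show ?case by (simp only: hermite.simps degree_diff_le)
qed simp

lemma poly_growth: "\<exists>C m. \<forall>x::real. \<bar>poly q x\<bar> \<le> C * (1 + \<bar>x\<bar>) ^ m"
proof (induction q)
  case 0
  show ?case by (auto intro: exI[of _ 0])
next
  case (pCons a q)
  then obtain C m where C: "\<And>x. \<bar>poly q x\<bar> \<le> C * (1 + \<bar>x\<bar>) ^ m" by blast
  have "\<bar>poly (pCons a q) x\<bar> \<le> (\<bar>a\<bar> + C) * (1 + \<bar>x\<bar>) ^ Suc m" for x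
  proof -
    have "\<bar>poly (pCons a q) x\<bar> \<le> \<bar>a\<bar> + \<bar>x\<bar> * \<bar>poly q x\<bar>"
      by (simp add: abs_mult[symmetric] abs_triangle_ineq)
    also have "\<dots> \<le> \<bar>a\<bar> * (1 + \<bar>x\<bar>) ^ Suc m + (1 + \<bar>x\<bar>) * (C * (1 + \<bar>x\<bar>) ^ m)"
      by (intro add_mono mult_mono C mult_left_le[of _ "\<bar>a\<bar>", THEN ord_le_eq_trans] order_trans[OF _ mult_left_mono[OF one_le_power[of "1 + \<bar>x\<bar>" "Suc m"], of "\<bar>a\<bar>"]]) auto
    finally show ?thesis by (simp add: algebra_simps)
  qed
  then show ?case by blast
qed

lemma poly_std_normal_integrable: "integrable std_normal_distribution (poly q)"
proof -
  obtain C m where C: "\<And>x. \<bar>poly q x\<bar> \<le> C * (1 + \<bar>x\<bar>) ^ m" using poly_growth by blast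
  have meas: "poly q \<in> borel_measurable borel" by (intro borel_measurable_continuous_onI continuous_intros)
  show ?thesis
  proof (rule Bochner_Integration.integrable_bound)
    show "integrable std_normal_distribution (\<lambda>x. C * (1 + \<bar>x\<bar>) ^ m)"
      by (intro integrable_mult_right integrable_std_normal_one_plus_abs_power)
    show "AE x in std_normal_distribution. norm (poly q x) \<le> norm (C * (1 + \<bar>x\<bar>) ^ m)"
      using C by (auto intro: order_trans[OF _ abs_ge_self])
  qed (use meas in simp)
qed

lemma poly_ibp: "(\<integral>x. x * poly q x \<partial>std_normal_distribution) = (\<integral>x. poly (pderiv q) x \<partial>std_normal_distribution)"
proof -
  obtain C m where C: "\<And>x. \<bar>poly q x\<bar> \<le> C * (1 + \<bar>x\<bar>) ^ m" using poly_growth by blast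
  obtain C' m' where C': "\<And>x. \<bar>poly (pderiv q) x\<bar> \<le> C' * (1 + \<bar>x\<bar>) ^ m'" using poly_growth by blast
  have "(\<integral>x. x *\<^sub>R poly q x \<partial>std_normal_distribution) = (\<integral>x. poly (pderiv q) x \<partial>std_normal_distribution)"
    by (rule std_normal_ibp[where C = C and m = m and C' = C' and m' = m'])
       (auto simp: has_real_derivative_iff_has_vector_derivative[symmetric] C C' intro!: poly_DERIV continuous_intros)
  then show ?thesis by simp
qed

text \<open>One of the two factors of index n + 1 is expanded by the recursion. Integrating its x by
  parts cancels the term with the derivative of \<open>hermite n\<close> and leaves
  \<open>hermite n\<close> times the derivative of \<open>hermite (Suc n)\<close>, which is n + 1
  times \<open>hermite n\<close>.\<close>

lemma hermite_norm_Suc: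
  "(\<integral>x. (poly (hermite (Suc n)) x)\<^sup>2 \<partial>std_normal_distribution) = real (Suc n) * (\<integral>x. (poly (hermite n) x)\<^sup>2 \<partial>std_normal_distribution)"
proof -
  let ?h = "hermite n" and ?k = "hermite (Suc n)"
  have "(\<integral>x. (poly ?k x)\<^sup>2 \<partial>std_normal_distribution)
      = (\<integral>x. x * poly (?h * ?k) x - poly (pderiv ?h * ?k) x \<partial>std_normal_distribution)"
    by (intro Bochner_Integration.integral_cong refl) (simp add: power2_eq_square algebra_simps)
  also have "\<dots> = (\<integral>x. x * poly (?h * ?k) x \<partial>std_normal_distribution) - (\<integral>x. poly (pderiv ?h * ?k) x \<partial>std_normal_distribution)"
  proof (rule Bochner_Integration.integral_diff[OF _ poly_std_normal_integrable])
    have "(\<lambda>x. x * poly (?h * ?k) x) = poly ([:0, 1:] * (?h * ?k))" by auto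
    then show "integrable std_normal_distribution (\<lambda>x. x * poly (?h * ?k) x)"
      by (simp only: poly_std_normal_integrable)
  qed
  also have "(\<integral>x. x * poly (?h * ?k) x \<partial>std_normal_distribution) = (\<integral>x. poly (smult (real (Suc n)) (?h * ?h)) x + poly (pderiv ?h * ?k) x \<partial>std_normal_distribution)"
    unfolding poly_ibp pderiv_mult pderiv_hermite
    by (intro Bochner_Integration.integral_cong refl) (simp del: hermite.simps add: algebra_simps)
  also have "\<dots> = (\<integral>x. poly (smult (real (Suc n)) (?h * ?h)) x \<partial>std_normal_distribution) + (\<integral>x. poly (pderiv ?h * ?k) x \<partial>std_normal_distribution)"
    by (intro Bochner_Integration.integral_add poly_std_normal_integrable)
  finally show ?thesis by (simp del: hermite.simps add: power2_eq_square)
qed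

lemma hermite_norm_pos: "0 < (\<integral>x. (poly (hermite n) x)\<^sup>2 \<partial>std_normal_distribution)"
proof (induction n)
  case 0
  show ?case using std_normal.prob_space by simp
next
  case (Suc n)
  then show ?case unfolding hermite_norm_Suc by simp
qed

lemma gauss_single:
  fixes f :: "real \<Rightarrow> real"
  assumes "0 < d" and [measurable]: "f \<in> borel_measurable borel"
  shows "(\<integral>g. f (g 0) \<partial>gauss {..<d}) = (\<integral>x. f x \<partial>std_normal_distribution)"
proof -
  have "(\<integral>g. f (g 0) \<partial>gauss {..<d}) = (\<integral>g. f (g 0) \<partial>gauss {0})"
    using assms by (intro gauss_marginal measurable_compose[OF gauss_coord_measurable]) auto
  also have "\<dots> = (\<integral>x. f x \<partial>std_normal_distribution)"
    by (rule std_normal_prod.product_integral_singleton) simp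
  finally show ?thesis .
qed

lemma poly_fun_hermite:
  assumes "d \<ge> 1"
  shows "poly_fun d n (\<lambda>x. poly (hermite n) (x 0))"
  unfolding poly_fun_def
proof (intro exI conjI)
  define e where "e k = (\<lambda>i::nat. if i = 0 then k else 0 :: nat)" for k
  let ?A = "e ` {..n}" and ?a = "\<lambda>m :: nat \<Rightarrow> nat. coeff (hermite n) (m 0)"
  have d: "{..<d} = insert 0 ({..<d} - {0})" using assms by auto
  have s: "(\<Sum>i<d. e k i) = k" for k by (subst d, subst sum.insert) (auto simp: e_def)
  have pr: "(\<Prod>i<d. x i ^ e k i) = x 0 ^ k" for k and x :: "nat \<Rightarrow> real"
    by (subst d, subst prod.insert) (auto simp: e_def intro!: prod.neutral)
  have inj: "inj_on e {..n}" by (rule inj_onI) (auto simp: e_def fun_eq_iff split: if_splits)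
  show "finite ?A" by simp
  show "\<forall>m\<in>?A. (\<Sum>i<d. m i) \<le> n" using s by auto
  show "\<forall>x. poly (hermite n) (x 0) = (\<Sum>m\<in>?A. ?a m * (\<Prod>i<d. x i ^ m i))"
  proof
    fix x :: "nat \<Rightarrow> real"
    have "poly (hermite n) (x 0) = (\<Sum>k\<le>n. coeff (hermite n) k * x 0 ^ k)"
      unfolding poly_altdef using degree_hermite[of n] by (intro sum.mono_neutral_left) (auto simp: coeff_eq_0)
    also have "\<dots> = (\<Sum>m\<in>?A. ?a m * (\<Prod>i<d. x i ^ m i))"
      by (subst sum.reindex[OF inj]) (simp add: pr, simp add: e_def)
    finally show "poly (hermite n) (x 0) = (\<Sum>m\<in>?A. ?a m * (\<Prod>i<d. x i ^ m i))" .
  qed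
qed

text \<open>Equality holds for the n-th Hermite polynomial in a single coordinate, which is
  available in every dimension d \<ge> 1: the squared norm of its derivative is n^2 times that of
  index n - 1, hence n times its own.\<close>

theorem gradient_bound_L2_optimal:
  assumes d: "d \<ge> 1" and n: "n \<ge> 1" and K: "gradient_bound d n 2 K"
  shows "sqrt (real n) \<le> K"
proof -
  let ?P = "\<lambda>x :: nat \<Rightarrow> real. poly (hermite n) (x 0)"
  obtain k where k: "n = Suc k" using n by (cases n) auto
  have pd0: "partial_deriv 0 ?P x = poly (pderiv (hermite n)) (x 0)" for x
    unfolding partial_deriv_def by (rule DERIV_imp_deriv) (simp add: poly_DERIV)
  have pd1: "partial_deriv i ?P x = 0" if "i \<noteq> 0" for i x
    unfolding partial_deriv_def using that by simp
  have gn: "grad_norm d ?P x = \<bar>poly (pderiv (hermite n)) (x 0)\<bar>" for x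
  proof -
    have "(\<Sum>i<d. (partial_deriv i ?P x)\<^sup>2) = (partial_deriv 0 ?P x)\<^sup>2 + (\<Sum>i\<in>{..<d} - {0}. (partial_deriv i ?P x)\<^sup>2)"
      by (subst sum.remove[of "{..<d}" 0]) (use d in auto)
    then show ?thesis unfolding grad_norm_def L2_set_def by (simp add: pd0 pd1)
  qed
  define N where "N = (\<integral>x. (poly (hermite n) x)\<^sup>2 \<partial>std_normal_distribution)"
  have N: "N > 0" unfolding N_def by (rule hermite_norm_pos)
  have d0: "0 < d" using d by simp
  have "(\<integral>x. (poly (pderiv (hermite n)) x)\<^sup>2 \<partial>std_normal_distribution) = real n * N"
    unfolding N_def k hermite_norm_Suc pderiv_hermite
    by (simp only: poly_smult power_mult_distrib integral_mult_right_zero) (simp add: power2_eq_square)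
  then have "gauss_Lp_grad d 2 ?P = sqrt (real n * N)"
    unfolding gauss_Lp_grad_def gauss_Lp_def std_gaussian_def gn
    using gauss_single[OF d0, of "\<lambda>x. (poly (pderiv (hermite n)) x)\<^sup>2"]
    using N by (simp add: powr_half_sqrt borel_measurable_continuous_onI continuous_intros)
  moreover have "gauss_Lp d 2 ?P = sqrt N"
    unfolding gauss_Lp_def std_gaussian_def N_def
    using gauss_single[OF d0, of "\<lambda>x. (poly (hermite n) x)\<^sup>2"]
    by (simp add: powr_half_sqrt borel_measurable_continuous_onI continuous_intros)
  ultimately have "sqrt (real n * N) \<le> K * sqrt N"
    using K poly_fun_hermite[OF d, of n] unfolding gradient_bound_def by metis
  then have "sqrt (real n) * sqrt N \<le> K * sqrt N" by (simp add: real_sqrt_mult)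
  then show ?thesis using N by simp
qed

section \<open>The weighted product measure of a monomial\<close>

lemma abs_powr_le_power: 
  fixes x s :: real
  assumes "0 \<le> s" "s \<le> real N"
  shows "\<bar>x\<bar> powr s \<le> (1 + \<bar>x\<bar>) ^ N"
proof -
  have "\<bar>x\<bar> powr s \<le> (1 + \<bar>x\<bar>) powr s" using assms by (intro powr_mono2) auto
  also have "\<dots> \<le> (1 + \<bar>x\<bar>) powr real N" using assms by (intro powr_mono) auto
  also have "\<dots> = (1 + \<bar>x\<bar>) ^ N" by (intro powr_realpow) auto
  finally show ?thesis .
qed

context
  fixes p :: real
  assumes p: "p > 1"
begin

lemma abs_powr_p_integrable: "integrable std_normal_distribution (\<lambda>x. \<bar>x\<bar> powr p)"
proof (rule Bochner_Integration.integrable_bound)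
  show "integrable std_normal_distribution (\<lambda>x. (1 + \<bar>x\<bar>) ^ nat \<lceil>p\<rceil>)"
    by (rule integrable_std_normal_one_plus_abs_power)
  show "AE x in std_normal_distribution. norm (\<bar>x\<bar> powr p) \<le> norm ((1 + \<bar>x\<bar>) ^ nat \<lceil>p\<rceil>)"
    using p by (intro AE_I2) (simp, rule abs_powr_le_power, auto)
qed measurable

text \<open>For p < 2 the integrand is singular at 0, with exponent p - 2 > -1 by p > 1: on (0, 1)
  the antiderivative x^(p - 1) / (p - 1) settles this, and evenness gives (-1, 1). Outside, |x|^(p -
  2) \<le> |x|^p.\<close>

lemma abs_powr_p2_integrable: "integrable std_normal_distribution (\<lambda>x. \<bar>x\<bar> powr (p - 2))"
proof -
  have "set_integrable lborel (einterval 0 1) (\<lambda>x. x powr (p - 2))"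
  proof (rule interval_integral_FTC_nonneg)
    show "((\<lambda>x. x powr (p - 1) / (p - 1)) has_real_derivative x powr (p - 2)) (at x)" if "0 < ereal x" for x
    proof -
      have "((\<lambda>x. x powr (p - 1) / (p - 1)) has_real_derivative (p - 1) * x powr (p - 1 - 1) / (p - 1)) (at x)"
        using that by (intro DERIV_cdivide has_real_derivative_powr) auto
      then show ?thesis using p by simp
    qed
    show "isCont (\<lambda>x. x powr (p - 2)) x" if "0 < ereal x" for x
      using that by (intro continuous_intros) auto
    show "(((\<lambda>x. x powr (p - 1) / (p - 1)) \<circ> real_of_ereal) \<longlongrightarrow> 0 powr (p - 1) / (p - 1)) (at_right 0)"
      unfolding zero_ereal_def ereal_tendsto_simps using p
      by (intro tendsto_divide tendsto_const tendsto_powr2 tendsto_ident_at) (auto simp: eventually_at_right_less eventually_at_filter)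
    show "(((\<lambda>x. x powr (p - 1) / (p - 1)) \<circ> real_of_ereal) \<longlongrightarrow> 1 powr (p - 1) / (p - 1)) (at_left 1)"
      unfolding one_ereal_def ereal_tendsto_simps using p
      by (intro tendsto_divide tendsto_const tendsto_powr tendsto_ident_at) auto
  qed auto
  moreover have "(\<lambda>x. indicator (einterval 0 1) x *\<^sub>R x powr (p - 2))
      = (\<lambda>x. indicator {0..} x *\<^sub>R (indicator {-1<..<1} x * \<bar>x\<bar> powr (p - 2)))"
    by (auto simp: fun_eq_iff einterval_def indicator_def zero_ereal_def one_ereal_def)
  ultimately have 1: "integrable lborel (\<lambda>x. indicator {0..} x *\<^sub>R (indicator {-1<..<1} x * \<bar>x\<bar> powr (p - 2)))"
    unfolding set_integrable_def by (simp only:)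
  have "indicator {-1<..<1} (- x) * \<bar>- x\<bar> powr (p - 2) = indicator {-1<..<1} x * \<bar>x\<bar> powr (p - 2)" for x :: real
    by (auto simp: indicator_def)
  from has_bochner_integral_even_function[OF has_bochner_integral_integrable[OF 1] this]
  have "integrable lborel (\<lambda>x. indicator {-1<..<1} x * \<bar>x\<bar> powr (p - 2))"
    by (simp only: has_bochner_integral_iff)
  moreover have "integrable lborel (\<lambda>x. std_normal_density x *\<^sub>R (\<bar>x\<bar> powr p))"
    using abs_powr_p_integrable by (subst (asm) integrable_std_normal) auto
  ultimately have "integrable lborel (\<lambda>x. indicator {-1<..<1} x * \<bar>x\<bar> powr (p - 2) + std_normal_density x *\<^sub>R (\<bar>x\<bar> powr p))"
    by (rule Bochner_Integration.integrable_add)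
  then have "integrable lborel (\<lambda>x. std_normal_density x *\<^sub>R (\<bar>x\<bar> powr (p - 2)))"
  proof (rule Bochner_Integration.integrable_bound)
    show "AE x in lborel. norm (std_normal_density x *\<^sub>R (\<bar>x\<bar> powr (p - 2)))
       \<le> norm (indicator {-1<..<1} x * \<bar>x\<bar> powr (p - 2) + std_normal_density x *\<^sub>R (\<bar>x\<bar> powr p))"
    proof (rule AE_I2)
      fix x :: real
      have "std_normal_density x * \<bar>x\<bar> powr (p - 2) \<le> indicator {-1<..<1} x * \<bar>x\<bar> powr (p - 2) + std_normal_density x * \<bar>x\<bar> powr p"
      proof (cases "\<bar>x\<bar> < 1")
        case True
        have "std_normal_density x \<le> 1 / sqrt (2 * pi) * 1"
          unfolding std_normal_density_def by (intro mult_left_mono) auto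
        also have "\<dots> \<le> 1"
          using pi_gt3 by (simp add: real_le_rsqrt)
        finally have "std_normal_density x * \<bar>x\<bar> powr (p - 2) \<le> 1 * \<bar>x\<bar> powr (p - 2)"
          by (intro mult_right_mono) auto
        then show ?thesis using True by (simp add: indicator_def abs_less_iff add_increasing2)
      next
        case False
        then have "\<bar>x\<bar> powr (p - 2) \<le> \<bar>x\<bar> powr p" by (intro powr_mono) auto
        then have "std_normal_density x * \<bar>x\<bar> powr (p - 2) \<le> std_normal_density x * \<bar>x\<bar> powr p"
          by (intro mult_left_mono) auto
        then show ?thesis using False by (simp add: add_increasing)
      qed
      then show "norm (std_normal_density x *\<^sub>R (\<bar>x\<bar> powr (p - 2)))
       \<le> norm (indicator {-1<..<1} x * \<bar>x\<bar> powr (p - 2) + std_normal_density x *\<^sub>R (\<bar>x\<bar> powr p))"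
        by simp
    qed
  qed measurable
  then show ?thesis by (subst integrable_std_normal) auto
qed

definition abs_moment where "abs_moment = (\<integral>x. \<bar>x\<bar> powr p \<partial>std_normal_distribution)"

text \<open>Formally an integration by parts for sgn x |x|^(p - 1), which is not differentiable at 0
  when p < 2. It is therefore carried out on the half-line, where the boundary value at 0 vanishes
  because p > 1, and doubled by evenness. This is the source of the mean 1 / (p - 1) of
  x^(-2).\<close>

lemma abs_moment_eq: "abs_moment = (p - 1) * (\<integral>x. \<bar>x\<bar> powr (p - 2) \<partial>std_normal_distribution)"
proof -
  let ?d = std_normal_density
  define k where "k x = ?d x * ((p - 1) * \<bar>x\<bar> powr (p - 2) - \<bar>x\<bar> powr p)" for x
  have i: "integrable lborel (\<lambda>x. ?d x * \<bar>x\<bar> powr p)" "integrable lborel (\<lambda>x. ?d x * \<bar>x\<bar> powr (p - 2))"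
    using abs_powr_p_integrable abs_powr_p2_integrable by (auto simp: integrable_std_normal)
  have "integrable lborel (\<lambda>x. (p - 1) * (?d x * \<bar>x\<bar> powr (p - 2)) - ?d x * \<bar>x\<bar> powr p)"
    by (intro Bochner_Integration.integrable_diff integrable_mult_right i)
  then have ik: "integrable lborel k" unfolding k_def by (simp add: algebra_simps)
  have sk: "set_integrable lborel (einterval 0 \<infinity>) k"
    unfolding set_integrable_def
    by (rule integrable_mult_indicator[of _ lborel k, simplified, OF _ ik, unfolded real_scaleR_def[symmetric]]) simp
  have "(LBINT x=0..\<infinity>. k x) = 0 - 0"
  proof (rule interval_integral_FTC_integrable)
    show "((\<lambda>x. ?d x * \<bar>x\<bar> powr (p - 1)) has_vector_derivative k x) (at x)" if "0 < ereal x" for x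
    proof -
      have x: "x > 0" using that by simp
      have "((\<lambda>x. c * exp (- x\<^sup>2 / 2)) has_real_derivative - x * (c * exp (- x\<^sup>2 / 2))) (at x)" for c :: real
        by (auto intro!: derivative_eq_intros simp: power2_eq_square)
      then have "(?d has_real_derivative - x * ?d x) (at x)"
        unfolding std_normal_density_def .
      then have "((\<lambda>x. ?d x * x powr (p - 1)) has_real_derivative (- x * ?d x) * x powr (p - 1) + ((p - 1) * x powr (p - 1 - 1)) * ?d x) (at x)"
        using x by (intro DERIV_mult has_real_derivative_powr)
      also have "(- x * ?d x) * x powr (p - 1) + ((p - 1) * x powr (p - 1 - 1)) * ?d x = k x"
      proof -
        have "x * x powr (p - 1) = x powr p" using x by (simp add: powr_mult_base)
        then show ?thesis unfolding k_def using x by (simp add: algebra_simps)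
      qed
      finally have "((\<lambda>x. ?d x * x powr (p - 1)) has_real_derivative k x) (at x)" .
      then have "((\<lambda>x. ?d x * \<bar>x\<bar> powr (p - 1)) has_real_derivative k x) (at x)"
        by (rule has_field_derivative_transform_within_open[where S = "{0<..}"]) (use x in auto)
      then show ?thesis by (simp add: has_real_derivative_iff_has_vector_derivative)
    qed
    show "isCont k x" if "0 < ereal x" for x
      unfolding k_def std_normal_density_def using that by (intro continuous_intros) auto
    show "(((\<lambda>x. ?d x * \<bar>x\<bar> powr (p - 1)) \<circ> real_of_ereal) \<longlongrightarrow> 0) (at_right 0)"
    proof -
      have "((\<lambda>x. ?d x * \<bar>x\<bar> powr (p - 1)) \<longlongrightarrow> ?d 0 * 0 powr (p - 1)) (at_right 0)"
        unfolding std_normal_density_def using p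
        by (intro tendsto_intros tendsto_powr2 tendsto_rabs_zero tendsto_ident_at) auto
      then show ?thesis unfolding zero_ereal_def ereal_tendsto_simps by simp
    qed
    show "(((\<lambda>x. ?d x * \<bar>x\<bar> powr (p - 1)) \<circ> real_of_ereal) \<longlongrightarrow> 0) (at_left \<infinity>)"
    proof -
      have "((\<lambda>x. ?d x *\<^sub>R (\<bar>x\<bar> powr (p - 1))) \<longlongrightarrow> 0) at_top"
      proof (rule std_normal_density_mult_tendsto_0[OF _ filterlim_abs_real])
        show "norm (\<bar>x\<bar> powr (p - 1)) \<le> 1 * (1 + \<bar>x\<bar>) ^ nat \<lceil>p\<rceil>" for x
          using abs_powr_le_power[of "p - 1" "nat \<lceil>p\<rceil>" x] p by (simp, linarith)
      qed
      then show ?thesis unfolding ereal_tendsto_simps by simp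
    qed
  qed (use sk in auto)
  then have "(\<integral>x. indicator {0..} x *\<^sub>R k x \<partial>lborel) = 0"
  proof -
    assume a: "(LBINT x=0..\<infinity>. k x) = 0 - 0"
    have "(\<lambda>x. indicator {0..} x *\<^sub>R k x) = (\<lambda>x. indicator (einterval 0 \<infinity>) x *\<^sub>R k x)"
      by (auto simp: fun_eq_iff einterval_def indicator_def zero_ereal_def k_def)
    then show ?thesis using a by (simp add: interval_lebesgue_integral_def set_lebesgue_integral_def)
  qed
  moreover have "integrable lborel (\<lambda>x. indicator {0..} x *\<^sub>R k x)"
    by (intro integrable_mult_indicator ik) simp
  ultimately have "has_bochner_integral lborel (\<lambda>x. indicator {0..} x *\<^sub>R k x) 0"
    by (simp add: has_bochner_integral_iff)
  then have "has_bochner_integral lborel k (2 *\<^sub>R 0)"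
    by (rule has_bochner_integral_even_function) (simp add: k_def std_normal_density_def)
  then have "integral\<^sup>L lborel k = 0" by (simp add: has_bochner_integral_iff)
  moreover have "integral\<^sup>L lborel k = (\<integral>x. (p - 1) * (?d x * \<bar>x\<bar> powr (p - 2)) - ?d x * \<bar>x\<bar> powr p \<partial>lborel)"
    by (intro Bochner_Integration.integral_cong refl) (simp add: k_def algebra_simps)
  ultimately have "(p - 1) * (\<integral>x. ?d x * \<bar>x\<bar> powr (p - 2) \<partial>lborel) - (\<integral>x. ?d x * \<bar>x\<bar> powr p \<partial>lborel) = 0"
    using i by simp
  then show ?thesis unfolding abs_moment_def by (simp add: integral_std_normal)
qed

lemma std_normal_nonzero: "AE x in std_normal_distribution. x \<noteq> 0"
  using AE_lborel_singleton[of 0] by (subst AE_density) (auto elim: AE_mp)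

lemma abs_moment_pos: "abs_moment > 0"
proof -
  have "abs_moment \<ge> 0" unfolding abs_moment_def by simp
  moreover have "abs_moment \<noteq> 0"
  proof
    assume "abs_moment = 0"
    then have "AE x in std_normal_distribution. \<bar>x\<bar> powr p = 0"
      unfolding abs_moment_def using abs_powr_p_integrable by (subst (asm) integral_nonneg_eq_0_iff_AE) auto
    with std_normal_nonzero have "AE x in std_normal_distribution. False" by eventually_elim auto
    then show False using std_normal.AE_False by simp
  qed
  ultimately show ?thesis by simp
qed

text \<open>Expectations under the product measure with density proportional to
  \<open>\<Prod>\<^sub>i \<bar>x\<^sub>i\<bar>\<^sup>p\<close> (and, for one coordinate, under its marginal).\<close>

definition nu :: "(real \<Rightarrow> real) \<Rightarrow> real" where
  "nu h = (\<integral>x. \<bar>x\<bar> powr p * h x \<partial>std_normal_distribution) / abs_moment"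

definition Wt :: "nat \<Rightarrow> (nat \<Rightarrow> real) \<Rightarrow> real" where
  "Wt N g = (\<Prod>i<N. \<bar>g i\<bar> powr p)"

definition rho :: "nat \<Rightarrow> ((nat \<Rightarrow> real) \<Rightarrow> real) \<Rightarrow> real" where
  "rho N f = (\<integral>g. Wt N g * f g \<partial>gauss {..<N}) / abs_moment ^ N"

definition rho_int :: "nat \<Rightarrow> ((nat \<Rightarrow> real) \<Rightarrow> real) \<Rightarrow> bool" where
  "rho_int N f \<longleftrightarrow> integrable (gauss {..<N}) (\<lambda>g. Wt N g * f g)"

definition nu_int :: "(real \<Rightarrow> real) \<Rightarrow> bool" where
  "nu_int h \<longleftrightarrow> integrable std_normal_distribution (\<lambda>x. \<bar>x\<bar> powr p * h x)"

lemma Wt_nonneg: "Wt N g \<ge> 0"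
  unfolding Wt_def by (simp add: prod_nonneg)

text \<open>Independence of the coordinates under \<open>rho\<close>: weight and integrand both
  factor. The expectations in one or two coordinates are instances with the constant 1 in all other
  places.\<close>

lemma rho_prod:
  assumes "\<And>i. i < N \<Longrightarrow> nu_int (u i)"
  shows "rho_int N (\<lambda>g. \<Prod>i<N. u i (g i))" "rho N (\<lambda>g. \<Prod>i<N. u i (g i)) = (\<Prod>i<N. nu (u i))"
proof -
  have e: "Wt N g * (\<Prod>i<N. u i (g i)) = (\<Prod>i<N. \<bar>g i\<bar> powr p * u i (g i))" for g
    unfolding Wt_def by (simp add: prod.distrib)
  show "rho_int N (\<lambda>g. \<Prod>i<N. u i (g i))"
    unfolding rho_int_def e using assms unfolding nu_int_def
    by (intro std_normal_prod.product_integrable_prod) auto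
  have "(\<integral>g. (\<Prod>i<N. \<bar>g i\<bar> powr p * u i (g i)) \<partial>gauss {..<N}) = (\<Prod>i<N. \<integral>x. \<bar>x\<bar> powr p * u i x \<partial>std_normal_distribution)"
    using assms unfolding nu_int_def by (intro std_normal_prod.product_integral_prod) auto
  then show "rho N (\<lambda>g. \<Prod>i<N. u i (g i)) = (\<Prod>i<N. nu (u i))"
    unfolding rho_def e nu_def by (simp add: prod_dividef)
qed

lemma nu_int_1: "nu_int (\<lambda>_. 1)" and nu_1: "nu (\<lambda>_. 1) = 1"
  unfolding nu_int_def nu_def using abs_powr_p_integrable abs_moment_pos by (auto simp: abs_moment_def)

lemma rho_1: "rho_int N (\<lambda>_. c)" "rho N (\<lambda>_. c) = c"
proof -
  have "rho_int N (\<lambda>_. 1)" "rho N (\<lambda>_. 1) = 1"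
    using rho_prod[of N "\<lambda>_ _. 1"] nu_int_1 nu_1 by auto
  then show "rho_int N (\<lambda>_. c)" "rho N (\<lambda>_. c) = c"
    unfolding rho_int_def rho_def by auto
qed

lemma rho_coord:
  assumes j: "j < N" and h: "nu_int h"
  shows "rho_int N (\<lambda>g. h (g j))" "rho N (\<lambda>g. h (g j)) = nu h"
proof -
  define u where "u i = (if i = j then h else (\<lambda>_. 1))" for i
  have u: "(\<Prod>i<N. u i (g i)) = h (g j)" for g
  proof -
    have "(\<Prod>i<N. u i (g i)) = (\<Prod>i<N. if i = j then h (g j) else 1)" by (intro prod.cong) (auto simp: u_def)
    then show ?thesis using j by simp
  qed
  have v: "(\<Prod>i<N. nu (u i)) = nu h"
  proof -
    have "(\<Prod>i<N. nu (u i)) = (\<Prod>i<N. if i = j then nu h else 1)" by (intro prod.cong) (auto simp: u_def nu_1)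
    then show ?thesis using j by simp
  qed
  have "nu_int (u i)" for i unfolding u_def using h nu_int_1 by auto
  from rho_prod[of N u, OF this] show "rho_int N (\<lambda>g. h (g j))" "rho N (\<lambda>g. h (g j)) = nu h"
    unfolding u v by auto
qed

lemma rho_coord2:
  assumes jk: "j < N" "k < N" "j \<noteq> k" and h: "nu_int h"
  shows "rho_int N (\<lambda>g. h (g j) * h (g k))" "rho N (\<lambda>g. h (g j) * h (g k)) = (nu h)\<^sup>2"
proof -
  define u where "u i = (if i = j \<or> i = k then h else (\<lambda>_. 1))" for i
  have pr: "(\<Prod>i<N. if i = j \<or> i = k then f i else 1) = f j * f k" for f :: "nat \<Rightarrow> real"
  proof -
    have "(\<Prod>i<N. if i = j \<or> i = k then f i else 1) = (\<Prod>i<N. (if i = j then f i else 1) * (if i = k then f i else 1))"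
      using jk by (intro prod.cong) auto
    then show ?thesis using jk by (simp add: prod.distrib)
  qed
  have u: "(\<Prod>i<N. u i (g i)) = h (g j) * h (g k)" for g
    unfolding pr[of "\<lambda>i. h (g i)", symmetric] by (intro prod.cong) (auto simp: u_def)
  have v: "(\<Prod>i<N. nu (u i)) = (nu h)\<^sup>2"
    unfolding power2_eq_square pr[of "\<lambda>i. nu h", symmetric] by (intro prod.cong) (auto simp: u_def nu_1)
  have "nu_int (u i)" for i unfolding u_def using h nu_int_1 by auto
  from rho_prod[of N u, OF this] show "rho_int N (\<lambda>g. h (g j) * h (g k))" "rho N (\<lambda>g. h (g j) * h (g k)) = (nu h)\<^sup>2"
    unfolding u v by auto
qed

lemma rho_int_add: "rho_int N f \<Longrightarrow> rho_int N f' \<Longrightarrow> rho_int N (\<lambda>g. f g + f' g)"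
  and rho_add: "rho_int N f \<Longrightarrow> rho_int N f' \<Longrightarrow> rho N (\<lambda>g. f g + f' g) = rho N f + rho N f'"
  unfolding rho_int_def rho_def distrib_left by (auto simp: add_divide_distrib)

lemma rho_int_cmult: "rho_int N f \<Longrightarrow> rho_int N (\<lambda>g. c * f g)"
  and rho_cmult: "rho N (\<lambda>g. c * f g) = c * rho N f"
  unfolding rho_int_def rho_def by (auto simp: mult.left_commute[of _ c])

lemma rho_int_sum: "(\<And>i. i \<in> I \<Longrightarrow> rho_int N (f i)) \<Longrightarrow> rho_int N (\<lambda>g. \<Sum>i\<in>I. f i g)"
  and rho_sum: "(\<And>i. i \<in> I \<Longrightarrow> rho_int N (f i)) \<Longrightarrow> rho N (\<lambda>g. \<Sum>i\<in>I. f i g) = (\<Sum>i\<in>I. rho N (f i))"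
  unfolding rho_int_def rho_def sum_distrib_left by (auto simp: sum_divide_distrib)

lemma rho_mono_AE:
  assumes "rho_int N f" "rho_int N f'" "AE g in gauss {..<N}. f g \<le> f' g"
  shows "rho N f \<le> rho N f'"
  unfolding rho_def using assms(1,2) unfolding rho_int_def
proof (intro divide_right_mono integral_mono_AE)
  show "AE g in gauss {..<N}. Wt N g * f g \<le> Wt N g * f' g"
    using assms(3) by eventually_elim (simp add: mult_left_mono Wt_nonneg)
qed (use abs_moment_pos in auto)

lemma rho_mono: "rho_int N f \<Longrightarrow> rho_int N f' \<Longrightarrow> (\<And>g. f g \<le> f' g) \<Longrightarrow> rho N f \<le> rho N f'"
  by (rule rho_mono_AE) auto

lemma Wt_measurable [measurable]: "Wt N \<in> borel_measurable (gauss {..<N})"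
proof -
  have "(\<lambda>g. \<Prod>i<N. \<bar>g i\<bar> powr p) \<in> borel_measurable (gauss {..<N})"
    by (intro borel_measurable_prod measurable_compose[OF gauss_coord_measurable]) auto
  then show ?thesis unfolding Wt_def[abs_def] .
qed

lemma rho_int_bound:
  assumes f: "rho_int N f'" and [measurable]: "f \<in> borel_measurable (gauss {..<N})" and b: "\<And>g. \<bar>f g\<bar> \<le> f' g"
  shows "rho_int N f"
  using f unfolding rho_int_def
proof (rule Bochner_Integration.integrable_bound)
  show "AE g in gauss {..<N}. norm (Wt N g * f g) \<le> norm (Wt N g * f' g)"
    using b by (intro AE_I2) (auto simp: abs_mult Wt_nonneg intro!: mult_left_mono order_trans[OF b abs_ge_self])
qed measurable

section \<open>Averages under the weighted product measure and a quantitative weak law of large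
  numbers\<close>

definition avg :: "nat \<Rightarrow> (real \<Rightarrow> real) \<Rightarrow> (nat \<Rightarrow> real) \<Rightarrow> real" where
  "avg N h g = (\<Sum>j<N. h (g j)) / real N"

lemma avg_rho:
  assumes N: "N \<ge> 1" and h: "nu_int h"
  shows "rho_int N (avg N h)" "rho N (avg N h) = nu h"
proof -
  have e: "avg N h = (\<lambda>g. (1 / real N) * (\<Sum>j<N. h (g j)))" unfolding avg_def[abs_def] by auto
  show "rho_int N (avg N h)" unfolding e using h by (intro rho_int_cmult rho_int_sum rho_coord) auto
  have "rho N (\<lambda>g. \<Sum>j<N. h (g j)) = (\<Sum>j<N. nu h)"
    using h by (subst rho_sum) (auto simp: rho_coord)
  then show "rho N (avg N h) = nu h" unfolding e rho_cmult using N by simp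
qed

lemma avg_measurable: "h \<in> borel_measurable borel \<Longrightarrow> avg N h \<in> borel_measurable (gauss {..<N})"
proof -
  assume h: "h \<in> borel_measurable borel"
  have "(\<lambda>g. h (g j)) \<in> borel_measurable (gauss {..<N})" if "j \<in> {..<N}" for j
    by (rule measurable_compose[OF gauss_coord_measurable[OF that] h])
  then have "(\<lambda>g. (\<Sum>j<N. h (g j)) / real N) \<in> borel_measurable (gauss {..<N})"
    by (intro borel_measurable_divide borel_measurable_sum) auto
  then show ?thesis unfolding avg_def[abs_def] .
qed

lemma nu_int_bounded:
  assumes "h \<in> borel_measurable borel" "\<And>x. \<bar>h x\<bar> \<le> M"
  shows "nu_int h"
  unfolding nu_int_def
proof (rule Bochner_Integration.integrable_bound)
  show "integrable std_normal_distribution (\<lambda>x. M * \<bar>x\<bar> powr p)"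
    by (intro integrable_mult_right abs_powr_p_integrable)
  show "AE x in std_normal_distribution. norm (\<bar>x\<bar> powr p * h x) \<le> norm (M * \<bar>x\<bar> powr p)"
    by (intro AE_I2) (auto simp: abs_mult mult.commute intro!: mult_right_mono order_trans[OF assms(2) abs_ge_self])
qed (use assms in measurable)

lemma nu_mono: "nu_int h \<Longrightarrow> nu_int h' \<Longrightarrow> (\<And>x. h x \<le> h' x) \<Longrightarrow> nu h \<le> nu h'"
  unfolding nu_def nu_int_def using abs_moment_pos
  by (intro divide_right_mono integral_mono mult_left_mono) auto

lemma nu_diff_const: "nu_int h \<Longrightarrow> nu_int (\<lambda>x. h x - c) \<and> nu (\<lambda>x. h x - c) = nu h - c"
  using nu_int_1 nu_1 abs_moment_pos abs_powr_p_integrable unfolding nu_int_def nu_def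
  by (auto simp: right_diff_distrib diff_divide_distrib abs_moment_def[symmetric])

text \<open>Distinct coordinates are uncorrelated, so the variance of the average is at most M^2 /
  N. The pointwise inequality |D| \<le> 1 / s + s D^2 with s = sqrt N replaces the Cauchy-Schwarz
  inequality, which is how the 1 + M^2 arises.\<close>

lemma avg_deviation:
  assumes N: "N \<ge> 1" and [measurable]: "h \<in> borel_measurable borel" and h: "\<And>x. 0 \<le> h x" "\<And>x. h x \<le> M"
  shows "rho_int N (\<lambda>g. \<bar>avg N h g - nu h\<bar>)" "rho N (\<lambda>g. \<bar>avg N h g - nu h\<bar>) \<le> (1 + M\<^sup>2) / sqrt (real N)"
proof -
  have nh: "nu_int h" by (rule nu_int_bounded[of _ M]) (use h in auto)
  have nu0: "0 \<le> nu h" unfolding nu_def using h abs_moment_pos by (intro divide_nonneg_nonneg) auto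
  have "nu_int (\<lambda>_. M)" by (rule nu_int_bounded) auto
  moreover have "nu (\<lambda>_. M) = M" unfolding nu_def using abs_moment_pos by (simp add: abs_moment_def[symmetric])
  ultimately have nuM: "nu h \<le> M" using nu_mono[OF nh, of "\<lambda>_. M"] h by auto
  define k where "k x = h x - nu h" for x
  have k: "\<bar>k x\<bar> \<le> M" for x unfolding k_def using h[of x] nu0 nuM by auto
  have [measurable]: "k \<in> borel_measurable borel" unfolding k_def[abs_def] by measurable
  have nk: "nu_int k" "nu k = 0" using nu_diff_const[OF nh] unfolding k_def[abs_def] by auto
  have nk2: "nu_int (\<lambda>x. (k x)\<^sup>2)" "nu (\<lambda>x. (k x)\<^sup>2) \<le> M\<^sup>2"
  proof -
    have b: "\<bar>(k x)\<^sup>2\<bar> \<le> M\<^sup>2" for x using power_mono[OF k[of x], of 2] by simp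
    show "nu_int (\<lambda>x. (k x)\<^sup>2)" by (rule nu_int_bounded[OF _ b]) measurable
    then have "nu (\<lambda>x. (k x)\<^sup>2) \<le> nu (\<lambda>_. M\<^sup>2)" using b by (intro nu_mono nu_int_bounded[of _ "\<bar>M\<^sup>2\<bar>"]) auto
    also have "nu (\<lambda>_. M\<^sup>2) = M\<^sup>2" unfolding nu_def using abs_moment_pos by (simp add: abs_moment_def[symmetric])
    finally show "nu (\<lambda>x. (k x)\<^sup>2) \<le> M\<^sup>2" .
  qed
  define D where "D g = avg N h g - nu h" for g
  have D: "D g = (1 / real N) * (\<Sum>j<N. k (g j))" for g
    unfolding D_def avg_def k_def using N by (simp add: sum_subtractf field_simps)
  have D2: "(D g)\<^sup>2 = (1 / real N)\<^sup>2 * (\<Sum>j<N. \<Sum>i<N. k (g j) * k (g i))" for g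
    unfolding D by (simp only: power_mult_distrib power2_eq_square[of "sum _ _"] sum_product)
  have kk: "rho_int N (\<lambda>g. k (g j) * k (g i))" "rho N (\<lambda>g. k (g j) * k (g i)) = (if i = j then nu (\<lambda>x. (k x)\<^sup>2) else 0)"
    if "j < N" "i < N" for i j
    using rho_coord[OF that(1) nk2(1)] rho_coord2[OF that _ nk(1)] nk(2)
    by (cases "i = j"; auto simp: power2_eq_square)+
  have rD2: "rho_int N (\<lambda>g. (D g)\<^sup>2)"
    unfolding D2 by (intro rho_int_cmult rho_int_sum kk) auto
  have "rho N (\<lambda>g. (D g)\<^sup>2) = (1 / real N)\<^sup>2 * (\<Sum>j<N. \<Sum>i<N. if i = j then nu (\<lambda>x. (k x)\<^sup>2) else 0)"
  proof -
    have "rho N (\<lambda>g. \<Sum>j<N. \<Sum>i<N. k (g j) * k (g i)) = (\<Sum>j<N. rho N (\<lambda>g. \<Sum>i<N. k (g j) * k (g i)))"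
      by (intro rho_sum rho_int_sum kk) auto
    also have "\<dots> = (\<Sum>j<N. \<Sum>i<N. rho N (\<lambda>g. k (g j) * k (g i)))"
      by (intro sum.cong refl rho_sum kk) auto
    also have "\<dots> = (\<Sum>j<N. \<Sum>i<N. if i = j then nu (\<lambda>x. (k x)\<^sup>2) else 0)"
      by (intro sum.cong refl) (simp add: kk)
    finally show ?thesis unfolding D2 rho_cmult by simp
  qed
  also have "\<dots> = nu (\<lambda>x. (k x)\<^sup>2) / real N" using N by (simp add: power2_eq_square)
  finally have vD: "rho N (\<lambda>g. (D g)\<^sup>2) \<le> M\<^sup>2 / real N" using nk2(2) by (simp add: divide_right_mono)
  define s where "s = sqrt (real N)"
  have s: "s > 0" "s\<^sup>2 = real N" using N unfolding s_def by auto
  have pt: "\<bar>D g\<bar> \<le> 1 / s + s * (D g)\<^sup>2" for g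
  proof -
    have "0 \<le> (1 - s * \<bar>D g\<bar>)\<^sup>2" by simp
    then have "2 * (s * \<bar>D g\<bar>) \<le> 1 + s\<^sup>2 * (D g)\<^sup>2" by (simp add: power2_eq_square algebra_simps)
    then have "s * \<bar>D g\<bar> \<le> 1 + s\<^sup>2 * (D g)\<^sup>2" using s(1) by (smt (verit) abs_ge_zero mult_nonneg_nonneg)
    then show ?thesis using s(1) by (simp add: field_simps power2_eq_square)
  qed
  have [measurable]: "avg N h \<in> borel_measurable (gauss {..<N})" by (rule avg_measurable) measurable
  have r2: "rho_int N (\<lambda>g. 1 / s + s * (D g)\<^sup>2)" by (intro rho_int_add rho_int_cmult rho_1 rD2)
  show r: "rho_int N (\<lambda>g. \<bar>avg N h g - nu h\<bar>)"
    by (rule rho_int_bound[OF r2]) (use pt in \<open>auto simp: D_def\<close>)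
  have "rho N (\<lambda>g. \<bar>D g\<bar>) \<le> rho N (\<lambda>g. 1 / s + s * (D g)\<^sup>2)"
    by (rule rho_mono[OF _ r2 pt]) (use r in \<open>simp add: D_def[abs_def]\<close>)
  also have "\<dots> = 1 / s + s * rho N (\<lambda>g. (D g)\<^sup>2)"
    by (subst rho_add) (auto simp: rho_1 rho_cmult intro: rho_int_cmult rD2)
  also have "\<dots> \<le> 1 / s + s * (M\<^sup>2 / real N)" using s(1) vD by (intro add_left_mono mult_left_mono) auto
  also have "\<dots> = (1 + M\<^sup>2) / s" unfolding s(2)[symmetric] using s(1) by (simp add: field_simps power2_eq_square)
  finally show "rho N (\<lambda>g. \<bar>avg N h g - nu h\<bar>) \<le> (1 + M\<^sup>2) / sqrt (real N)" unfolding D_def s_def .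
qed

end

section \<open>The gradient of the product polynomial\<close>

lemma partial_deriv_prod_poly:
  assumes "j < N"
  shows "partial_deriv j (prod_poly N) x = (\<Prod>i\<in>{..<N} - {j}. x i)"
proof -
  have "prod_poly N (x(j := t)) = t * (\<Prod>i\<in>{..<N} - {j}. x i)" for t
    unfolding prod_poly_def using assms by (subst prod.remove[of _ j]) auto
  then show ?thesis unfolding partial_deriv_def
    by (intro DERIV_imp_deriv) (auto intro!: derivative_eq_intros)
qed

lemma poly_fun_prod_poly: "poly_fun N N (prod_poly N)"
  unfolding poly_fun_def prod_poly_def
  by (intro exI[of _ "{\<lambda>_. 1}"] exI[of _ "\<lambda>_. 1"]) simp

lemma grad_norm_prod_poly_bound: "grad_norm N (prod_poly N) g \<le> real N * wt {..<N} g"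
proof -
  have "grad_norm N (prod_poly N) g \<le> (\<Sum>j<N. \<bar>partial_deriv j (prod_poly N) g\<bar>)"
    unfolding grad_norm_def by (rule L2_set_le_sum_abs)
  also have "\<dots> \<le> (\<Sum>j<N. wt {..<N} g)"
  proof (rule sum_mono)
    fix j assume "j \<in> {..<N}"
    then have j: "j < N" by simp
    have "\<bar>partial_deriv j (prod_poly N) g\<bar> = (\<Prod>i\<in>{..<N} - {j}. \<bar>g i\<bar>)"
      unfolding partial_deriv_prod_poly[OF j] by (simp add: abs_prod)
    also have "\<dots> \<le> wt ({..<N} - {j}) g" unfolding wt_def by (intro prod_mono) auto
    also have "\<dots> \<le> (1 + norm (g j)) * wt ({..<N} - {j}) g"
      using wt_pos[of "{..<N} - {j}" g] by (simp add: distrib_right)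
    also have "\<dots> = wt {..<N} g" using wt_upd[of "{..<N}" j g "g j"] j by simp
    finally show "\<bar>partial_deriv j (prod_poly N) g\<bar> \<le> wt {..<N} g" .
  qed
  finally show ?thesis by simp
qed

text \<open>Convexity at U + V = (1 - t) (U / (1 - t)) + t (V / t). For small t the factor of the
  main part U is close to 1, and the price is a large factor on the small part V.\<close>

lemma powr_combine:
  fixes U V t q :: real
  assumes q: "q \<ge> 1" and UV: "U \<ge> 0" "V \<ge> 0" and t: "0 < t" "t < 1"
  shows "(U + V) powr q \<le> (1 - t) powr (1 - q) * U powr q + t powr (1 - q) * V powr q"
proof (cases "U + V = 0")
  case False
  then have m: "U + V > 0" using UV by simp
  have a: "(1 - t) * ((U + V) powr q + q * (U + V) powr (q - 1) * (U / (1 - t) - (U + V))) \<le> (1 - t) * (U / (1 - t)) powr q"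
    using powr_ge_tangent[OF q _ m, of "U / (1 - t)"] UV t by (intro mult_left_mono) auto
  have b: "t * ((U + V) powr q + q * (U + V) powr (q - 1) * (V / t - (U + V))) \<le> t * (V / t) powr q"
    using powr_ge_tangent[OF q _ m, of "V / t"] UV t by (intro mult_left_mono) auto
  define X where "X = q * (U + V) powr (q - 1)"
  have "(1 - t) * ((U + V) powr q + X * (U / (1 - t) - (U + V))) + t * ((U + V) powr q + X * (V / t - (U + V))) = (U + V) powr q"
  proof -
    have "(1 - t) * (U / (1 - t)) = U" "t * (V / t) = V" using t by auto
    moreover have "(1 - t) * (inv_sq + X * (u - m)) + t * (inv_sq + X * (v - m)) = inv_sq + X * ((1 - t) * u + t * v - m)" for inv_sq u v m
      by (simp add: algebra_simps)
    ultimately show ?thesis by simp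
  qed
  then have "(U + V) powr q \<le> (1 - t) * (U / (1 - t)) powr q + t * (V / t) powr q"
    using a b unfolding X_def by linarith
  also have "(1 - t) * (U / (1 - t)) powr q = (1 - t) powr (1 - q) * U powr q"
    using t UV by (simp add: powr_divide powr_diff)
  also have "t * (V / t) powr q = t powr (1 - q) * V powr q"
    using t UV by (simp add: powr_divide powr_diff)
  finally show ?thesis .
qed (use UV in auto)

text \<open>Convexity: the tangent at u lies below the power at m, and its slope is at most that at
  M. The error is linear in |u - m|, the quantity that \<open>avg_deviation\<close>
  controls.\<close>

lemma powr_lipschitz_upper:
  fixes u m M q :: real
  assumes q: "q \<ge> 1" and u: "0 \<le> u" "u \<le> M" and m: "0 \<le> m"
  shows "u powr q \<le> m powr q + q * M powr (q - 1) * \<bar>u - m\<bar>"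
proof (cases "u \<le> m")
  case True
  then have "u powr q \<le> m powr q" using q u by (intro powr_mono2) auto
  then show ?thesis using q by (simp add: add_increasing2)
next
  case False
  then have "u > 0" using m by simp
  from powr_ge_tangent[OF q m this] have "u powr q \<le> m powr q + q * u powr (q - 1) * (u - m)"
    by (simp add: algebra_simps)
  also have "q * u powr (q - 1) * (u - m) \<le> q * M powr (q - 1) * \<bar>u - m\<bar>"
    using False q u by (intro mult_mono mult_left_mono powr_mono2) auto
  finally show ?thesis by simp
qed

text \<open>For u < m the left-hand side is m^(q - 1) u, the chord of a concave power between 0 and
  m. The slope of the chord stays finite, in contrast to the derivative of the power at 0.\<close>

lemma powr_lipschitz_lower:
  fixes u m q :: real
  assumes q: "0 \<le> q" "q \<le> 1" and u: "0 \<le> u" and m: "0 < m"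
  shows "m powr q - m powr (q - 1) * \<bar>u - m\<bar> \<le> u powr q"
proof (cases "m \<le> u")
  case True
  then have "m powr q \<le> u powr q" using q m by (intro powr_mono2) auto
  moreover have "0 \<le> m powr (q - 1) * \<bar>u - m\<bar>" by simp
  ultimately show ?thesis by linarith
next
  case False
  show ?thesis
  proof (cases "u = 0")
    case True
    then show ?thesis using m by (simp add: powr_diff)
  next
    case False
    have "m powr q - m powr (q - 1) * \<bar>u - m\<bar> = m powr (q - 1) * u"
      using \<open>\<not> m \<le> u\<close> m by (simp add: powr_diff field_simps)
    also have "\<dots> \<le> u powr (q - 1) * u"
      using \<open>\<not> m \<le> u\<close> u False q by (intro mult_right_mono powr_mono2') auto
    also have "\<dots> = u powr q" using u False by (simp add: powr_diff)
    finally show ?thesis .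
  qed
qed

section \<open>The norm ratio of the product polynomial as a moment of an average\<close>

context
  fixes p :: real
  assumes p: "p > 1"
begin

abbreviation "rho' \<equiv> rho p"
abbreviation "rho_int' \<equiv> rho_int p"
abbreviation "nu' \<equiv> nu p"
abbreviation "nu_int' \<equiv> nu_int p"

text \<open>As 0 raised to any power by \<open>powr\<close> is 0, the value at 0 is 0. So
  \<open>inv_sq_weight\<close> holds at every point, whereas the gradient formula is stated off the
  coordinate hyperplanes, a null set.\<close>

definition inv_sq :: "real \<Rightarrow> real" where "inv_sq x = \<bar>x\<bar> powr (-2)"
definition prod_ratio :: "nat \<Rightarrow> real" where "prod_ratio N = rho' N (\<lambda>g. avg N inv_sq g powr (p / 2))"
definition trunc :: "real \<Rightarrow> real \<Rightarrow> real" where "trunc M x = min (inv_sq x) M"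
definition excess :: "real \<Rightarrow> real \<Rightarrow> real" where "excess M x = max 0 (inv_sq x - M)"

lemma inv_sq_measurable [measurable]: "inv_sq \<in> borel_measurable borel"
  unfolding inv_sq_def[abs_def] by measurable

lemma trunc_measurable [measurable]: "trunc M \<in> borel_measurable borel"
  unfolding trunc_def[abs_def] by measurable

lemma excess_measurable [measurable]: "excess M \<in> borel_measurable borel"
  unfolding excess_def[abs_def] by measurable

lemma inv_sq_weight: "\<bar>x\<bar> powr p * inv_sq x = \<bar>x\<bar> powr (p - 2)"
  unfolding inv_sq_def by (simp add: powr_add[symmetric])

lemma nu_int_inv_sq: "nu_int' inv_sq"
  unfolding nu_int_def[OF p] inv_sq_weight by (rule abs_powr_p2_integrable[OF p])

lemma nu_inv_sq: "nu' inv_sq = 1 / (p - 1)"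
  using abs_moment_eq[OF p] abs_moment_pos[OF p] p unfolding nu_def[OF p] inv_sq_weight by (simp add: field_simps)

lemma avg_nonneg: "(\<And>x. 0 \<le> h x) \<Longrightarrow> 0 \<le> avg N h g"
  unfolding avg_def[OF p] by (simp add: sum_nonneg)

lemma inv_sq_nonneg: "0 \<le> inv_sq x"
  unfolding inv_sq_def by simp

lemma grad_norm_prod_poly_eq:
  assumes N: "N \<ge> 1" and g: "\<And>i. i < N \<Longrightarrow> g i \<noteq> 0"
  shows "grad_norm N (prod_poly N) g powr p = real N powr (p / 2) * (Wt p N g * avg N inv_sq g powr (p / 2))"
proof -
  define Pi where "Pi = (\<Prod>i<N. \<bar>g i\<bar>)"
  have Pi: "Pi > 0" unfolding Pi_def using g by (intro prod_pos) auto
  have "(partial_deriv j (prod_poly N) g)\<^sup>2 = Pi\<^sup>2 * inv_sq (g j)" if j: "j < N" for j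
  proof -
    have "Pi = \<bar>g j\<bar> * (\<Prod>i\<in>{..<N} - {j}. \<bar>g i\<bar>)"
      unfolding Pi_def using j by (subst prod.remove[of _ j]) auto
    then have "\<bar>partial_deriv j (prod_poly N) g\<bar> = Pi / \<bar>g j\<bar>"
      unfolding partial_deriv_prod_poly[OF j] using g[OF j] by (simp add: abs_prod)
    then have "\<bar>partial_deriv j (prod_poly N) g\<bar>\<^sup>2 = (Pi / \<bar>g j\<bar>)\<^sup>2" by simp
    then show ?thesis using g[OF j] by (simp add: inv_sq_def powr_minus power_mult_distrib power_inverse divide_inverse)
  qed
  then have "(\<Sum>j<N. (partial_deriv j (prod_poly N) g)\<^sup>2) = Pi\<^sup>2 * (real N * avg N inv_sq g)"
  proof -
    assume "\<And>j. j < N \<Longrightarrow> (partial_deriv j (prod_poly N) g)\<^sup>2 = Pi\<^sup>2 * inv_sq (g j)"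
    moreover have "real N * avg N inv_sq g = (\<Sum>j<N. inv_sq (g j))" unfolding avg_def[OF p] using N by simp
    ultimately show ?thesis by (simp add: sum_distrib_left)
  qed
  moreover have "0 \<le> avg N inv_sq g" by (rule avg_nonneg[OF inv_sq_nonneg])
  ultimately have "grad_norm N (prod_poly N) g = (Pi\<^sup>2 * (real N * avg N inv_sq g)) powr (1 / 2)"
    unfolding grad_norm_def L2_set_def by (simp add: powr_half_sqrt)
  then have "grad_norm N (prod_poly N) g powr p = (Pi\<^sup>2 * (real N * avg N inv_sq g)) powr (p / 2)"
    by (simp add: powr_powr)
  also have "\<dots> = (Pi\<^sup>2) powr (p / 2) * (real N powr (p / 2) * avg N inv_sq g powr (p / 2))"
    by (simp only: powr_mult)
  also have "(Pi\<^sup>2) powr (p / 2) = Pi powr p" using Pi by (simp add: powr_realpow[symmetric] powr_powr del: powr_numeral)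
  also have "Pi powr p = Wt p N g" unfolding Pi_def Wt_def[OF p] by (simp add: prod_powr_distrib)
  finally show ?thesis by (simp add: mult_ac)
qed

lemma AE_nonzero: "AE g in gauss {..<N}. \<forall>i\<in>{..<N}. g i \<noteq> 0"
  by (intro eventually_ball_finite ballI AE_PiM_component std_normal_nonzero[OF p] std_normal.prob_space_axioms) auto

lemma grad_norm_prod_poly_AE:
  assumes N: "N \<ge> 1"
  shows "AE g in gauss {..<N}. grad_norm N (prod_poly N) g powr p = real N powr (p / 2) * (Wt p N g * avg N inv_sq g powr (p / 2))"
  using AE_nonzero by eventually_elim (rule grad_norm_prod_poly_eq[OF N], auto)

lemma grad_norm_prod_poly_measurable: "grad_norm N (prod_poly N) \<in> borel_measurable (gauss {..<N})"
proof -
  have "(\<lambda>g. sqrt (\<Sum>j<N. (\<Prod>i\<in>{..<N} - {j}. g i)\<^sup>2)) \<in> borel_measurable (gauss {..<N})"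
    by (intro measurable_compose[OF _ borel_measurable_sqrt] borel_measurable_sum borel_measurable_power borel_measurable_prod gauss_coord_measurable) auto
  also have "(\<lambda>g. sqrt (\<Sum>j<N. (\<Prod>i\<in>{..<N} - {j}. g i)\<^sup>2)) = grad_norm N (prod_poly N)"
    unfolding grad_norm_def[abs_def] L2_set_def
    by (intro ext arg_cong[of _ _ sqrt] sum.cong) (auto simp: partial_deriv_prod_poly)
  finally show ?thesis .
qed

lemma grad_norm_prod_poly_integrable: "integrable (gauss {..<N}) (\<lambda>g. grad_norm N (prod_poly N) g powr p)"
proof -
  define k where "k = nat \<lceil>p\<rceil>"
  have k: "p \<le> real k" unfolding k_def by linarith
  have [measurable]: "grad_norm N (prod_poly N) \<in> borel_measurable (gauss {..<N})"
    by (rule grad_norm_prod_poly_measurable)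
  show ?thesis
  proof (rule integrable_gauss_wt_bound)
    fix g :: "nat \<Rightarrow> real"
    have g0: "0 \<le> grad_norm N (prod_poly N) g" unfolding grad_norm_def by (rule L2_set_nonneg)
    have "grad_norm N (prod_poly N) g \<le> (1 + real N) * wt {..<N} g"
      using grad_norm_prod_poly_bound[of N g] wt_pos[of "{..<N}" g] by (simp add: distrib_right)
    then have "grad_norm N (prod_poly N) g powr p \<le> ((1 + real N) * wt {..<N} g) powr p"
      using p g0 by (intro powr_mono2) auto
    also have "\<dots> \<le> ((1 + real N) * wt {..<N} g) powr real k"
      using k mult_ge1_I[of "1 + real N" "wt {..<N} g"] wt_ge_1[of "{..<N}" g] by (intro powr_mono) auto
    also have "\<dots> = (1 + real N) ^ k * wt {..<N} g ^ k"
      using wt_pos[of "{..<N}" g] by (simp add: powr_realpow power_mult_distrib)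
    finally show "norm (grad_norm N (prod_poly N) g powr p) \<le> (1 + real N) ^ k * wt {..<N} g ^ k" by simp
  qed auto
qed

lemma avg_inv_sq_measurable [measurable]: "avg N inv_sq \<in> borel_measurable (gauss {..<N})"
  by (rule avg_measurable[OF p]) measurable

lemma rho_int_SQ:
  assumes N: "N \<ge> 1"
  shows "rho_int' N (\<lambda>g. avg N inv_sq g powr (p / 2))"
proof -
  have [measurable]: "Wt p N \<in> borel_measurable (gauss {..<N})" by (rule Wt_measurable[OF p])
  have "integrable (gauss {..<N}) (\<lambda>g. real N powr (p / 2) * (Wt p N g * avg N inv_sq g powr (p / 2)))"
    by (rule integrable_cong_AE_imp[OF grad_norm_prod_poly_integrable]) (use grad_norm_prod_poly_AE[OF N] in \<open>auto elim: AE_mp\<close>)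
  then have "integrable (gauss {..<N}) (\<lambda>g. (1 / real N powr (p / 2)) * (real N powr (p / 2) * (Wt p N g * avg N inv_sq g powr (p / 2))))"
    by (rule integrable_mult_right)
  then show ?thesis unfolding rho_int_def[OF p] using N by simp
qed

text \<open>The p-th power of the norm of the product is \<open>abs_moment p ^ N\<close>, the
  normalising constant of \<open>rho\<close>; division by it turns the gradient moment into an
  expectation under \<open>rho\<close>, with sqrt N taken out.\<close>

lemma ratio_eq:
  assumes N: "N \<ge> 1"
  shows "gauss_Lp N p (prod_poly N) > 0"
    and "gauss_Lp_grad N p (prod_poly N) / gauss_Lp N p (prod_poly N) = sqrt (real N) * prod_ratio N powr (1 / p)"
proof -
  have abs_moment: "abs_moment p ^ N > 0" using abs_moment_pos[OF p] by simp
  have "(\<integral>g. \<bar>prod_poly N g\<bar> powr p \<partial>gauss {..<N}) = (\<integral>g. Wt p N g * 1 \<partial>gauss {..<N})"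
    unfolding prod_poly_def Wt_def[OF p] by (simp add: abs_prod prod_powr_distrib)
  also have "\<dots> = abs_moment p ^ N"
    using rho_1(2)[OF p, of N 1] abs_moment unfolding rho_def[OF p] by simp
  finally have L: "gauss_Lp N p (prod_poly N) = (abs_moment p ^ N) powr (1 / p)"
    unfolding gauss_Lp_def std_gaussian_def by simp
  then show pos: "gauss_Lp N p (prod_poly N) > 0" using abs_moment_pos[OF p] by simp
  have R0: "prod_ratio N \<ge> 0" unfolding prod_ratio_def rho_def[OF p] using abs_moment Wt_nonneg[OF p] by (intro divide_nonneg_nonneg Bochner_Integration.integral_nonneg) auto
  have [measurable]: "Wt p N \<in> borel_measurable (gauss {..<N})" "grad_norm N (prod_poly N) \<in> borel_measurable (gauss {..<N})"
    by (rule Wt_measurable[OF p], rule grad_norm_prod_poly_measurable)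
  have "(\<integral>g. \<bar>grad_norm N (prod_poly N) g\<bar> powr p \<partial>gauss {..<N}) = (\<integral>g. grad_norm N (prod_poly N) g powr p \<partial>gauss {..<N})"
    by (simp add: grad_norm_def L2_set_nonneg)
  also have "\<dots> = (\<integral>g. real N powr (p / 2) * (Wt p N g * avg N inv_sq g powr (p / 2)) \<partial>gauss {..<N})"
    by (rule integral_cong_AE[OF _ _ grad_norm_prod_poly_AE[OF N]]) measurable
  also have "\<dots> = real N powr (p / 2) * (prod_ratio N * abs_moment p ^ N)"
    unfolding prod_ratio_def rho_def[OF p] using abs_moment_pos[OF p] by simp
  finally have "gauss_Lp_grad N p (prod_poly N) = (real N powr (p / 2) * (prod_ratio N * abs_moment p ^ N)) powr (1 / p)"
    unfolding gauss_Lp_grad_def gauss_Lp_def std_gaussian_def by simp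
  also have "\<dots> = sqrt (real N) * (prod_ratio N powr (1 / p) * (abs_moment p ^ N) powr (1 / p))"
  proof -
    have "(real N powr (p / 2)) powr (1 / p) = sqrt (real N)"
      using p by (simp add: powr_powr powr_half_sqrt)
    then show ?thesis by (simp only: powr_mult)
  qed
  finally show "gauss_Lp_grad N p (prod_poly N) / gauss_Lp N p (prod_poly N) = sqrt (real N) * prod_ratio N powr (1 / p)"
    using pos unfolding L by simp
qed

lemma rho_int_lin: "N \<ge> 1 \<Longrightarrow> rho_int' N (\<lambda>g. a + b * (avg N inv_sq g - c))"
  and rho_lin: "N \<ge> 1 \<Longrightarrow> rho' N (\<lambda>g. a + b * (avg N inv_sq g - c)) = a + b * (1 / (p - 1) - c)"
proof -
  assume N: "N \<ge> 1"
  note r = avg_rho[OF p N nu_int_inv_sq] rho_1[OF p, of N]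
  have e: "(\<lambda>g. a + b * (avg N inv_sq g - c)) = (\<lambda>g. (a - b * c) + b * avg N inv_sq g)" by (auto simp: algebra_simps)
  show "rho_int' N (\<lambda>g. a + b * (avg N inv_sq g - c))" unfolding e by (intro rho_int_add[OF p] rho_int_cmult[OF p] r)
  show "rho' N (\<lambda>g. a + b * (avg N inv_sq g - c)) = a + b * (1 / (p - 1) - c)"
    unfolding e by (subst rho_add[OF p]) (auto intro!: rho_int_cmult[OF p] r simp: r rho_cmult[OF p] nu_inv_sq algebra_simps)
qed

text \<open>The tangent of the convex power p / 2 at the mean 1 / (p - 1) of the average; the linear
  term has expectation zero. For p \<le> 2 the power is concave and \<open>prod_ratio_le\<close>
  holds instead, so for each p one half of the limit comes with every N.\<close>

lemma prod_ratio_ge: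
  assumes p2: "p \<ge> 2" and N: "N \<ge> 1"
  shows "(1 / (p - 1)) powr (p / 2) \<le> prod_ratio N"
proof -
  define c where "c = 1 / (p - 1)"
  have c: "c > 0" using p by (simp add: c_def)
  have "rho' N (\<lambda>g. c powr (p / 2) + p / 2 * c powr (p / 2 - 1) * (avg N inv_sq g - c)) \<le> prod_ratio N"
    unfolding prod_ratio_def
    by (intro rho_mono[OF p] rho_int_lin N rho_int_SQ powr_ge_tangent c avg_nonneg inv_sq_nonneg) (use p2 in auto)
  then show ?thesis unfolding rho_lin[OF N] c_def by simp
qed

lemma prod_ratio_le:
  assumes p2: "p \<le> 2" and N: "N \<ge> 1"
  shows "prod_ratio N \<le> (1 / (p - 1)) powr (p / 2)"
proof -
  define c where "c = 1 / (p - 1)"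
  have c: "c > 0" using p by (simp add: c_def)
  have "prod_ratio N \<le> rho' N (\<lambda>g. c powr (p / 2) + p / 2 * c powr (p / 2 - 1) * (avg N inv_sq g - c))"
    unfolding prod_ratio_def
    by (intro rho_mono[OF p] rho_int_lin N rho_int_SQ powr_le_tangent_at c avg_nonneg inv_sq_nonneg) (use p p2 in auto)
  then show ?thesis unfolding rho_lin[OF N] c_def by simp
qed

section \<open>Truncation of \<open>inv_sq\<close> at level M and the limit of the ratio\<close>

lemma trunc_bounds: "M \<ge> 0 \<Longrightarrow> 0 \<le> trunc M x" "trunc M x \<le> M" "trunc M x \<le> inv_sq x"
  unfolding trunc_def using inv_sq_nonneg[of x] by auto

lemma nu_int_trunc: "M \<ge> 0 \<Longrightarrow> nu_int' (trunc M)"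
  by (rule nu_int_bounded[OF p, of _ M]) (use trunc_bounds in auto)

lemma nu_trunc_le: "M \<ge> 0 \<Longrightarrow> nu' (trunc M) \<le> 1 / (p - 1)"
  unfolding nu_inv_sq[symmetric] by (intro nu_mono[OF p] nu_int_trunc nu_int_inv_sq trunc_bounds)

lemma nu_trunc_nonneg: "M \<ge> 0 \<Longrightarrow> nu' (trunc M) \<ge> 0"
  unfolding nu_def[OF p] using trunc_bounds abs_moment_pos[OF p] by (intro divide_nonneg_nonneg) auto

lemma nu_trunc_lim: "(\<lambda>n. nu' (trunc (real n))) \<longlonglongrightarrow> 1 / (p - 1)"
proof -
  have "(\<lambda>n. \<integral>x. \<bar>x\<bar> powr p * trunc (real n) x \<partial>std_normal_distribution) \<longlonglongrightarrow> (\<integral>x. \<bar>x\<bar> powr p * inv_sq x \<partial>std_normal_distribution)"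
  proof (rule integral_dominated_convergence)
    show "integrable std_normal_distribution (\<lambda>x. \<bar>x\<bar> powr p * inv_sq x)"
      using nu_int_inv_sq unfolding nu_int_def[OF p] .
    show "AE x in std_normal_distribution. (\<lambda>n. \<bar>x\<bar> powr p * trunc (real n) x) \<longlonglongrightarrow> \<bar>x\<bar> powr p * inv_sq x"
    proof (rule AE_I2)
      fix x
      have "\<forall>\<^sub>F n in sequentially. trunc (real n) x = inv_sq x"
        using eventually_ge_at_top[of "nat \<lceil>inv_sq x\<rceil>"] 
      proof eventually_elim
        case (elim n)
        then have "inv_sq x \<le> real n" by linarith
        then show ?case by (simp add: trunc_def)
      qed
      then show "(\<lambda>n. \<bar>x\<bar> powr p * trunc (real n) x) \<longlonglongrightarrow> \<bar>x\<bar> powr p * inv_sq x"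
        by (intro tendsto_mult tendsto_const tendsto_eventually)
    qed
    show "AE x in std_normal_distribution. norm (\<bar>x\<bar> powr p * trunc (real n) x) \<le> \<bar>x\<bar> powr p * inv_sq x" for n
      using trunc_bounds[of "real n"] by (intro AE_I2) (auto simp: abs_mult intro!: mult_left_mono)
  qed measurable
  then have "(\<lambda>n. nu' (trunc (real n))) \<longlonglongrightarrow> nu' inv_sq"
    unfolding nu_def[OF p] using abs_moment_pos[OF p] by (intro tendsto_divide tendsto_const) auto
  then show ?thesis unfolding nu_inv_sq .
qed

text \<open>The weight |x|^p exactly compensates the singularity |x|^(-p) of \<open>inv_sq\<close>
  raised to p / 2. The constant 1 is thus a dominating function for all truncation levels, which
  makes the contribution of the excess vanish in the limit.\<close>

lemma excess_powr_weight:
  assumes "M \<ge> 0"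
  shows "\<bar>x\<bar> powr p * excess M x powr (p / 2) \<le> 1"
proof -
  have "excess M x powr (p / 2) \<le> inv_sq x powr (p / 2)"
    unfolding excess_def using assms p inv_sq_nonneg[of x] by (intro powr_mono2) auto
  also have "inv_sq x powr (p / 2) = \<bar>x\<bar> powr (- p)" unfolding inv_sq_def by (simp add: powr_powr)
  finally have "\<bar>x\<bar> powr p * excess M x powr (p / 2) \<le> \<bar>x\<bar> powr p * \<bar>x\<bar> powr (- p)"
    by (intro mult_left_mono) auto
  also have "\<dots> \<le> 1" by (simp add: powr_add[symmetric])
  finally show ?thesis .
qed

lemma nu_int_excess: "M \<ge> 0 \<Longrightarrow> nu_int' (\<lambda>x. excess M x powr (p / 2))"
  unfolding nu_int_def[OF p]
proof (rule Bochner_Integration.integrable_bound)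
  show "integrable std_normal_distribution (\<lambda>_. 1 :: real)" by simp
  show "M \<ge> 0 \<Longrightarrow> AE x in std_normal_distribution. norm (\<bar>x\<bar> powr p * excess M x powr (p / 2)) \<le> norm (1 :: real)"
    using excess_powr_weight by (intro AE_I2) (auto simp: abs_mult)
qed measurable

lemma nu_excess_lim: "(\<lambda>n. nu' (\<lambda>x. excess (real n) x powr (p / 2))) \<longlonglongrightarrow> 0"
proof -
  have "(\<lambda>n. \<integral>x. \<bar>x\<bar> powr p * excess (real n) x powr (p / 2) \<partial>std_normal_distribution) \<longlonglongrightarrow> (\<integral>x. 0 \<partial>std_normal_distribution)"
  proof (rule integral_dominated_convergence)
    show "integrable std_normal_distribution (\<lambda>_. 1 :: real)" by simp
    show "AE x in std_normal_distribution. (\<lambda>n. \<bar>x\<bar> powr p * excess (real n) x powr (p / 2)) \<longlonglongrightarrow> 0"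
    proof (rule AE_I2)
      fix x
      have "\<forall>\<^sub>F n in sequentially. excess (real n) x = 0"
        using eventually_ge_at_top[of "nat \<lceil>inv_sq x\<rceil>"] 
      proof eventually_elim
        case (elim n)
        then have "inv_sq x \<le> real n" by linarith
        then show ?case by (simp add: excess_def)
      qed
      then have "\<forall>\<^sub>F n in sequentially. \<bar>x\<bar> powr p * excess (real n) x powr (p / 2) = 0"
        by eventually_elim simp
      then show "(\<lambda>n. \<bar>x\<bar> powr p * excess (real n) x powr (p / 2)) \<longlonglongrightarrow> 0"
        by (rule tendsto_eventually)
    qed
    show "AE x in std_normal_distribution. norm (\<bar>x\<bar> powr p * excess (real n) x powr (p / 2)) \<le> 1" for n
      using excess_powr_weight[of "real n"] by (intro AE_I2) (auto simp: abs_mult)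
  qed measurable
  then have "(\<lambda>n. nu' (\<lambda>x. excess (real n) x powr (p / 2))) \<longlonglongrightarrow> 0 / abs_moment p"
    unfolding nu_def[OF p] using abs_moment_pos[OF p] by (intro tendsto_divide tendsto_const) auto
  then show ?thesis by simp
qed

lemma avg_trunc_bounds:
  assumes "M \<ge> 0" "N \<ge> 1"
  shows "0 \<le> avg N (trunc M) g" "avg N (trunc M) g \<le> M" "avg N (trunc M) g \<le> avg N inv_sq g"
    "avg N inv_sq g = avg N (trunc M) g + avg N (excess M) g"
proof -
  show "0 \<le> avg N (trunc M) g" by (intro avg_nonneg trunc_bounds assms)
  have "(\<Sum>j<N. trunc M (g j)) \<le> (\<Sum>j<N. M)" by (intro sum_mono trunc_bounds)
  then show "avg N (trunc M) g \<le> M" unfolding avg_def[OF p] using assms by (simp add: divide_le_eq mult.commute)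
  show "avg N (trunc M) g \<le> avg N inv_sq g" unfolding avg_def[OF p] by (intro divide_right_mono sum_mono trunc_bounds) auto
  have "inv_sq x = trunc M x + excess M x" for x unfolding trunc_def excess_def by auto
  then show "avg N inv_sq g = avg N (trunc M) g + avg N (excess M) g"
    unfolding avg_def[OF p] by (simp add: sum.distrib add_divide_distrib)
qed

text \<open>\<open>powr_combine\<close> separates the truncated average from the average of the
  excess. The former stays in [0, M], where the power is Lipschitz and \<open>avg_deviation\<close>
  applies; the latter is handled by the power mean inequality, which gives a bound independent of
  N.\<close>

lemma prod_ratio_upper_trunc:
  assumes p2: "p \<ge> 2" and N: "N \<ge> 1" and M: "M \<ge> 0" and t: "0 < t" "t < 1"
  shows "prod_ratio N \<le> (1 - t) powr (1 - p / 2) * ((1 / (p - 1)) powr (p / 2) + p / 2 * M powr (p / 2 - 1) * ((1 + M\<^sup>2) / sqrt (real N)))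
      + t powr (1 - p / 2) * nu' (\<lambda>x. excess M x powr (p / 2))"
proof -
  define q where "q = p / 2"
  have q: "q \<ge> 1" using p2 by (simp add: q_def)
  define \<theta> where "\<theta> = nu' (trunc M)"
  have \<theta>: "0 \<le> \<theta>" "\<theta> \<le> 1 / (p - 1)" unfolding \<theta>_def using nu_trunc_nonneg nu_trunc_le M by auto
  define A B C where "A = (1 - t) powr (1 - q)" and "B = t powr (1 - q)" and "C = q * M powr (q - 1)"
  have AB: "A \<ge> 0" "B \<ge> 0" "C \<ge> 0" unfolding A_def B_def C_def using q by auto
  let ?k = "\<lambda>x. excess M x powr q"
  note dev = avg_deviation[OF p N trunc_measurable trunc_bounds(1)[OF M] trunc_bounds(2), folded \<theta>_def]
  note ex = avg_rho[OF p N nu_int_excess[OF M], folded q_def]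
  let ?f = "\<lambda>g. A * (\<theta> powr q + C * \<bar>avg N (trunc M) g - \<theta>\<bar>) + B * avg N ?k g"
  have rf: "rho_int' N ?f"
    by (intro rho_int_add[OF p] rho_int_cmult[OF p] rho_1(1)[OF p] dev(1) ex(1))
  have pt: "avg N inv_sq g powr q \<le> ?f g" for g
  proof -
    have e0: "0 \<le> avg N (excess M) g" by (intro avg_nonneg) (simp add: excess_def)
    have "avg N inv_sq g powr q \<le> A * avg N (trunc M) g powr q + B * avg N (excess M) g powr q"
      unfolding avg_trunc_bounds(4)[OF M N] A_def B_def
      by (rule powr_combine[OF q _ e0 t]) (rule avg_trunc_bounds[OF M N])
    also have "avg N (trunc M) g powr q \<le> \<theta> powr q + C * \<bar>avg N (trunc M) g - \<theta>\<bar>"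
      unfolding C_def by (rule powr_lipschitz_upper[OF q avg_trunc_bounds(1,2)[OF M N] \<theta>(1)])
    also have "avg N (excess M) g powr q \<le> avg N ?k g"
    proof -
      have "{..<N} \<noteq> {}" using N by (auto simp: lessThan_empty_iff)
      then show ?thesis using power_mean[of "{..<N}" "\<lambda>j. excess M (g j)" q] q
        unfolding avg_def[OF p] by (auto simp: excess_def)
    qed
    finally show ?thesis using AB by (simp add: mult_left_mono add_mono)
  qed
  have "prod_ratio N \<le> rho' N ?f"
    unfolding prod_ratio_def q_def[symmetric]
    by (rule rho_mono[OF p _ rf pt]) (use rho_int_SQ[OF N] in \<open>simp add: q_def\<close>)
  also have "rho' N ?f = A * (\<theta> powr q + C * rho' N (\<lambda>g. \<bar>avg N (trunc M) g - \<theta>\<bar>)) + B * nu' ?k"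
    by (simp only: rho_add[OF p] rho_int_add[OF p] rho_int_cmult[OF p] rho_1[OF p] rho_cmult[OF p] dev(1) ex)
  also have "\<dots> \<le> A * ((1 / (p - 1)) powr q + C * ((1 + M\<^sup>2) / sqrt (real N))) + B * nu' ?k"
    using \<theta> q by (intro add_mono mult_left_mono AB dev powr_mono2) auto
  finally show ?thesis unfolding A_def B_def C_def q_def .
qed

text \<open>For a lower bound the excess may be discarded. The chord estimate is anchored at the
  mean of the truncated variable, so this mean has to be positive, which holds at high levels since
  it tends to 1 / (p - 1).\<close>

lemma prod_ratio_lower_trunc:
  assumes p2: "p \<le> 2" and N: "N \<ge> 1" and M: "M \<ge> 0" and \<theta>: "nu' (trunc M) > 0"
  shows "nu' (trunc M) powr (p / 2) - nu' (trunc M) powr (p / 2 - 1) * ((1 + M\<^sup>2) / sqrt (real N)) \<le> prod_ratio N"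
proof -
  define q where "q = p / 2"
  have q: "0 \<le> q" "q \<le> 1" using p2 p by (auto simp: q_def)
  define \<theta> where "\<theta> = nu' (trunc M)"
  have \<theta>0: "\<theta> > 0" using \<theta> by (simp add: \<theta>_def)
  note dev = avg_deviation[OF p N trunc_measurable trunc_bounds(1)[OF M] trunc_bounds(2), folded \<theta>_def]
  let ?f = "\<lambda>g. \<theta> powr q + (- (\<theta> powr (q - 1))) * \<bar>avg N (trunc M) g - \<theta>\<bar>"
  have rf: "rho_int' N ?f" by (intro rho_int_add[OF p] rho_int_cmult[OF p] rho_1(1)[OF p] dev(1))
  have pt: "?f g \<le> avg N inv_sq g powr q" for g
  proof -
    have "\<theta> powr q - \<theta> powr (q - 1) * \<bar>avg N (trunc M) g - \<theta>\<bar> \<le> avg N (trunc M) g powr q"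
      by (rule powr_lipschitz_lower[OF q avg_trunc_bounds(1)[OF M N] \<theta>0])
    also have "\<dots> \<le> avg N inv_sq g powr q"
      using q avg_trunc_bounds[OF M N, of g] by (intro powr_mono2) auto
    finally show ?thesis by simp
  qed
  have "\<theta> powr q - \<theta> powr (q - 1) * ((1 + M\<^sup>2) / sqrt (real N)) \<le> \<theta> powr q + (- (\<theta> powr (q - 1))) * rho' N (\<lambda>g. \<bar>avg N (trunc M) g - \<theta>\<bar>)"
  proof -
    have "\<theta> powr (q - 1) * rho' N (\<lambda>g. \<bar>avg N (trunc M) g - \<theta>\<bar>) \<le> \<theta> powr (q - 1) * ((1 + M\<^sup>2) / sqrt (real N))"
      by (intro mult_left_mono dev(2)) auto
    then show ?thesis unfolding mult_minus_left by linarith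
  qed
  also have "\<dots> = rho' N ?f"
    by (simp only: rho_add[OF p] rho_int_cmult[OF p] rho_1[OF p] rho_cmult[OF p] dev(1))
  also have "\<dots> \<le> prod_ratio N"
    unfolding prod_ratio_def q_def[symmetric]
    by (rule rho_mono[OF p rf _ pt]) (use rho_int_SQ[OF N] in \<open>simp add: q_def\<close>)
  finally show ?thesis unfolding q_def \<theta>_def .
qed

lemma inv_sqrt_lim: "(\<lambda>N. D / sqrt (real N)) \<longlonglongrightarrow> 0"
  by (intro tendsto_divide_0[OF tendsto_const] filterlim_at_top_imp_at_infinity
      filterlim_compose[OF sqrt_at_top filterlim_real_sequentially])

text \<open>Jensen's inequality gives one side, depending on the position of p relative to 2. On the
  other side the parameters are fixed in turn, t (only for p > 2), then the level n, and finally N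
  tends to infinity, so that each error is small against constants already chosen.\<close>

lemma prod_ratio_lim: "prod_ratio \<longlonglongrightarrow> (1 / (p - 1)) powr (p / 2)"
proof (rule order_tendstoI)
  let ?c = "1 / (p - 1)" and ?q = "p / 2"
  have N1: "\<forall>\<^sub>F N in sequentially. N \<ge> (1::nat)" by (rule eventually_ge_at_top)
  have c: "?c > 0" using p by simp
  show "\<forall>\<^sub>F N in sequentially. x < prod_ratio N" if x: "x < ?c powr ?q" for x
  proof (cases "p \<ge> 2")
    case True
    from N1 show ?thesis by eventually_elim (use prod_ratio_ge[OF True] x in fastforce)
  next
    case False
    have "(\<lambda>n. nu' (trunc (real n)) powr ?q) \<longlonglongrightarrow> ?c powr ?q"
      using c by (intro tendsto_powr nu_trunc_lim tendsto_const) auto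
    from order_tendstoD(1)[OF this x] order_tendstoD(1)[OF nu_trunc_lim c]
    have "\<forall>\<^sub>F n in sequentially. x < nu' (trunc (real n)) powr ?q \<and> 0 < nu' (trunc (real n))"
      by (rule eventually_conj)
    then obtain n where n: "x < nu' (trunc (real n)) powr ?q" "0 < nu' (trunc (real n))"
      by (auto simp: eventually_sequentially)
    let ?\<theta> = "nu' (trunc (real n))"
    have "(\<lambda>N. ?\<theta> powr ?q - ?\<theta> powr (?q - 1) * ((1 + (real n)\<^sup>2) / sqrt (real N))) \<longlonglongrightarrow> ?\<theta> powr ?q - ?\<theta> powr (?q - 1) * 0"
      by (intro tendsto_diff tendsto_mult tendsto_const inv_sqrt_lim)
    then have "\<forall>\<^sub>F N in sequentially. x < ?\<theta> powr ?q - ?\<theta> powr (?q - 1) * ((1 + (real n)\<^sup>2) / sqrt (real N))"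
      by (rule order_tendstoD(1)) (use n in simp)
    with N1 show ?thesis
    proof eventually_elim
      case (elim N)
      then show ?case using prod_ratio_lower_trunc[of N "real n"] False n(2) by simp
    qed
  qed
  show "\<forall>\<^sub>F N in sequentially. prod_ratio N < x" if x: "?c powr ?q < x" for x
  proof (cases "p \<le> 2")
    case True
    from N1 show ?thesis by eventually_elim (use prod_ratio_le[OF True] x in fastforce)
  next
    case False
    have "((\<lambda>t. (1 - t) powr (1 - ?q) * ?c powr ?q) \<longlongrightarrow> (1 - 0) powr (1 - ?q) * ?c powr ?q) (at_right 0)"
      by (intro tendsto_mult tendsto_powr tendsto_diff tendsto_const tendsto_ident_at) auto
    then have "\<forall>\<^sub>F t in at_right 0. (1 - t) powr (1 - ?q) * ?c powr ?q < x"
      by (rule order_tendstoD(2)) (use x in simp)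
    moreover have "\<forall>\<^sub>F t :: real in at_right 0. t < 1 \<and> 0 < t"
      by (intro eventually_conj eventually_at_right_less order_tendstoD(2)[OF tendsto_ident_at]) auto
    ultimately have "\<forall>\<^sub>F t in at_right 0. (1 - t) powr (1 - ?q) * ?c powr ?q < x \<and> t < 1 \<and> 0 < t"
      by (rule eventually_conj)
    then obtain t where t: "(1 - t) powr (1 - ?q) * ?c powr ?q < x" "0 < t" "t < 1"
      using eventually_happens'[OF trivial_limit_at_right_real[of 0]] by blast
    \<comment> \<open>The possibly large factor t powr (1 - p / 2) is fixed by now, so a high
      truncation level n can absorb it.\<close>
    let ?\<delta> = "\<lambda>n. nu' (\<lambda>y. excess (real n) y powr ?q)"
    have "(\<lambda>n. (1 - t) powr (1 - ?q) * ?c powr ?q + t powr (1 - ?q) * ?\<delta> n) \<longlonglongrightarrow> (1 - t) powr (1 - ?q) * ?c powr ?q + t powr (1 - ?q) * 0"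
      by (intro tendsto_add tendsto_mult tendsto_const nu_excess_lim)
    then have "\<forall>\<^sub>F n in sequentially. (1 - t) powr (1 - ?q) * ?c powr ?q + t powr (1 - ?q) * ?\<delta> n < x"
      by (rule order_tendstoD(2)) (use t in simp)
    then obtain n where n: "(1 - t) powr (1 - ?q) * ?c powr ?q + t powr (1 - ?q) * ?\<delta> n < x"
      by (auto simp: eventually_sequentially)
    have "(\<lambda>N. (1 - t) powr (1 - ?q) * (?c powr ?q + ?q * real n powr (?q - 1) * ((1 + (real n)\<^sup>2) / sqrt (real N))) + t powr (1 - ?q) * ?\<delta> n)
        \<longlonglongrightarrow> (1 - t) powr (1 - ?q) * (?c powr ?q + ?q * real n powr (?q - 1) * 0) + t powr (1 - ?q) * ?\<delta> n"
      by (intro tendsto_add tendsto_mult tendsto_const inv_sqrt_lim)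
    then have "\<forall>\<^sub>F N in sequentially. (1 - t) powr (1 - ?q) * (?c powr ?q + ?q * real n powr (?q - 1) * ((1 + (real n)\<^sup>2) / sqrt (real N))) + t powr (1 - ?q) * ?\<delta> n < x"
      by (rule order_tendstoD(2)) (use n in simp)
    with N1 show ?thesis
    proof eventually_elim
      case (elim N)
      then show ?case using prod_ratio_upper_trunc[of N "real n" t] False t by simp
    qed
  qed
qed

lemma sqrt_c: "((1 / (p - 1)) powr (p / 2)) powr (1 / p) = 1 / sqrt (p - 1)"
  using p by (simp add: powr_powr powr_half_sqrt real_sqrt_divide)

lemma prod_poly_ratio_ge:
  assumes p2: "p \<ge> 2" and N: "N \<ge> 1"
  shows "sqrt (real N / (p - 1)) \<le> gauss_Lp_grad N p (prod_poly N) / gauss_Lp N p (prod_poly N)"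
proof -
  have "((1 / (p - 1)) powr (p / 2)) powr (1 / p) \<le> prod_ratio N powr (1 / p)"
    using prod_ratio_ge[OF p2 N] p by (intro powr_mono2) auto
  then have "sqrt (real N) * (1 / sqrt (p - 1)) \<le> sqrt (real N) * prod_ratio N powr (1 / p)"
    unfolding sqrt_c by (intro mult_left_mono) auto
  then show ?thesis unfolding ratio_eq(2)[OF N] by (simp add: real_sqrt_divide)
qed

lemma prod_poly_ratio_lim:
  "(\<lambda>N. gauss_Lp_grad N p (prod_poly N) / (sqrt (real N) * gauss_Lp N p (prod_poly N))) \<longlonglongrightarrow> 1 / sqrt (p - 1)"
proof -
  have "(\<lambda>N. prod_ratio N powr (1 / p)) \<longlonglongrightarrow> ((1 / (p - 1)) powr (p / 2)) powr (1 / p)"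
    using p by (intro tendsto_powr prod_ratio_lim tendsto_const) auto
  then have "(\<lambda>N. prod_ratio N powr (1 / p)) \<longlonglongrightarrow> 1 / sqrt (p - 1)" unfolding sqrt_c .
  moreover have "\<forall>\<^sub>F N in sequentially. prod_ratio N powr (1 / p) = gauss_Lp_grad N p (prod_poly N) / (sqrt (real N) * gauss_Lp N p (prod_poly N))"
    using eventually_ge_at_top[of "1::nat"]
  proof eventually_elim
    case (elim N)
    have "gauss_Lp_grad N p (prod_poly N) / (sqrt (real N) * gauss_Lp N p (prod_poly N))
       = (gauss_Lp_grad N p (prod_poly N) / gauss_Lp N p (prod_poly N)) / sqrt (real N)" by simp
    then show ?case unfolding ratio_eq(2)[OF elim] using elim by simp
  qed
  ultimately show ?thesis by (rule Lim_transform_eventually)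
qed

end

theorem proposition5p1:
  shows
    "(\<forall>(d::nat)\<ge>1. \<forall>(n::nat)\<ge>1.
        gradient_bound d n 2 (sqrt (real n)) \<and>
        (\<forall>K::real. gradient_bound d n 2 K \<longrightarrow> sqrt (real n) \<le> K))
   \<and> (\<forall>(N::nat)\<ge>1. \<forall>(p::real)\<ge>2.
        gauss_Lp_grad N p (prod_poly N) / gauss_Lp N p (prod_poly N) \<ge> sqrt (real N / (p - 1)))
   \<and> (\<forall>(p::real)>1.
        (\<lambda>N::nat. gauss_Lp_grad N p (prod_poly N) / (sqrt (real N) * gauss_Lp N p (prod_poly N)))
          \<longlonglongrightarrow> 1 / sqrt (p - 1))
   \<and> (\<forall>(d::nat)\<ge>1. \<forall>(n::nat)\<ge>1. \<forall>(p::real)\<ge>2.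
        gradient_bound d n p (2 * exp 1 * sqrt 2 * sqrt (real n / p)))
   \<and> (\<exists>c::real. c > 0 \<and>
        (\<forall>(n::nat)\<ge>1. \<forall>(p::real)\<ge>2. \<forall>K::real.
           (\<forall>(d::nat)\<ge>1. gradient_bound d n p K) \<longrightarrow> K \<ge> c * sqrt (real n / p)))"
proof (intro conjI allI impI exI[of _ "1 :: real"])
  fix n :: nat and p K :: real
  assume n: "n \<ge> 1" and p: "p \<ge> 2" and K: "\<forall>(d::nat)\<ge>1. gradient_bound d n p K"
  have p1: "p > 1" using p by simp
  \<comment> \<open>The dimension may depend on n, so the product of n coordinates in dimension n is
    an admissible test of degree n. It forces K \<ge> sqrt (n / (p - 1)) \<ge> sqrt (n / p), hence
    the universal constant 1.\<close>
  have "gauss_Lp_grad n p (prod_poly n) \<le> K * gauss_Lp n p (prod_poly n)"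
    using K n poly_fun_prod_poly unfolding gradient_bound_def by blast
  then have "gauss_Lp_grad n p (prod_poly n) / gauss_Lp n p (prod_poly n) \<le> K"
    using ratio_eq(1)[OF p1 n] by (simp add: divide_le_eq)
  moreover have "sqrt (real n / p) \<le> sqrt (real n / (p - 1))"
    using p by (intro real_sqrt_le_mono divide_left_mono) auto
  ultimately show "1 * sqrt (real n / p) \<le> K"
    using prod_poly_ratio_ge[OF p1 p n] by linarith
qed (auto intro: gradient_bound_L2 gradient_bound_L2_optimal gradient_bound_Lp prod_poly_ratio_ge prod_poly_ratio_lim)

end
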